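(* If $\mathcal L$ is a finitary biframe, then its assembly $\mathsf A(\mathcal L)$ is a finitary biframe.
   Context: A biframe is a triple $\mathcal L=(L^+,L^-,L)$ of frames with injective frame maps $e_L^{\pm}:L^{\pm}\to L$ such that every element of $L$ (the main component) is a join of elements $e_L^+(x^+)\wedge e_L^-(x^-)$; we identify $x^{\pm}$ with $e_L^{\pm}(x^{\pm})$. A relation $R$ on a frame is treated as a set of inequalities: the quotient by $R$ is the universal frame quotient $q$ with $q(a)\le q(b)$ for $(a,b)\in R$; the congruence generated by $R$ is the kernel of $q$. $\mathsf{fin}(L)\subseteq L$ is the set of finite joins of elements $x^+\wedge x^-$; a congruence on $L$ is finitary if generated by some $R\subseteq\mathsf{fin}(L)\times\mathsf{fin}(L)$. With $L^+\oplus L^-$ the frame coproduct and $C_L$ the kernel of the canonical surjection $L^+\oplus L^-\to L$, $\mathcal L$ is finitary if $C_L$ is a finitary congruence on $L^+\oplus L^-$ (the main component of $(L^+,L^-,L^+\oplus L^-)$). $\mathsf A(L)$ is the frame of congruences on $L$ ordered by inclusion; $\nabla(a)=\{(x,y):x\vee a=y\vee a\}$, $\Delta(a)=\{(x,y):x\wedge a=y\wedge a\}$. The assembly $\mathsf A(\mathcal L)$ is the biframe (with inclusions as the two injections) whose positive, negative and main components are the subframes of $\mathsf A(L)$ generated respectively by $\{\nabla(a^+):a^+\in L^+\}\cup\{\Delta(a^-):a^-\in L^-\}$, by $\{\nabla(a^-):a^-\in L^-\}\cup\{\Delta(a^+):a^+\in L^+\}$, and by $\{\nabla(x):x\in L\}\cup\{\Delta(s):s\in\mathsf{fin}(L)\}$.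 *)

theory Defs
  imports "HOL-Algebra.Complete_Lattice"
begin

section \<open>Frames, frame maps and congruences\<close>

locale frame = complete_lattice L for L (structure) +
  assumes meet_Sup_distrib:
    "\<lbrakk>a \<in> carrier L; A \<subseteq> carrier L\<rbrakk> \<Longrightarrow> a \<sqinter> \<Squnion>A = \<Squnion>((\<lambda>x. a \<sqinter> x) ` A)"

definition frame_map :: "'a gorder \<Rightarrow> 'b gorder \<Rightarrow> ('a \<Rightarrow> 'b) \<Rightarrow> bool" where
  "frame_map L M f \<longleftrightarrow> frame L \<and> frame M \<and> f \<in> carrier L \<rightarrow> carrier M
     \<and> sup_pres L M f \<and> meet_pres L M f \<and> f \<top>\<^bsub>L\<^esub> = \<top>\<^bsub>M\<^esub>"

definition frame_kernel :: "'a gorder \<Rightarrow> ('a \<Rightarrow> 'b) \<Rightarrow> ('a \<times> 'a) set" where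
  "frame_kernel L f = {(x, y). x \<in> carrier L \<and> y \<in> carrier L \<and> f x = f y}"

definition frame_congruence :: "'a gorder \<Rightarrow> ('a \<times> 'a) set \<Rightarrow> bool" where
  "frame_congruence L \<theta> \<longleftrightarrow> equiv (carrier L) \<theta>
     \<and> (\<forall>(x, y) \<in> \<theta>. \<forall>(u, v) \<in> \<theta>. (x \<sqinter>\<^bsub>L\<^esub> u, y \<sqinter>\<^bsub>L\<^esub> v) \<in> \<theta>)
     \<and> (\<forall>S \<subseteq> \<theta>. (\<Squnion>\<^bsub>L\<^esub>(fst ` S), \<Squnion>\<^bsub>L\<^esub>(snd ` S)) \<in> \<theta>)"

definition quotient_frame :: "'a gorder \<Rightarrow> ('a \<times> 'a) set \<Rightarrow> 'a set gorder" where
  "quotient_frame L \<theta> = \<lparr>carrier = carrier L // \<theta>, eq = (=),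
     le = (\<lambda>X Y. \<exists>x \<in> X. \<exists>y \<in> Y. x \<sqsubseteq>\<^bsub>L\<^esub> y)\<rparr>"

text \<open>
  A relation \<open>R\<close> is read as a set of inequalities: the congruence generated by \<open>R\<close> is
  the least one whose quotient map \<open>q\<close> satisfies \<open>q a \<le> q b\<close> for \<open>(a, b) \<in> R\<close>.
  The lemma \<open>quotient_universal\<close> below shows that this \<open>q\<close> is the universal frame map
  with that property, and that its kernel is the generated congruence.
\<close>

definition congruence_generated :: "'a gorder \<Rightarrow> ('a \<times> 'a) set \<Rightarrow> ('a \<times> 'a) set" where
  "congruence_generated L R = \<Inter>{\<theta>. frame_congruence L \<theta>
     \<and> (\<forall>(a, b) \<in> R. \<theta> `` {a} \<sqsubseteq>\<^bsub>quotient_frame L \<theta>\<^esub> \<theta> `` {b})}"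


section \<open>Frame coproducts\<close>

text \<open>
  The coproduct of \<open>L\<close> and \<open>M\<close> is realised by the usual ideals of \<open>L \<times> M\<close>: down-sets of
  pairs closed under arbitrary (also empty) joins in each coordinate separately.
  The universal property is \<open>coproduct_universal\<close> below.
\<close>

definition coproduct_ideal :: "'a gorder \<Rightarrow> 'b gorder \<Rightarrow> ('a \<times> 'b) set \<Rightarrow> bool" where
  "coproduct_ideal L M U \<longleftrightarrow> U \<subseteq> carrier L \<times> carrier M
     \<and> (\<forall>(x, y) \<in> U. \<forall>x' \<in> carrier L. \<forall>y' \<in> carrier M.
          x' \<sqsubseteq>\<^bsub>L\<^esub> x \<longrightarrow> y' \<sqsubseteq>\<^bsub>M\<^esub> y \<longrightarrow> (x', y') \<in> U)
     \<and> (\<forall>S \<subseteq> carrier L. \<forall>y \<in> carrier M. S \<times> {y} \<subseteq> U \<longrightarrow> (\<Squnion>\<^bsub>L\<^esub>S, y) \<in> U)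
     \<and> (\<forall>x \<in> carrier L. \<forall>T \<subseteq> carrier M. {x} \<times> T \<subseteq> U \<longrightarrow> (x, \<Squnion>\<^bsub>M\<^esub>T) \<in> U)"

definition frame_coproduct :: "'a gorder \<Rightarrow> 'b gorder \<Rightarrow> ('a \<times> 'b) set gorder" where
  "frame_coproduct L M = \<lparr>carrier = {U. coproduct_ideal L M U}, eq = (=), le = (\<subseteq>)\<rparr>"

definition coproduct_inl :: "'a gorder \<Rightarrow> 'b gorder \<Rightarrow> 'a \<Rightarrow> ('a \<times> 'b) set" where
  "coproduct_inl L M x = {(a, b) \<in> carrier L \<times> carrier M. a \<sqsubseteq>\<^bsub>L\<^esub> x \<or> b = \<bottom>\<^bsub>M\<^esub>}"

definition coproduct_inr :: "'a gorder \<Rightarrow> 'b gorder \<Rightarrow> 'b \<Rightarrow> ('a \<times> 'b) set" where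
  "coproduct_inr L M y = {(a, b) \<in> carrier L \<times> carrier M. b \<sqsubseteq>\<^bsub>M\<^esub> y \<or> a = \<bottom>\<^bsub>L\<^esub>}"

text \<open>The frame map out of the coproduct induced by \<open>f : L \<rightarrow> N\<close> and \<open>g : M \<rightarrow> N\<close>.\<close>

definition coproduct_copair ::
    "'c gorder \<Rightarrow> ('a \<Rightarrow> 'c) \<Rightarrow> ('b \<Rightarrow> 'c) \<Rightarrow> ('a \<times> 'b) set \<Rightarrow> 'c" where
  "coproduct_copair N f g U = \<Squnion>\<^bsub>N\<^esub>((\<lambda>(a, b). f a \<sqinter>\<^bsub>N\<^esub> g b) ` U)"


section \<open>Biframes\<close>

record ('p, 'n, 'm) biframe_data =
  pos :: "'p gorder"
  neg :: "'n gorder"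
  main :: "'m gorder"
  pos_map :: "'p \<Rightarrow> 'm"
  neg_map :: "'n \<Rightarrow> 'm"

definition rectangles :: "('p, 'n, 'm) biframe_data \<Rightarrow> 'm set" where
  "rectangles B = {pos_map B x \<sqinter>\<^bsub>main B\<^esub> neg_map B y | x y.
     x \<in> carrier (pos B) \<and> y \<in> carrier (neg B)}"

definition biframe :: "('p, 'n, 'm) biframe_data \<Rightarrow> bool" where
  "biframe B \<longleftrightarrow>
     frame_map (pos B) (main B) (pos_map B) \<and> inj_on (pos_map B) (carrier (pos B))
     \<and> frame_map (neg B) (main B) (neg_map B) \<and> inj_on (neg_map B) (carrier (neg B))
     \<and> (\<forall>x \<in> carrier (main B). \<exists>S \<subseteq> rectangles B. x = \<Squnion>\<^bsub>main B\<^esub>S)"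

definition fin_elements :: "('p, 'n, 'm) biframe_data \<Rightarrow> 'm set" where
  "fin_elements B = {\<Squnion>\<^bsub>main B\<^esub>S | S. finite S \<and> S \<subseteq> rectangles B}"

definition finitary_congruence :: "('p, 'n, 'm) biframe_data \<Rightarrow> ('m \<times> 'm) set \<Rightarrow> bool" where
  "finitary_congruence B \<theta> \<longleftrightarrow>
     (\<exists>R \<subseteq> fin_elements B \<times> fin_elements B. \<theta> = congruence_generated (main B) R)"

definition coproduct_biframe ::
    "'p gorder \<Rightarrow> 'n gorder \<Rightarrow> ('p, 'n, ('p \<times> 'n) set) biframe_data" where
  "coproduct_biframe L M = \<lparr>pos = L, neg = M, main = frame_coproduct L M,
     pos_map = coproduct_inl L M, neg_map = coproduct_inr L M\<rparr>"

definition coproduct_congruence ::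
    "('p, 'n, 'm) biframe_data \<Rightarrow> (('p \<times> 'n) set \<times> ('p \<times> 'n) set) set" where
  "coproduct_congruence B = frame_kernel (frame_coproduct (pos B) (neg B))
     (coproduct_copair (main B) (pos_map B) (neg_map B))"

definition finitary_biframe :: "('p, 'n, 'm) biframe_data \<Rightarrow> bool" where
  "finitary_biframe B \<longleftrightarrow> biframe B
     \<and> finitary_congruence (coproduct_biframe (pos B) (neg B)) (coproduct_congruence B)"


section \<open>The assembly\<close>

definition congruence_frame :: "'a gorder \<Rightarrow> ('a \<times> 'a) set gorder" where
  "congruence_frame L = \<lparr>carrier = {\<theta>. frame_congruence L \<theta>}, eq = (=), le = (\<subseteq>)\<rparr>"

definition closed_congruence :: "'a gorder \<Rightarrow> 'a \<Rightarrow> ('a \<times> 'a) set" (\<open>\<nabla>\<index>\<close>) where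
  "\<nabla>\<^bsub>L\<^esub> a = {(x, y) \<in> carrier L \<times> carrier L. x \<squnion>\<^bsub>L\<^esub> a = y \<squnion>\<^bsub>L\<^esub> a}"

definition open_congruence :: "'a gorder \<Rightarrow> 'a \<Rightarrow> ('a \<times> 'a) set" (\<open>\<Delta>\<index>\<close>) where
  "\<Delta>\<^bsub>L\<^esub> a = {(x, y) \<in> carrier L \<times> carrier L. x \<sqinter>\<^bsub>L\<^esub> a = y \<sqinter>\<^bsub>L\<^esub> a}"

definition subframe :: "'a gorder \<Rightarrow> 'a set \<Rightarrow> bool" where
  "subframe A T \<longleftrightarrow> T \<subseteq> carrier A \<and> \<top>\<^bsub>A\<^esub> \<in> T
     \<and> (\<forall>x \<in> T. \<forall>y \<in> T. x \<sqinter>\<^bsub>A\<^esub> y \<in> T) \<and> (\<forall>S \<subseteq> T. \<Squnion>\<^bsub>A\<^esub>S \<in> T)"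

definition generated_subframe :: "'a gorder \<Rightarrow> 'a set \<Rightarrow> 'a gorder" where
  "generated_subframe A G = A\<lparr>carrier := \<Inter>{T. subframe A T \<and> G \<subseteq> T}\<rparr>"

definition assembly ::
    "('p, 'n, 'm) biframe_data
      \<Rightarrow> (('m \<times> 'm) set, ('m \<times> 'm) set, ('m \<times> 'm) set) biframe_data" where
  "assembly B =
    (let L = main B; P = pos_map B ` carrier (pos B); N = neg_map B ` carrier (neg B) in
     \<lparr>pos = generated_subframe (congruence_frame L) (\<nabla>\<^bsub>L\<^esub> ` P \<union> \<Delta>\<^bsub>L\<^esub> ` N),
      neg = generated_subframe (congruence_frame L) (\<nabla>\<^bsub>L\<^esub> ` N \<union> \<Delta>\<^bsub>L\<^esub> ` P),
      main = generated_subframe (congruence_frame L)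
        (\<nabla>\<^bsub>L\<^esub> ` carrier L \<union> \<Delta>\<^bsub>L\<^esub> ` fin_elements B),
      pos_map = (\<lambda>\<theta>. \<theta>), neg_map = (\<lambda>\<theta>. \<theta>)\<rparr>)"


section \<open>Universal property of quotients\<close>

lemma partial_orderI_eq:
  assumes "eq L = (=)"
    and "\<And>x. x \<in> carrier L \<Longrightarrow> x \<sqsubseteq>\<^bsub>L\<^esub> x"
    and "\<And>x y. \<lbrakk>x \<sqsubseteq>\<^bsub>L\<^esub> y; y \<sqsubseteq>\<^bsub>L\<^esub> x; x \<in> carrier L; y \<in> carrier L\<rbrakk> \<Longrightarrow> x = y"
    and "\<And>x y z. \<lbrakk>x \<sqsubseteq>\<^bsub>L\<^esub> y; y \<sqsubseteq>\<^bsub>L\<^esub> z; x \<in> carrier L; y \<in> carrier L; z \<in> carrier L\<rbrakk> \<Longrightarrow> x \<sqsubseteq>\<^bsub>L\<^esub> z"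
  shows "partial_order L"
  using assms by unfold_locales auto

lemma complete_latticeI_sup:
  assumes po: "partial_order L"
    and sup: "\<And>A. A \<subseteq> carrier L \<Longrightarrow> \<exists>s. least L s (Upper L A)"
  shows "complete_lattice L"
proof -
  interpret partial_order L by fact
  show ?thesis
  proof (rule complete_latticeI)
    fix A assume A: "A \<subseteq> carrier L"
    obtain s where s: "least L s (Upper L (Lower L A))" using sup[of "Lower L A"] by auto
    have "greatest L s (Lower L A)"
      unfolding greatest_def
      by (smt (verit, best) A Lower_closed Lower_memI Upper_memI least_def least_Upper_above Lower_memD s subset_iff)
    then show "\<exists>i. greatest L i (Lower L A)" by blast
  qed (rule sup)
qed

context complete_lattice begin

lemma Sup_eqI: "least L s (Upper L A) \<Longrightarrow> A \<subseteq> carrier L \<Longrightarrow> \<Squnion>A = s"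
  by (metis eq_is_equal supI weak_least_unique)

lemma meet_eqI: "greatest L s (Lower L {a, b}) \<Longrightarrow> a \<in> carrier L \<Longrightarrow> b \<in> carrier L \<Longrightarrow> a \<sqinter> b = s"
  by (metis eq_is_equal meetI weak_greatest_unique)

lemma top_eqI: "\<lbrakk>t \<in> carrier L; \<And>x. x \<in> carrier L \<Longrightarrow> x \<sqsubseteq> t\<rbrakk> \<Longrightarrow> \<top> = t"
  by (simp add: le_antisym top_closed top_higher)

lemma le_iff_meet_eq: "\<lbrakk>x \<in> carrier L; y \<in> carrier L\<rbrakk> \<Longrightarrow> x \<sqsubseteq> y \<longleftrightarrow> x \<sqinter> y = x"
  by (auto simp: le_iff_join eq_commute)

end

lemma greatest_Lower_pairI:
  assumes "a \<in> carrier L" "b \<in> carrier L" "m \<in> carrier L" "m \<sqsubseteq>\<^bsub>L\<^esub> a" "m \<sqsubseteq>\<^bsub>L\<^esub> b"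
    and "\<And>y. \<lbrakk>y \<in> carrier L; y \<sqsubseteq>\<^bsub>L\<^esub> a; y \<sqsubseteq>\<^bsub>L\<^esub> b\<rbrakk> \<Longrightarrow> y \<sqsubseteq>\<^bsub>L\<^esub> m"
  shows "greatest L m (Lower L {a, b})"
  using assms by (auto simp: greatest_def Lower_def)

lemma frame_mapI:
  assumes "frame L" "frame M" "f \<in> carrier L \<rightarrow> carrier M"
    and "\<And>A. A \<subseteq> carrier L \<Longrightarrow> f (\<Squnion>\<^bsub>L\<^esub>A) = \<Squnion>\<^bsub>M\<^esub>(f ` A)"
    and "\<And>x y. \<lbrakk>x \<in> carrier L; y \<in> carrier L\<rbrakk> \<Longrightarrow> f (x \<sqinter>\<^bsub>L\<^esub> y) = f x \<sqinter>\<^bsub>M\<^esub> f y"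
    and "f \<top>\<^bsub>L\<^esub> = \<top>\<^bsub>M\<^esub>"
  shows "frame_map L M f"
  using assms unfolding frame_map_def sup_pres_def meet_pres_def by (auto simp: frame_def)

lemma frame_mapD:
  assumes "frame_map L M f"
  shows "frame L" "frame M" "f \<in> carrier L \<rightarrow> carrier M"
    and "\<And>A. A \<subseteq> carrier L \<Longrightarrow> f (\<Squnion>\<^bsub>L\<^esub>A) = \<Squnion>\<^bsub>M\<^esub>(f ` A)"
    and "\<And>x y. \<lbrakk>x \<in> carrier L; y \<in> carrier L\<rbrakk> \<Longrightarrow> f (x \<sqinter>\<^bsub>L\<^esub> y) = f x \<sqinter>\<^bsub>M\<^esub> f y"
    and "f \<top>\<^bsub>L\<^esub> = \<top>\<^bsub>M\<^esub>"
  using assms unfolding frame_map_def sup_pres_def meet_pres_def by auto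

lemma frame_congruence_meet:
  assumes "frame_congruence L \<theta>" "(x, y) \<in> \<theta>" "(u, v) \<in> \<theta>"
  shows "(x \<sqinter>\<^bsub>L\<^esub> u, y \<sqinter>\<^bsub>L\<^esub> v) \<in> \<theta>"
proof -
  have "\<forall>(x, y) \<in> \<theta>. \<forall>(u, v) \<in> \<theta>. (x \<sqinter>\<^bsub>L\<^esub> u, y \<sqinter>\<^bsub>L\<^esub> v) \<in> \<theta>"
    using assms(1) unfolding frame_congruence_def by blast
  from bspec[OF bspec[OF this assms(2), simplified] assms(3)] show ?thesis by simp
qed

locale framecong = frame L for L (structure) +
  fixes \<theta> assumes cong: "frame_congruence L \<theta>"
begin

abbreviation "Q \<equiv> quotient_frame L \<theta>"
abbreviation "q a \<equiv> \<theta> `` {a}"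

lemma equiv: "equiv (carrier L) \<theta>" using cong by (simp add: frame_congruence_def)
lemma cmeet: "(x,y) \<in> \<theta> \<Longrightarrow> (u,v) \<in> \<theta> \<Longrightarrow> (x \<sqinter> u, y \<sqinter> v) \<in> \<theta>"
  by (rule frame_congruence_meet[OF cong])
lemma csup: "S \<subseteq> \<theta> \<Longrightarrow> (\<Squnion>(fst ` S), \<Squnion>(snd ` S)) \<in> \<theta>"
  using cong by (simp add: frame_congruence_def)
lemma carr: "(x,y) \<in> \<theta> \<Longrightarrow> x \<in> carrier L" "(x,y) \<in> \<theta> \<Longrightarrow> y \<in> carrier L"
  using equiv by (auto simp: equiv_def)
lemma crefl: "x \<in> carrier L \<Longrightarrow> (x,x) \<in> \<theta>"
  using equiv by (auto simp: equiv_def refl_on_def)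
lemma csym: "(x,y) \<in> \<theta> \<Longrightarrow> (y,x) \<in> \<theta>"
  using equiv by (auto simp: equiv_def dest: symD)
lemma ctrans: "(x,y) \<in> \<theta> \<Longrightarrow> (y,z) \<in> \<theta> \<Longrightarrow> (x,z) \<in> \<theta>"
  using equiv by (auto simp: equiv_def dest: transD)

lemma carrier_Q: "carrier Q = q ` carrier L"
  by (auto simp: quotient_frame_def quotient_def)

lemma q_eq: "\<lbrakk>a \<in> carrier L; b \<in> carrier L\<rbrakk> \<Longrightarrow> q a = q b \<longleftrightarrow> (a,b) \<in> \<theta>"
  using eq_equiv_class_iff[OF equiv] by simp

lemma q_le: assumes "a \<in> carrier L" "b \<in> carrier L"
  shows "q a \<sqsubseteq>\<^bsub>Q\<^esub> q b \<longleftrightarrow> (a \<sqinter> b, a) \<in> \<theta>"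
proof
  assume "q a \<sqsubseteq>\<^bsub>Q\<^esub> q b"
  then obtain x y where "(a,x) \<in> \<theta>" "(b,y) \<in> \<theta>" "x \<sqsubseteq> y" by (auto simp: quotient_frame_def)
  then show "(a \<sqinter> b, a) \<in> \<theta>"
    by (metis carr(2) cmeet csym ctrans le_iff_meet_eq)
next
  assume *: "(a \<sqinter> b, a) \<in> \<theta>"
  have "a \<sqinter> b \<in> q a" "b \<in> q b" using * assms crefl csym by auto
  moreover have "a \<sqinter> b \<sqsubseteq> b" using assms by (simp add: meet_right)
  ultimately show "q a \<sqsubseteq>\<^bsub>Q\<^esub> q b" by (auto simp: quotient_frame_def)
qed

lemma q_mono: "\<lbrakk>a \<in> carrier L; b \<in> carrier L; a \<sqsubseteq> b\<rbrakk> \<Longrightarrow> q a \<sqsubseteq>\<^bsub>Q\<^esub> q b"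
  by (simp add: q_le le_iff_meet_eq crefl)

lemma po_Q: "partial_order Q"
proof (rule partial_orderI_eq)
  show "(.=\<^bsub>Q\<^esub>) = (=)" by (simp add: quotient_frame_def)
next
  fix X assume "X \<in> carrier Q" then show "X \<sqsubseteq>\<^bsub>Q\<^esub> X" by (auto simp: carrier_Q q_mono)
next
  fix X Y assume *: "X \<sqsubseteq>\<^bsub>Q\<^esub> Y" "Y \<sqsubseteq>\<^bsub>Q\<^esub> X" "X \<in> carrier Q" "Y \<in> carrier Q"
  then obtain a b where ab: "a \<in> carrier L" "b \<in> carrier L" "X = q a" "Y = q b" by (auto simp: carrier_Q)
  with * have "(a \<sqinter> b, a) \<in> \<theta>" "(b \<sqinter> a, b) \<in> \<theta>" by (auto simp: q_le)
  then have "(a,b) \<in> \<theta>" by (metis csym ctrans meet_comm)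
  then show "X = Y" using ab q_eq by simp
next
  fix X Y Z assume *: "X \<sqsubseteq>\<^bsub>Q\<^esub> Y" "Y \<sqsubseteq>\<^bsub>Q\<^esub> Z" "X \<in> carrier Q" "Y \<in> carrier Q" "Z \<in> carrier Q"
  then obtain a b c where ab: "a \<in> carrier L" "b \<in> carrier L" "c \<in> carrier L" "X = q a" "Y = q b" "Z = q c" by (auto simp: carrier_Q)
  with * have 1: "(a \<sqinter> b, a) \<in> \<theta>" "(b \<sqinter> c, b) \<in> \<theta>" by (auto simp: q_le)
  have "(a \<sqinter> c, (a \<sqinter> b) \<sqinter> c) \<in> \<theta>" using 1 ab by (simp add: cmeet crefl csym)
  moreover have "((a \<sqinter> b) \<sqinter> c, a \<sqinter> b) \<in> \<theta>" using 1 ab by (simp add: cmeet crefl meet_assoc)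
  ultimately show "X \<sqsubseteq>\<^bsub>Q\<^esub> Z" using ab 1 by (metis ctrans q_le)
qed

lemma sup_Q: assumes A: "A \<subseteq> carrier L"
  shows "least Q (q (\<Squnion>A)) (Upper Q (q ` A))"
proof (rule least_UpperI)
  show "q (\<Squnion>A) \<in> carrier Q" using A by (auto simp: carrier_Q)
  show "q ` A \<subseteq> carrier Q" using A by (auto simp: carrier_Q)
  show "X \<sqsubseteq>\<^bsub>Q\<^esub> q (\<Squnion>A)" if "X \<in> q ` A" for X
    using that A by (auto intro!: q_mono sup_upper)
next
  fix Y assume Y: "Y \<in> Upper Q (q ` A)"
  then obtain b where b: "b \<in> carrier L" "Y = q b" by (auto simp: carrier_Q Upper_def)
  have le: "(a \<sqinter> b, a) \<in> \<theta>" if "a \<in> A" for a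
  proof -
    have "q a \<sqsubseteq>\<^bsub>Q\<^esub> q b" using Y b that A by (auto simp: Upper_def carrier_Q)
    then show ?thesis using b that A q_le by auto
  qed
  have "(\<Squnion>(fst ` (\<lambda>a. (a \<sqinter> b, a)) ` A), \<Squnion>(snd ` (\<lambda>a. (a \<sqinter> b, a)) ` A)) \<in> \<theta>"
    by (rule csup) (use le in auto)
  then have "(\<Squnion>((\<lambda>a. b \<sqinter> a) ` A), \<Squnion>A) \<in> \<theta>" by (simp add: image_image meet_comm)
  then have "(\<Squnion>A \<sqinter> b, \<Squnion>A) \<in> \<theta>" using meet_Sup_distrib[OF b(1) A] by (simp add: meet_comm)
  then show "q (\<Squnion>A) \<sqsubseteq>\<^bsub>Q\<^esub> Y" using b A q_le by simp
qed

lemma ex_rep: assumes "X \<subseteq> carrier Q" shows "\<exists>A \<subseteq> carrier L. X = q ` A"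
  using assms carrier_Q by (metis subset_imageE)

lemma cl_Q: "complete_lattice Q"
  by (rule complete_latticeI_sup[OF po_Q]) (metis ex_rep sup_Q)

lemma Sup_Q: "A \<subseteq> carrier L \<Longrightarrow> \<Squnion>\<^bsub>Q\<^esub>(q ` A) = q (\<Squnion>A)"
  by (rule complete_lattice.Sup_eqI[OF cl_Q sup_Q]) (auto simp: carrier_Q)

lemma meet_Q: assumes ab: "a \<in> carrier L" "b \<in> carrier L"
  shows "q a \<sqinter>\<^bsub>Q\<^esub> q b = q (a \<sqinter> b)"
proof -
  have c: "q a \<in> carrier Q" "q b \<in> carrier Q" "q (a \<sqinter> b) \<in> carrier Q"
    unfolding carrier_Q using ab meet_closed[OF ab] by blast+
  have le: "q (a \<sqinter> b) \<sqsubseteq>\<^bsub>Q\<^esub> q a" "q (a \<sqinter> b) \<sqsubseteq>\<^bsub>Q\<^esub> q b"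
    by (rule q_mono[OF meet_closed[OF ab] ab(1) meet_left[OF ab]],
        rule q_mono[OF meet_closed[OF ab] ab(2) meet_right[OF ab]])
  have gr: "Y \<sqsubseteq>\<^bsub>Q\<^esub> q (a \<sqinter> b)" if *: "Y \<in> carrier Q" "Y \<sqsubseteq>\<^bsub>Q\<^esub> q a" "Y \<sqsubseteq>\<^bsub>Q\<^esub> q b" for Y
  proof -
    obtain c where c: "c \<in> carrier L" "Y = q c" using *(1) unfolding carrier_Q by blast
    with * ab have 1: "(c \<sqinter> a, c) \<in> \<theta>" "(c \<sqinter> b, c) \<in> \<theta>" by (auto simp: q_le)
    have "((c \<sqinter> a) \<sqinter> b, c \<sqinter> b) \<in> \<theta>" using 1 ab by (simp add: cmeet crefl)
    then have "(c \<sqinter> (a \<sqinter> b), c) \<in> \<theta>" using 1 ab c by (metis ctrans meet_assoc)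
    then show ?thesis using c ab by (simp add: q_le)
  qed
  have "greatest Q (q (a \<sqinter> b)) (Lower Q {q a, q b})"
    by (rule greatest_Lower_pairI[OF c le gr])
  then show ?thesis by (rule complete_lattice.meet_eqI[OF cl_Q _ c(1,2)])
qed

lemma frame_Q: "frame Q"
proof (intro frame.intro cl_Q frame_axioms.intro)
  fix X Y assume "X \<in> carrier Q" "Y \<subseteq> carrier Q"
  then obtain a A where aA: "a \<in> carrier L" "X = q a" "A \<subseteq> carrier L" "Y = q ` A"
    using ex_rep[of Y] unfolding carrier_Q by blast
  have "(\<lambda>Z. X \<sqinter>\<^bsub>Q\<^esub> Z) ` Y = q ` ((\<lambda>x. a \<sqinter> x) ` A)"
    unfolding aA(4) image_image by (rule image_cong) (use aA meet_Q in auto)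
  moreover have "(\<lambda>x. a \<sqinter> x) ` A \<subseteq> carrier L" using aA by auto
  ultimately show "X \<sqinter>\<^bsub>Q\<^esub> \<Squnion>\<^bsub>Q\<^esub>Y = \<Squnion>\<^bsub>Q\<^esub>((\<lambda>Z. X \<sqinter>\<^bsub>Q\<^esub> Z) ` Y)"
    using aA by (simp add: Sup_Q meet_Q meet_Sup_distrib)
qed

lemma frame_map_q: "frame_map L Q q"
proof (rule frame_mapI)
  show "q \<top> = \<top>\<^bsub>Q\<^esub>"
  proof (rule complete_lattice.top_eqI[OF cl_Q, symmetric])
    fix X assume "X \<in> carrier Q"
    then obtain x where "x \<in> carrier L" "X = q x" unfolding carrier_Q by blast
    then show "X \<sqsubseteq>\<^bsub>Q\<^esub> q \<top>" using q_mono[OF _ top_closed top_higher] by blast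
  qed (unfold carrier_Q, blast intro: top_closed)
  show "q \<in> carrier L \<rightarrow> carrier Q" unfolding carrier_Q by blast
qed (use frame_axioms frame_Q Sup_Q meet_Q in simp_all)

lemma kernel_q: "frame_kernel L q = \<theta>"
proof (rule Set.set_eqI)
  fix p show "p \<in> frame_kernel L q \<longleftrightarrow> p \<in> \<theta>"
    using q_eq[of "fst p" "snd p"] carr[of "fst p" "snd p"] by (cases p) (auto simp only: frame_kernel_def mem_Collect_eq case_prod_conv fst_conv snd_conv)
qed

end

lemma frame_congruence_kernel:
  assumes f: "frame_map L M f"
  shows "frame_congruence L (frame_kernel L f)"
proof -
  interpret L: frame L using frame_mapD(1)[OF f] .
  note D = frame_mapD[OF f]
  have "equiv (carrier L) (frame_kernel L f)"
    by (auto simp: equiv_def frame_kernel_def refl_on_def sym_def trans_def)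
  moreover have "(\<Squnion>\<^bsub>L\<^esub>(fst ` S), \<Squnion>\<^bsub>L\<^esub>(snd ` S)) \<in> frame_kernel L f" if S: "S \<subseteq> frame_kernel L f" for S
  proof -
    have c: "fst ` S \<subseteq> carrier L" "snd ` S \<subseteq> carrier L" using S by (auto simp: frame_kernel_def)
    have "f ` fst ` S = f ` snd ` S" unfolding image_image
      by (rule image_cong) (use S in \<open>auto simp: frame_kernel_def\<close>)
    then show ?thesis using c D(4) by (simp add: frame_kernel_def)
  qed
  ultimately show ?thesis using D(5)
    by (auto simp: frame_congruence_def) (auto simp: frame_kernel_def)
qed

lemma frame_congruence_generated:
  fixes L :: "'a gorder" (structure)
  assumes L: "frame L" and R: "R \<subseteq> carrier L \<times> carrier L"
  shows "frame_congruence L (congruence_generated L R)"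
    and "\<And>a b. (a, b) \<in> R \<Longrightarrow> (a \<sqinter> b, a) \<in> congruence_generated L R"
proof -
  interpret frame L by fact
  let ?F = "{\<theta>. frame_congruence L \<theta> \<and> (\<forall>(a, b) \<in> R. (a \<sqinter> b, a) \<in> \<theta>)}"
  have le: "(\<theta> `` {a} \<sqsubseteq>\<^bsub>quotient_frame L \<theta>\<^esub> \<theta> `` {b}) = ((a \<sqinter> b, a) \<in> \<theta>)"
    if "frame_congruence L \<theta>" "(a, b) \<in> R" for \<theta> a b
  proof -
    interpret framecong L \<theta> by unfold_locales (rule that)
    show ?thesis using q_le that R by auto
  qed
  have eq: "congruence_generated L R = \<Inter>?F"
    unfolding congruence_generated_def using le by (intro arg_cong[where f = Inter] Collect_cong) blast
  have tot: "carrier L \<times> carrier L \<in> ?F"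
  proof -
    have "frame_congruence L (carrier L \<times> carrier L)"
    proof -
      have "fst ` S \<subseteq> carrier L" "snd ` S \<subseteq> carrier L" if "S \<subseteq> carrier L \<times> carrier L" for S
        using that by auto
      then show ?thesis
        by (auto simp: frame_congruence_def equiv_def refl_on_def sym_def trans_def)
    qed
    then show ?thesis using R by auto
  qed
  have "equiv (carrier L) (\<Inter>?F)"
    unfolding equiv_def
  proof (intro conjI)
    show "\<Inter>?F \<subseteq> carrier L \<times> carrier L" using tot by blast
    have E: "equiv (carrier L) \<theta>" if "\<theta> \<in> ?F" for \<theta> using that by (simp add: frame_congruence_def)
    show "refl_on (carrier L) (\<Inter>?F)" using E by (fastforce simp: equiv_def refl_on_def)
    show "sym (\<Inter>?F)" using E unfolding equiv_def sym_def by blast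
    show "trans (\<Inter>?F)" using E unfolding equiv_def trans_def by blast
  qed
  moreover have "(x \<sqinter> u, y \<sqinter> v) \<in> \<Inter>?F" if "(x,y) \<in> \<Inter>?F" "(u,v) \<in> \<Inter>?F" for x y u v
  proof
    fix \<theta> assume "\<theta> \<in> ?F"
    then show "(x \<sqinter> u, y \<sqinter> v) \<in> \<theta>" using frame_congruence_meet[of L \<theta> x y u v] that by blast
  qed
  moreover have "(\<Squnion>(fst ` S), \<Squnion>(snd ` S)) \<in> \<Inter>?F" if "S \<subseteq> \<Inter>?F" for S
  proof
    fix \<theta> assume "\<theta> \<in> ?F"
    moreover from this that have "S \<subseteq> \<theta>" by blast
    ultimately show "(\<Squnion>(fst ` S), \<Squnion>(snd ` S)) \<in> \<theta>" by (simp add: frame_congruence_def)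
  qed
  ultimately show "frame_congruence L (congruence_generated L R)"
    unfolding eq frame_congruence_def[of L "\<Inter>?F"] by blast
  show "\<And>a b. (a, b) \<in> R \<Longrightarrow> (a \<sqinter> b, a) \<in> congruence_generated L R"
    unfolding eq by blast
qed

theorem quotient_universal:
  fixes L :: "'a gorder" (structure)
  assumes L: "frame L" and R: "R \<subseteq> carrier L \<times> carrier L"
  defines "\<theta> \<equiv> congruence_generated L R"
  shows "frame_map L (quotient_frame L \<theta>) (\<lambda>x. \<theta> `` {x})"
    and "(\<lambda>x. \<theta> `` {x}) ` carrier L = carrier (quotient_frame L \<theta>)"
    and "frame_kernel L (\<lambda>x. \<theta> `` {x}) = \<theta>"
    and "\<And>a b. (a, b) \<in> R \<Longrightarrow> \<theta> `` {a} \<sqsubseteq>\<^bsub>quotient_frame L \<theta>\<^esub> \<theta> `` {b}"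
    and "\<And>(N :: 'b gorder) f. frame_map L N f \<Longrightarrow> (\<And>a b. (a, b) \<in> R \<Longrightarrow> f a \<sqsubseteq>\<^bsub>N\<^esub> f b)
      \<Longrightarrow> \<exists>h. frame_map (quotient_frame L \<theta>) N h \<and> (\<forall>x \<in> carrier L. h (\<theta> `` {x}) = f x)"
proof -
  interpret frame L by fact
  interpret framecong L \<theta>
    by unfold_locales (simp add: \<theta>_def frame_congruence_generated[OF L R])
  show "frame_map L Q q" by (rule frame_map_q)
  show "q ` carrier L = carrier Q" by (simp add: carrier_Q)
  show "frame_kernel L q = \<theta>" by (rule kernel_q)
  show "q a \<sqsubseteq>\<^bsub>Q\<^esub> q b" if "(a, b) \<in> R" for a b
  proof -
    have "(a \<sqinter> b, a) \<in> \<theta>" using frame_congruence_generated(2)[OF L R that] by (simp add: \<theta>_def)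
    moreover have "a \<in> carrier L" "b \<in> carrier L" using R that by auto
    ultimately show ?thesis using q_le by blast
  qed
  fix N :: "'b gorder" and f
  assume f: "frame_map L N f" and fR: "\<And>a b. (a, b) \<in> R \<Longrightarrow> f a \<sqsubseteq>\<^bsub>N\<^esub> f b"
  note D = frame_mapD[OF f]
  interpret N: frame N by (rule D(2))
  have sub: "\<theta> \<subseteq> frame_kernel L f"
  proof -
    let ?k = "frame_kernel L f"
    have k: "frame_congruence L ?k" by (rule frame_congruence_kernel[OF f])
    interpret k: framecong L ?k by unfold_locales (rule k)
    have "?k `` {a} \<sqsubseteq>\<^bsub>quotient_frame L ?k\<^esub> ?k `` {b}" if "(a, b) \<in> R" for a b
    proof -
      have ab: "a \<in> carrier L" "b \<in> carrier L" using R that by auto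
      moreover have "f (a \<sqinter> b) = f a"
        using fR[OF that] ab D(3,5) N.le_iff_meet_eq by (metis PiE)
      ultimately show ?thesis by (subst k.q_le) (auto simp: frame_kernel_def)
    qed
    then show ?thesis unfolding \<theta>_def congruence_generated_def using k by auto
  qed
  define h where "h X = f (SOME x. x \<in> X)" for X
  have h: "h (q x) = f x" if "x \<in> carrier L" for x
  proof -
    have "x \<in> q x" using that crefl by simp
    then have "(SOME y. y \<in> q x) \<in> q x" by (rule someI)
    then show ?thesis using sub by (auto simp: h_def frame_kernel_def)
  qed
  have "frame_map Q N h"
  proof (rule frame_mapI[OF frame_Q D(2)])
    show "h \<in> carrier Q \<rightarrow> carrier N" using h D(3) by (auto simp: carrier_Q)
    show "h (X \<sqinter>\<^bsub>Q\<^esub> Y) = h X \<sqinter>\<^bsub>N\<^esub> h Y" if "X \<in> carrier Q" "Y \<in> carrier Q" for X Y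
      using that by (auto simp: carrier_Q meet_Q h D(5))
    show "h \<top>\<^bsub>Q\<^esub> = \<top>\<^bsub>N\<^esub>"
      using frame_mapD(6)[OF frame_map_q] h D(6) by (metis top_closed)
    fix X assume "X \<subseteq> carrier Q"
    then obtain A where A: "A \<subseteq> carrier L" "X = q ` A" using ex_rep[of X] by blast
    have "h ` q ` A = f ` A" unfolding image_image by (rule image_cong) (use A h in auto)
    then show "h (\<Squnion>\<^bsub>Q\<^esub>X) = \<Squnion>\<^bsub>N\<^esub>(h ` X)" using A by (simp add: Sup_Q h D(4))
  qed
  then show "\<exists>h. frame_map Q N h \<and> (\<forall>x \<in> carrier L. h (q x) = f x)" using h by blast
qed


section \<open>Universal property of coproducts\<close>

locale framepair = L: frame L + M: frame M for L :: "'a gorder" and M :: "'b gorder"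
begin

abbreviation "C \<equiv> frame_coproduct L M"
abbreviation "idl \<equiv> coproduct_ideal L M"

lemma idlD:
  assumes "idl U"
  shows "U \<subseteq> carrier L \<times> carrier M"
    and "\<And>x y x' y'. \<lbrakk>(x, y) \<in> U; x' \<in> carrier L; y' \<in> carrier M; x' \<sqsubseteq>\<^bsub>L\<^esub> x; y' \<sqsubseteq>\<^bsub>M\<^esub> y\<rbrakk> \<Longrightarrow> (x', y') \<in> U"
    and "\<And>S y. \<lbrakk>S \<subseteq> carrier L; y \<in> carrier M; \<And>x. x \<in> S \<Longrightarrow> (x, y) \<in> U\<rbrakk> \<Longrightarrow> (\<Squnion>\<^bsub>L\<^esub>S, y) \<in> U"
    and "\<And>x T. \<lbrakk>x \<in> carrier L; T \<subseteq> carrier M; \<And>y. y \<in> T \<Longrightarrow> (x, y) \<in> U\<rbrakk> \<Longrightarrow> (x, \<Squnion>\<^bsub>M\<^esub>T) \<in> U"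
proof -
  note I = assms[unfolded coproduct_ideal_def]
  show "U \<subseteq> carrier L \<times> carrier M" by (rule conjunct1[OF I])
  show "(x', y') \<in> U" if "(x, y) \<in> U" "x' \<in> carrier L" "y' \<in> carrier M" "x' \<sqsubseteq>\<^bsub>L\<^esub> x" "y' \<sqsubseteq>\<^bsub>M\<^esub> y"
    for x y x' y'
    using bspec[OF conjunct1[OF conjunct2[OF I]] that(1), unfolded prod.case] that(2-) by blast
  show "(\<Squnion>\<^bsub>L\<^esub>S, y) \<in> U" if "S \<subseteq> carrier L" "y \<in> carrier M" "\<And>x. x \<in> S \<Longrightarrow> (x, y) \<in> U" for S y
  proof -
    have "S \<times> {y} \<subseteq> U" using that(3) by auto
    then show ?thesis using conjunct1[OF conjunct2[OF conjunct2[OF I]]] that(1,2) by blast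
  qed
  show "(x, \<Squnion>\<^bsub>M\<^esub>T) \<in> U" if "x \<in> carrier L" "T \<subseteq> carrier M" "\<And>y. y \<in> T \<Longrightarrow> (x, y) \<in> U" for x T
  proof -
    have "{x} \<times> T \<subseteq> U" using that(3) by auto
    then show ?thesis using conjunct2[OF conjunct2[OF conjunct2[OF I]]] that(1,2) by blast
  qed
qed

lemma idlI:
  assumes "U \<subseteq> carrier L \<times> carrier M"
    and "\<And>x y x' y'. \<lbrakk>(x, y) \<in> U; x' \<in> carrier L; y' \<in> carrier M; x' \<sqsubseteq>\<^bsub>L\<^esub> x; y' \<sqsubseteq>\<^bsub>M\<^esub> y\<rbrakk> \<Longrightarrow> (x', y') \<in> U"
    and "\<And>S y. \<lbrakk>S \<subseteq> carrier L; y \<in> carrier M; \<And>x. x \<in> S \<Longrightarrow> (x, y) \<in> U\<rbrakk> \<Longrightarrow> (\<Squnion>\<^bsub>L\<^esub>S, y) \<in> U"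
    and "\<And>x T. \<lbrakk>x \<in> carrier L; T \<subseteq> carrier M; \<And>y. y \<in> T \<Longrightarrow> (x, y) \<in> U\<rbrakk> \<Longrightarrow> (x, \<Squnion>\<^bsub>M\<^esub>T) \<in> U"
  shows "idl U"
  unfolding coproduct_ideal_def
proof (intro conjI allI impI ballI)
  show "case p of (x, y) \<Rightarrow> \<forall>x'\<in>carrier L. \<forall>y'\<in>carrier M.
      x' \<sqsubseteq>\<^bsub>L\<^esub> x \<longrightarrow> y' \<sqsubseteq>\<^bsub>M\<^esub> y \<longrightarrow> (x', y') \<in> U" if "p \<in> U" for p
    using that assms(2) by (cases p) blast
  show "U \<subseteq> carrier L \<times> carrier M" by fact
  show "(\<Squnion>\<^bsub>L\<^esub>S, y) \<in> U" if "S \<subseteq> carrier L" "y \<in> carrier M" "S \<times> {y} \<subseteq> U" for S y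
    using that by (intro assms(3)) auto
  show "(x, \<Squnion>\<^bsub>M\<^esub>T) \<in> U" if "x \<in> carrier L" "T \<subseteq> carrier M" "{x} \<times> T \<subseteq> U" for x T
    using that by (intro assms(4)) auto
qed

lemma idl_Inter:
  assumes "\<And>U. U \<in> F \<Longrightarrow> idl U"
  shows "idl (carrier L \<times> carrier M \<inter> \<Inter>F)"
proof (rule idlI)
  fix x y x' y' assume *: "(x, y) \<in> carrier L \<times> carrier M \<inter> \<Inter>F" "x' \<in> carrier L" "y' \<in> carrier M"
    "x' \<sqsubseteq>\<^bsub>L\<^esub> x" "y' \<sqsubseteq>\<^bsub>M\<^esub> y"
  have "(x', y') \<in> U" if "U \<in> F" for U using idlD(2)[OF assms[OF that]] * that by auto
  then show "(x', y') \<in> carrier L \<times> carrier M \<inter> \<Inter>F" using * by auto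
next
  fix S y assume *: "S \<subseteq> carrier L" "y \<in> carrier M" "\<And>x. x \<in> S \<Longrightarrow> (x, y) \<in> carrier L \<times> carrier M \<inter> \<Inter>F"
  have "(\<Squnion>\<^bsub>L\<^esub>S, y) \<in> U" if "U \<in> F" for U using idlD(3)[OF assms[OF that]] * that by auto
  then show "(\<Squnion>\<^bsub>L\<^esub>S, y) \<in> carrier L \<times> carrier M \<inter> \<Inter>F" using * by auto
next
  fix x T assume *: "x \<in> carrier L" "T \<subseteq> carrier M" "\<And>y. y \<in> T \<Longrightarrow> (x, y) \<in> carrier L \<times> carrier M \<inter> \<Inter>F"
  have "(x, \<Squnion>\<^bsub>M\<^esub>T) \<in> U" if "U \<in> F" for U using idlD(4)[OF assms[OF that]] * that by auto
  then show "(x, \<Squnion>\<^bsub>M\<^esub>T) \<in> carrier L \<times> carrier M \<inter> \<Inter>F" using * by auto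
qed auto

definition "cl V = carrier L \<times> carrier M \<inter> \<Inter>{U. idl U \<and> V \<subseteq> U}"

lemma cl_idl: "idl (cl V)" unfolding cl_def by (rule idl_Inter) auto
lemma cl_sub: "V \<subseteq> carrier L \<times> carrier M \<Longrightarrow> V \<subseteq> cl V" unfolding cl_def by auto
lemma cl_least: "idl U \<Longrightarrow> V \<subseteq> U \<Longrightarrow> cl V \<subseteq> U" unfolding cl_def by auto

lemma C_simps: "carrier C = Collect idl" "U \<sqsubseteq>\<^bsub>C\<^esub> V \<longleftrightarrow> U \<subseteq> V" "(.=\<^bsub>C\<^esub>) = (=)"
  by (auto simp: frame_coproduct_def)

lemma po_C: "partial_order C"
  by (rule partial_orderI_eq) (auto simp: C_simps)

lemma least_C: assumes "F \<subseteq> carrier C" shows "least C (cl (\<Union>F)) (Upper C F)"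
proof (rule least_UpperI)
  have "\<Union>F \<subseteq> carrier L \<times> carrier M" using assms idlD(1) by (auto simp: C_simps)
  then show "X \<sqsubseteq>\<^bsub>C\<^esub> cl (\<Union>F)" if "X \<in> F" for X using that cl_sub by (auto simp: C_simps)
  show "cl (\<Union>F) \<sqsubseteq>\<^bsub>C\<^esub> Y" if "Y \<in> Upper C F" for Y
    unfolding C_simps by (rule cl_least) (use that assms in \<open>auto simp: C_simps Upper_def\<close>)
qed (use assms cl_idl in \<open>auto simp: C_simps\<close>)

lemma cl_C: "complete_lattice C"
  by (rule complete_latticeI_sup[OF po_C]) (metis least_C)

lemma Sup_C: "F \<subseteq> carrier C \<Longrightarrow> \<Squnion>\<^bsub>C\<^esub>F = cl (\<Union>F)"
  by (rule complete_lattice.Sup_eqI[OF cl_C least_C])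

lemma idl_Int: assumes "idl U" "idl V" shows "idl (U \<inter> V)"
proof -
  have "idl (carrier L \<times> carrier M \<inter> \<Inter>{U, V})" by (rule idl_Inter) (use assms in auto)
  moreover have "carrier L \<times> carrier M \<inter> \<Inter>{U, V} = U \<inter> V" using idlD(1)[OF assms(1)] by auto
  ultimately show ?thesis by simp
qed

lemma meet_C: "idl U \<Longrightarrow> idl V \<Longrightarrow> U \<sqinter>\<^bsub>C\<^esub> V = U \<inter> V"
  by (rule complete_lattice.meet_eqI[OF cl_C greatest_Lower_pairI]) (auto simp: C_simps idl_Int)

lemma idl_residual:
  assumes U: "idl U" and W: "idl W"
  shows "idl {(a, b) \<in> carrier L \<times> carrier M. \<forall>(c, d) \<in> U. (c \<sqinter>\<^bsub>L\<^esub> a, d \<sqinter>\<^bsub>M\<^esub> b) \<in> W}" (is "idl ?R")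
proof -
  note UD = idlD[OF U] and WD = idlD[OF W]
  have R: "(a, b) \<in> ?R \<longleftrightarrow> a \<in> carrier L \<and> b \<in> carrier M \<and> (\<forall>c d. (c, d) \<in> U \<longrightarrow> (c \<sqinter>\<^bsub>L\<^esub> a, d \<sqinter>\<^bsub>M\<^esub> b) \<in> W)" for a b
    by auto
  show ?thesis
  proof (rule idlI)
    fix x y x' y' assume *: "(x, y) \<in> ?R" "x' \<in> carrier L" "y' \<in> carrier M" "x' \<sqsubseteq>\<^bsub>L\<^esub> x" "y' \<sqsubseteq>\<^bsub>M\<^esub> y"
    have "(c \<sqinter>\<^bsub>L\<^esub> x', d \<sqinter>\<^bsub>M\<^esub> y') \<in> W" if "(c, d) \<in> U" for c d
    proof -
      have cd: "c \<in> carrier L" "d \<in> carrier M" "x \<in> carrier L" "y \<in> carrier M" using that UD(1) * by auto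
      have 1: "c \<sqinter>\<^bsub>L\<^esub> x' \<sqsubseteq>\<^bsub>L\<^esub> c \<sqinter>\<^bsub>L\<^esub> x"
        using cd * by (meson L.meet_le L.meet_left L.meet_right L.le_trans L.meet_closed)
      have 2: "d \<sqinter>\<^bsub>M\<^esub> y' \<sqsubseteq>\<^bsub>M\<^esub> d \<sqinter>\<^bsub>M\<^esub> y"
        using cd * by (meson M.meet_le M.meet_left M.meet_right M.le_trans M.meet_closed)
      have 3: "(c \<sqinter>\<^bsub>L\<^esub> x, d \<sqinter>\<^bsub>M\<^esub> y) \<in> W" using * that by auto
      show ?thesis by (rule WD(2)[OF 3 _ _ 1 2]) (use cd * in auto)
    qed
    then show "(x', y') \<in> ?R" using * by auto
  next
    fix S y assume *: "S \<subseteq> carrier L" "y \<in> carrier M" "\<And>x. x \<in> S \<Longrightarrow> (x, y) \<in> ?R"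
    have "(c \<sqinter>\<^bsub>L\<^esub> \<Squnion>\<^bsub>L\<^esub>S, d \<sqinter>\<^bsub>M\<^esub> y) \<in> W" if "(c, d) \<in> U" for c d
    proof -
      have cd: "c \<in> carrier L" "d \<in> carrier M" using that UD(1) by auto
      have "(c \<sqinter>\<^bsub>L\<^esub> x, d \<sqinter>\<^bsub>M\<^esub> y) \<in> W" if "x \<in> S" for x
        using *(3)[OF that] \<open>(c, d) \<in> U\<close> unfolding R by blast
      then have "(\<Squnion>\<^bsub>L\<^esub>((\<lambda>x. c \<sqinter>\<^bsub>L\<^esub> x) ` S), d \<sqinter>\<^bsub>M\<^esub> y) \<in> W"
        by (intro WD(3)) (use cd *(1,2) in auto)
      then show ?thesis using cd * L.meet_Sup_distrib by simp
    qed
    then show "(\<Squnion>\<^bsub>L\<^esub>S, y) \<in> ?R" using * by auto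
  next
    fix x T assume *: "x \<in> carrier L" "T \<subseteq> carrier M" "\<And>y. y \<in> T \<Longrightarrow> (x, y) \<in> ?R"
    have "(c \<sqinter>\<^bsub>L\<^esub> x, d \<sqinter>\<^bsub>M\<^esub> \<Squnion>\<^bsub>M\<^esub>T) \<in> W" if "(c, d) \<in> U" for c d
    proof -
      have cd: "c \<in> carrier L" "d \<in> carrier M" using that UD(1) by auto
      have "(c \<sqinter>\<^bsub>L\<^esub> x, d \<sqinter>\<^bsub>M\<^esub> y) \<in> W" if "y \<in> T" for y
        using *(3)[OF that] \<open>(c, d) \<in> U\<close> unfolding R by blast
      then have "(c \<sqinter>\<^bsub>L\<^esub> x, \<Squnion>\<^bsub>M\<^esub>((\<lambda>y. d \<sqinter>\<^bsub>M\<^esub> y) ` T)) \<in> W"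
        by (intro WD(4)) (use cd *(1,2) in auto)
      then show ?thesis using cd * M.meet_Sup_distrib by simp
    qed
    then show "(x, \<Squnion>\<^bsub>M\<^esub>T) \<in> ?R" using * by auto
  qed auto
qed

lemma meet_idem: "a \<in> carrier L \<Longrightarrow> a \<sqinter>\<^bsub>L\<^esub> a = a" "b \<in> carrier M \<Longrightarrow> b \<sqinter>\<^bsub>M\<^esub> b = b"
  using L.le_iff_meet_eq[of a a] M.le_iff_meet_eq[of b b] by auto

lemma Int_meets: assumes "idl U" "idl V" "(a, b) \<in> U" "(c, d) \<in> V"
  shows "(a \<sqinter>\<^bsub>L\<^esub> c, b \<sqinter>\<^bsub>M\<^esub> d) \<in> U \<inter> V"
proof -
  have "a \<in> carrier L" "c \<in> carrier L" "b \<in> carrier M" "d \<in> carrier M"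
    using idlD(1)[OF assms(1)] idlD(1)[OF assms(2)] assms by auto
  then show ?thesis
    using idlD(2)[OF assms(1,3)] idlD(2)[OF assms(2,4)]
    by (simp add: L.meet_left L.meet_right M.meet_left M.meet_right)
qed

lemma frame_C: "frame C"
proof (intro frame.intro cl_C frame_axioms.intro)
  fix U F assume U: "U \<in> carrier C" and F: "F \<subseteq> carrier C"
  then have Ui: "idl U" and Fi: "\<And>V. V \<in> F \<Longrightarrow> idl V" by (auto simp: C_simps)
  have img: "(\<lambda>V. U \<sqinter>\<^bsub>C\<^esub> V) ` F = (\<lambda>V. U \<inter> V) ` F" by (rule image_cong) (auto simp: meet_C Ui Fi)
  have imgc: "(\<lambda>V. U \<inter> V) ` F \<subseteq> carrier C" using Ui Fi by (auto simp: C_simps idl_Int)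
  let ?W = "cl (\<Union>((\<lambda>V. U \<inter> V) ` F))"
  let ?R = "{(a, b) \<in> carrier L \<times> carrier M. \<forall>(c, d) \<in> U. (c \<sqinter>\<^bsub>L\<^esub> a, d \<sqinter>\<^bsub>M\<^esub> b) \<in> ?W}"
  have Wsub: "\<Union>((\<lambda>V. U \<inter> V) ` F) \<subseteq> ?W" by (rule cl_sub) (use idlD(1)[OF Ui] in auto)
  have "\<Union>F \<subseteq> ?R"
  proof
    fix p assume "p \<in> \<Union>F"
    then obtain a b V where p: "p = (a, b)" "V \<in> F" "(a, b) \<in> V" by (cases p) auto
    have "(c \<sqinter>\<^bsub>L\<^esub> a, d \<sqinter>\<^bsub>M\<^esub> b) \<in> ?W" if "(c, d) \<in> U" for c d
      using Int_meets[OF Ui Fi[OF p(2)] that p(3)] Wsub p(2) by blast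
    moreover have "a \<in> carrier L" "b \<in> carrier M" using p(3) idlD(1)[OF Fi[OF p(2)]] by auto
    ultimately show "p \<in> ?R" using p(1) by blast
  qed
  then have clR: "cl (\<Union>F) \<subseteq> ?R" using cl_least idl_residual[OF Ui cl_idl] by blast
  have "U \<inter> cl (\<Union>F) \<subseteq> ?W"
  proof
    fix p assume p: "p \<in> U \<inter> cl (\<Union>F)"
    obtain a b where ab: "p = (a, b)" by (cases p)
    then have "(a \<sqinter>\<^bsub>L\<^esub> a, b \<sqinter>\<^bsub>M\<^esub> b) \<in> ?W" using p clR by blast
    then show "p \<in> ?W" using ab p idlD(1)[OF Ui] meet_idem by auto
  qed
  moreover have "?W \<subseteq> U \<inter> cl (\<Union>F)"
  proof (rule cl_least[OF idl_Int[OF Ui cl_idl]])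
    have "\<Union>F \<subseteq> cl (\<Union>F)" by (rule cl_sub) (use idlD(1)[OF Fi] in auto)
    then show "\<Union>((\<lambda>V. U \<inter> V) ` F) \<subseteq> U \<inter> cl (\<Union>F)" by auto
  qed
  ultimately show "U \<sqinter>\<^bsub>C\<^esub> \<Squnion>\<^bsub>C\<^esub>F = \<Squnion>\<^bsub>C\<^esub>((\<lambda>V. U \<sqinter>\<^bsub>C\<^esub> V) ` F)"
    unfolding img Sup_C[OF F] Sup_C[OF imgc] using meet_C[OF Ui cl_idl] by auto
qed

lemma top_C: "\<top>\<^bsub>C\<^esub> = carrier L \<times> carrier M"
proof (rule complete_lattice.top_eqI[OF cl_C])
  have "idl (carrier L \<times> carrier M \<inter> \<Inter>{})" by (rule idl_Inter) auto
  then show "carrier L \<times> carrier M \<in> carrier C" by (simp add: C_simps)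
qed (auto simp: C_simps dest: idlD(1))

lemma bot_pairs: assumes "idl U"
  shows "a \<in> carrier L \<Longrightarrow> (a, \<bottom>\<^bsub>M\<^esub>) \<in> U" "b \<in> carrier M \<Longrightarrow> (\<bottom>\<^bsub>L\<^esub>, b) \<in> U"
  using idlD(4)[OF assms, of a "{}"] idlD(3)[OF assms, of "{}" b]
    L.weak_sup_empty M.weak_sup_empty L.eq_is_equal M.eq_is_equal by auto

lemma Sup_bot: "S \<subseteq> {\<bottom>\<^bsub>L\<^esub>} \<Longrightarrow> \<Squnion>\<^bsub>L\<^esub>S = \<bottom>\<^bsub>L\<^esub>" "T \<subseteq> {\<bottom>\<^bsub>M\<^esub>} \<Longrightarrow> \<Squnion>\<^bsub>M\<^esub>T = \<bottom>\<^bsub>M\<^esub>"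
proof -
  assume "S \<subseteq> {\<bottom>\<^bsub>L\<^esub>}" then have "S = {} \<or> S = {\<bottom>\<^bsub>L\<^esub>}" by auto
  then show "\<Squnion>\<^bsub>L\<^esub>S = \<bottom>\<^bsub>L\<^esub>" using L.weak_sup_empty L.eq_is_equal by auto
next
  assume "T \<subseteq> {\<bottom>\<^bsub>M\<^esub>}" then have "T = {} \<or> T = {\<bottom>\<^bsub>M\<^esub>}" by auto
  then show "\<Squnion>\<^bsub>M\<^esub>T = \<bottom>\<^bsub>M\<^esub>" using M.weak_sup_empty M.eq_is_equal by auto
qed

lemma idl_inl: assumes x: "x \<in> carrier L" shows "idl (coproduct_inl L M x)"
proof (rule idlI)
  fix a b a' b' assume *: "(a, b) \<in> coproduct_inl L M x" "a' \<in> carrier L" "b' \<in> carrier M" "a' \<sqsubseteq>\<^bsub>L\<^esub> a" "b' \<sqsubseteq>\<^bsub>M\<^esub> b"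
  have "b' = \<bottom>\<^bsub>M\<^esub>" if "b = \<bottom>\<^bsub>M\<^esub>" using that * M.bottom_lower M.le_antisym M.bottom_closed by metis
  then show "(a', b') \<in> coproduct_inl L M x" using * x L.le_trans[of a' a x] by (auto simp: coproduct_inl_def)
next
  fix S y assume *: "S \<subseteq> carrier L" "y \<in> carrier M" "\<And>a. a \<in> S \<Longrightarrow> (a, y) \<in> coproduct_inl L M x"
  then show "(\<Squnion>\<^bsub>L\<^esub>S, y) \<in> coproduct_inl L M x" using L.sup_least[of S x] x by (auto simp: coproduct_inl_def)
next
  fix a T assume *: "a \<in> carrier L" "T \<subseteq> carrier M" "\<And>y. y \<in> T \<Longrightarrow> (a, y) \<in> coproduct_inl L M x"
  then show "(a, \<Squnion>\<^bsub>M\<^esub>T) \<in> coproduct_inl L M x" using Sup_bot(2)[of T] by (auto simp: coproduct_inl_def)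
qed (auto simp: coproduct_inl_def)

lemma frame_map_inl: "frame_map L C (coproduct_inl L M)"
proof (rule frame_mapI[OF L.frame_axioms frame_C])
  let ?i = "coproduct_inl L M"
  show "?i \<in> carrier L \<rightarrow> carrier C" using idl_inl by (auto simp: C_simps)
  show "?i \<top>\<^bsub>L\<^esub> = \<top>\<^bsub>C\<^esub>" by (auto simp: top_C coproduct_inl_def L.top_higher)
  show "?i (x \<sqinter>\<^bsub>L\<^esub> y) = ?i x \<sqinter>\<^bsub>C\<^esub> ?i y" if xy: "x \<in> carrier L" "y \<in> carrier L" for x y
  proof -
    have "a \<sqsubseteq>\<^bsub>L\<^esub> x \<sqinter>\<^bsub>L\<^esub> y \<longleftrightarrow> a \<sqsubseteq>\<^bsub>L\<^esub> x \<and> a \<sqsubseteq>\<^bsub>L\<^esub> y" if "a \<in> carrier L" for a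
      using that xy by (meson L.meet_le L.meet_left L.meet_right L.le_trans L.meet_closed)
    then show ?thesis unfolding meet_C[OF idl_inl[OF xy(1)] idl_inl[OF xy(2)]]
      by (auto simp: coproduct_inl_def)
  qed
  fix A assume A: "A \<subseteq> carrier L"
  have iA: "?i ` A \<subseteq> carrier C" using A idl_inl by (auto simp: C_simps)
  have "cl (\<Union>(?i ` A)) \<subseteq> ?i (\<Squnion>\<^bsub>L\<^esub>A)"
  proof (rule cl_least[OF idl_inl])
    have "?i x \<subseteq> ?i (\<Squnion>\<^bsub>L\<^esub>A)" if "x \<in> A" for x
      using L.sup_upper[OF A that] that A L.le_trans[of _ x "\<Squnion>\<^bsub>L\<^esub>A"] by (auto simp: coproduct_inl_def)
    then show "\<Union>(?i ` A) \<subseteq> ?i (\<Squnion>\<^bsub>L\<^esub>A)" by auto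
  qed (use A in auto)
  moreover have "?i (\<Squnion>\<^bsub>L\<^esub>A) \<subseteq> cl (\<Union>(?i ` A))"
  proof (rule subsetI)
    fix p assume "p \<in> ?i (\<Squnion>\<^bsub>L\<^esub>A)"
    then obtain a b where p: "p = (a, b)" "a \<in> carrier L" "b \<in> carrier M" "a \<sqsubseteq>\<^bsub>L\<^esub> \<Squnion>\<^bsub>L\<^esub>A \<or> b = \<bottom>\<^bsub>M\<^esub>"
      by (auto simp: coproduct_inl_def)
    have "\<Union>(?i ` A) \<subseteq> cl (\<Union>(?i ` A))" by (rule cl_sub) (auto simp: coproduct_inl_def)
    moreover have "(x, b) \<in> ?i x" if "x \<in> A" for x using that A p by (auto simp: coproduct_inl_def)
    ultimately have "(\<Squnion>\<^bsub>L\<^esub>A, b) \<in> cl (\<Union>(?i ` A))" using idlD(3)[OF cl_idl A p(3)] by blast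
    then show "p \<in> cl (\<Union>(?i ` A))"
      using idlD(2)[OF cl_idl _ p(2,3) _ M.le_refl[OF p(3)]] bot_pairs(1)[OF cl_idl p(2)] p by auto
  qed
  ultimately show "?i (\<Squnion>\<^bsub>L\<^esub>A) = \<Squnion>\<^bsub>C\<^esub>(?i ` A)" using Sup_C[OF iA] by auto
qed

lemma idl_inr: assumes x: "x \<in> carrier M" shows "idl (coproduct_inr L M x)"
proof (rule idlI)
  fix a b a' b' assume *: "(a, b) \<in> coproduct_inr L M x" "a' \<in> carrier L" "b' \<in> carrier M" "a' \<sqsubseteq>\<^bsub>L\<^esub> a" "b' \<sqsubseteq>\<^bsub>M\<^esub> b"
  have "a' = \<bottom>\<^bsub>L\<^esub>" if "a = \<bottom>\<^bsub>L\<^esub>" using that * L.bottom_lower L.le_antisym L.bottom_closed by metis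
  then show "(a', b') \<in> coproduct_inr L M x" using * x M.le_trans[of b' b x] by (auto simp: coproduct_inr_def)
next
  fix S y assume *: "S \<subseteq> carrier L" "y \<in> carrier M" "\<And>a. a \<in> S \<Longrightarrow> (a, y) \<in> coproduct_inr L M x"
  then show "(\<Squnion>\<^bsub>L\<^esub>S, y) \<in> coproduct_inr L M x" using Sup_bot(1)[of S] by (auto simp: coproduct_inr_def)
next
  fix a T assume *: "a \<in> carrier L" "T \<subseteq> carrier M" "\<And>y. y \<in> T \<Longrightarrow> (a, y) \<in> coproduct_inr L M x"
  then show "(a, \<Squnion>\<^bsub>M\<^esub>T) \<in> coproduct_inr L M x" using M.sup_least[of T x] x by (auto simp: coproduct_inr_def)
qed (auto simp: coproduct_inr_def)

lemma frame_map_inr: "frame_map M C (coproduct_inr L M)"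
proof (rule frame_mapI[OF M.frame_axioms frame_C])
  let ?i = "coproduct_inr L M"
  show "?i \<in> carrier M \<rightarrow> carrier C" using idl_inr by (auto simp: C_simps)
  show "?i \<top>\<^bsub>M\<^esub> = \<top>\<^bsub>C\<^esub>" by (auto simp: top_C coproduct_inr_def M.top_higher)
  show "?i (x \<sqinter>\<^bsub>M\<^esub> y) = ?i x \<sqinter>\<^bsub>C\<^esub> ?i y" if xy: "x \<in> carrier M" "y \<in> carrier M" for x y
  proof -
    have "a \<sqsubseteq>\<^bsub>M\<^esub> x \<sqinter>\<^bsub>M\<^esub> y \<longleftrightarrow> a \<sqsubseteq>\<^bsub>M\<^esub> x \<and> a \<sqsubseteq>\<^bsub>M\<^esub> y" if "a \<in> carrier M" for a
      using that xy by (meson M.meet_le M.meet_left M.meet_right M.le_trans M.meet_closed)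
    then show ?thesis unfolding meet_C[OF idl_inr[OF xy(1)] idl_inr[OF xy(2)]]
      by (auto simp: coproduct_inr_def)
  qed
  fix A assume A: "A \<subseteq> carrier M"
  have iA: "?i ` A \<subseteq> carrier C" using A idl_inr by (auto simp: C_simps)
  have "cl (\<Union>(?i ` A)) \<subseteq> ?i (\<Squnion>\<^bsub>M\<^esub>A)"
  proof (rule cl_least[OF idl_inr])
    have "?i x \<subseteq> ?i (\<Squnion>\<^bsub>M\<^esub>A)" if "x \<in> A" for x
      using M.sup_upper[OF A that] that A M.le_trans[of _ x "\<Squnion>\<^bsub>M\<^esub>A"] by (auto simp: coproduct_inr_def)
    then show "\<Union>(?i ` A) \<subseteq> ?i (\<Squnion>\<^bsub>M\<^esub>A)" by auto
  qed (use A in auto)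
  moreover have "?i (\<Squnion>\<^bsub>M\<^esub>A) \<subseteq> cl (\<Union>(?i ` A))"
  proof (rule subsetI)
    fix p assume "p \<in> ?i (\<Squnion>\<^bsub>M\<^esub>A)"
    then obtain a b where p: "p = (a, b)" "a \<in> carrier L" "b \<in> carrier M" "b \<sqsubseteq>\<^bsub>M\<^esub> \<Squnion>\<^bsub>M\<^esub>A \<or> a = \<bottom>\<^bsub>L\<^esub>"
      by (auto simp: coproduct_inr_def)
    have "\<Union>(?i ` A) \<subseteq> cl (\<Union>(?i ` A))" by (rule cl_sub) (auto simp: coproduct_inr_def)
    moreover have "(a, x) \<in> ?i x" if "x \<in> A" for x using that A p by (auto simp: coproduct_inr_def)
    ultimately have "(a, \<Squnion>\<^bsub>M\<^esub>A) \<in> cl (\<Union>(?i ` A))" using idlD(4)[OF cl_idl p(2) A] by blast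
    then show "p \<in> cl (\<Union>(?i ` A))"
      using idlD(2)[OF cl_idl _ p(2,3) L.le_refl[OF p(2)]] bot_pairs(2)[OF cl_idl p(3)] p by auto
  qed
  ultimately show "?i (\<Squnion>\<^bsub>M\<^esub>A) = \<Squnion>\<^bsub>C\<^esub>(?i ` A)" using Sup_C[OF iA] by auto
qed

lemma inl_inr_Int: assumes "x \<in> carrier L" "y \<in> carrier M" "idl U" "(x, y) \<in> U"
  shows "coproduct_inl L M x \<sqinter>\<^bsub>C\<^esub> coproduct_inr L M y \<subseteq> U"
  unfolding meet_C[OF idl_inl[OF assms(1)] idl_inr[OF assms(2)]]
  using idlD(2)[OF assms(3,4)] bot_pairs[OF assms(3)]
  by (auto simp: coproduct_inl_def coproduct_inr_def)

lemma decompose: assumes U: "idl U"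
  shows "U = \<Squnion>\<^bsub>C\<^esub>((\<lambda>(x, y). coproduct_inl L M x \<sqinter>\<^bsub>C\<^esub> coproduct_inr L M y) ` U)" (is "_ = \<Squnion>\<^bsub>C\<^esub>?F")
proof -
  have UD: "U \<subseteq> carrier L \<times> carrier M" using idlD(1)[OF U] .
  have F: "?F \<subseteq> carrier C" using UD by (auto simp: C_simps meet_C idl_inl idl_inr idl_Int)
  have "coproduct_inl L M x \<sqinter>\<^bsub>C\<^esub> coproduct_inr L M y \<subseteq> U" if "(x, y) \<in> U" for x y
    by (rule inl_inr_Int[OF _ _ U that]) (use UD that in auto)
  then have "\<Union>?F \<subseteq> U" by blast
  then have 1: "cl (\<Union>?F) \<subseteq> U" by (rule cl_least[OF U])
  have "(x, y) \<in> coproduct_inl L M x \<sqinter>\<^bsub>C\<^esub> coproduct_inr L M y" if "(x, y) \<in> U" for x y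
  proof -
    have xy: "x \<in> carrier L" "y \<in> carrier M" using that UD by auto
    then show ?thesis unfolding meet_C[OF idl_inl[OF xy(1)] idl_inr[OF xy(2)]]
      by (auto simp: coproduct_inl_def coproduct_inr_def)
  qed
  then have "U \<subseteq> \<Union>?F" by fast
  moreover have "\<Union>?F \<subseteq> cl (\<Union>?F)"
    by (rule cl_sub) (use F idlD(1) in \<open>auto simp: C_simps\<close>)
  ultimately show ?thesis using 1 Sup_C[OF F] by auto
qed

end

theorem coproduct_universal:
  fixes L :: "'a gorder" and M :: "'b gorder" and N :: "'c gorder"
  assumes f: "frame_map L N f" and g: "frame_map M N g"
  defines "C \<equiv> frame_coproduct L M" and "h \<equiv> coproduct_copair N f g"
  shows "frame_map L C (coproduct_inl L M)" and "frame_map M C (coproduct_inr L M)"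
    and "frame_map C N h"
    and "\<And>x. x \<in> carrier L \<Longrightarrow> h (coproduct_inl L M x) = f x"
    and "\<And>y. y \<in> carrier M \<Longrightarrow> h (coproduct_inr L M y) = g y"
    and "\<And>k U. \<lbrakk>frame_map C N k; \<And>x. x \<in> carrier L \<Longrightarrow> k (coproduct_inl L M x) = f x;
      \<And>y. y \<in> carrier M \<Longrightarrow> k (coproduct_inr L M y) = g y; U \<in> carrier C\<rbrakk> \<Longrightarrow> k U = h U"
proof -
  note F = frame_mapD[OF f] and G = frame_mapD[OF g]
  interpret framepair L M by (intro framepair.intro F(1) G(1))
  interpret N: frame N by (rule F(2))
  interpret CF: frame "frame_coproduct L M" by (rule frame_C)
  show il: "frame_map L C (coproduct_inl L M)" unfolding C_def by (rule frame_map_inl)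
  show ir: "frame_map M C (coproduct_inr L M)" unfolding C_def by (rule frame_map_inr)
  have fc: "f x \<in> carrier N" if "x \<in> carrier L" for x using F(3) that by auto
  have gc: "g x \<in> carrier N" if "x \<in> carrier M" for x using G(3) that by auto
  have fmono: "f x \<sqsubseteq>\<^bsub>N\<^esub> f y" if "x \<sqsubseteq>\<^bsub>L\<^esub> y" "x \<in> carrier L" "y \<in> carrier L" for x y
    using that F(5)[of x y] fc by (metis L.le_iff_meet_eq N.le_iff_meet_eq)
  have gmono: "g x \<sqsubseteq>\<^bsub>N\<^esub> g y" if "x \<sqsubseteq>\<^bsub>M\<^esub> y" "x \<in> carrier M" "y \<in> carrier M" for x y
    using that G(5)[of x y] gc by (metis M.le_iff_meet_eq N.le_iff_meet_eq)
  have meet_mono: "a \<sqinter>\<^bsub>N\<^esub> b \<sqsubseteq>\<^bsub>N\<^esub> c \<sqinter>\<^bsub>N\<^esub> d"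
    if "a \<sqsubseteq>\<^bsub>N\<^esub> c" "b \<sqsubseteq>\<^bsub>N\<^esub> d" "a \<in> carrier N" "b \<in> carrier N" "c \<in> carrier N" "d \<in> carrier N" for a b c d
    using that by (meson N.meet_le N.meet_left N.meet_right N.le_trans N.meet_closed)
  let ?r = "\<lambda>(a, b). f a \<sqinter>\<^bsub>N\<^esub> g b"
  have rc: "?r ` U \<subseteq> carrier N" if "U \<subseteq> carrier L \<times> carrier M" for U using that fc gc by auto
  have hc: "h U \<in> carrier N" if "U \<subseteq> carrier L \<times> carrier M" for U
    unfolding h_def coproduct_copair_def using rc[OF that] by simp
  have hle: "h U \<sqsubseteq>\<^bsub>N\<^esub> n" if "U \<subseteq> carrier L \<times> carrier M" "n \<in> carrier N"
    "\<And>a b. (a, b) \<in> U \<Longrightarrow> f a \<sqinter>\<^bsub>N\<^esub> g b \<sqsubseteq>\<^bsub>N\<^esub> n" for U n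
    unfolding h_def coproduct_copair_def by (rule N.sup_least) (use that rc in auto)
  have hge: "f a \<sqinter>\<^bsub>N\<^esub> g b \<sqsubseteq>\<^bsub>N\<^esub> h U" if "U \<subseteq> carrier L \<times> carrier M" "(a, b) \<in> U" for U a b
    unfolding h_def coproduct_copair_def by (rule N.sup_upper) (use that rc[OF that(1)] in force)+
  have idn: "coproduct_ideal L M {(a, b) \<in> carrier L \<times> carrier M. f a \<sqinter>\<^bsub>N\<^esub> g b \<sqsubseteq>\<^bsub>N\<^esub> n}" (is "coproduct_ideal L M ?I")
    if n: "n \<in> carrier N" for n
  proof (rule idlI)
    fix x y x' y' assume *: "(x, y) \<in> ?I" "x' \<in> carrier L" "y' \<in> carrier M" "x' \<sqsubseteq>\<^bsub>L\<^esub> x" "y' \<sqsubseteq>\<^bsub>M\<^esub> y"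
    then have "f x' \<sqinter>\<^bsub>N\<^esub> g y' \<sqsubseteq>\<^bsub>N\<^esub> f x \<sqinter>\<^bsub>N\<^esub> g y"
      by (intro meet_mono fmono gmono) (auto simp: fc gc)
    then show "(x', y') \<in> ?I" using * n N.le_trans[of "f x' \<sqinter>\<^bsub>N\<^esub> g y'" "f x \<sqinter>\<^bsub>N\<^esub> g y" n] fc gc by auto
  next
    fix S y assume *: "S \<subseteq> carrier L" "y \<in> carrier M" "\<And>x. x \<in> S \<Longrightarrow> (x, y) \<in> ?I"
    have "f (\<Squnion>\<^bsub>L\<^esub>S) \<sqinter>\<^bsub>N\<^esub> g y = g y \<sqinter>\<^bsub>N\<^esub> \<Squnion>\<^bsub>N\<^esub>(f ` S)" using F(4)[OF *(1)] by (simp add: meet_comm)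
    also have "\<dots> = \<Squnion>\<^bsub>N\<^esub>((\<lambda>x. g y \<sqinter>\<^bsub>N\<^esub> x) ` f ` S)" by (rule N.meet_Sup_distrib) (use * fc gc in auto)
    also have "\<dots> \<sqsubseteq>\<^bsub>N\<^esub> n" by (rule N.sup_least) (use * fc gc n in \<open>auto simp: meet_comm[of N "g y"]\<close>)
    finally show "(\<Squnion>\<^bsub>L\<^esub>S, y) \<in> ?I" using * by auto
  next
    fix x T assume *: "x \<in> carrier L" "T \<subseteq> carrier M" "\<And>y. y \<in> T \<Longrightarrow> (x, y) \<in> ?I"
    have "f x \<sqinter>\<^bsub>N\<^esub> g (\<Squnion>\<^bsub>M\<^esub>T) = f x \<sqinter>\<^bsub>N\<^esub> \<Squnion>\<^bsub>N\<^esub>(g ` T)" using G(4)[OF *(2)] by simp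
    also have "\<dots> = \<Squnion>\<^bsub>N\<^esub>((\<lambda>z. f x \<sqinter>\<^bsub>N\<^esub> z) ` g ` T)" by (rule N.meet_Sup_distrib) (use * fc gc in auto)
    also have "\<dots> \<sqsubseteq>\<^bsub>N\<^esub> n" by (rule N.sup_least) (use * fc gc n in auto)
    finally show "(x, \<Squnion>\<^bsub>M\<^esub>T) \<in> ?I" using * by auto
  qed auto
  have hmono: "h U \<sqsubseteq>\<^bsub>N\<^esub> h V" if "U \<subseteq> V" "V \<subseteq> carrier L \<times> carrier M" for U V
    by (rule hle) (use that hc hge in auto)
  have IC: "U \<subseteq> carrier L \<times> carrier M" if "U \<in> carrier C" for U using that idlD(1) by (auto simp: C_def C_simps)
  have tops: "f \<top>\<^bsub>L\<^esub> = \<top>\<^bsub>N\<^esub>" "g \<top>\<^bsub>M\<^esub> = \<top>\<^bsub>N\<^esub>" using F(6) G(6) .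
  have meet_top: "n \<sqinter>\<^bsub>N\<^esub> \<top>\<^bsub>N\<^esub> = n" "\<top>\<^bsub>N\<^esub> \<sqinter>\<^bsub>N\<^esub> n = n" if "n \<in> carrier N" for n
  proof -
    show "n \<sqinter>\<^bsub>N\<^esub> \<top>\<^bsub>N\<^esub> = n" using that N.le_iff_meet_eq N.top_higher by simp
    then show "\<top>\<^bsub>N\<^esub> \<sqinter>\<^bsub>N\<^esub> n = n" by (simp add: meet_comm)
  qed
  have bots: "f \<bottom>\<^bsub>L\<^esub> = \<bottom>\<^bsub>N\<^esub>" "g \<bottom>\<^bsub>M\<^esub> = \<bottom>\<^bsub>N\<^esub>"
    using F(4)[of "{}"] G(4)[of "{}"] L.weak_sup_empty M.weak_sup_empty N.weak_sup_empty
      L.eq_is_equal M.eq_is_equal N.eq_is_equal by auto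
  have meet_bot: "n \<sqinter>\<^bsub>N\<^esub> \<bottom>\<^bsub>N\<^esub> = \<bottom>\<^bsub>N\<^esub>" "\<bottom>\<^bsub>N\<^esub> \<sqinter>\<^bsub>N\<^esub> n = \<bottom>\<^bsub>N\<^esub>" if "n \<in> carrier N" for n
  proof -
    show "\<bottom>\<^bsub>N\<^esub> \<sqinter>\<^bsub>N\<^esub> n = \<bottom>\<^bsub>N\<^esub>" using that N.le_iff_meet_eq N.bottom_lower by simp
    then show "n \<sqinter>\<^bsub>N\<^esub> \<bottom>\<^bsub>N\<^esub> = \<bottom>\<^bsub>N\<^esub>" by (simp add: meet_comm)
  qed
  show "h (coproduct_inl L M x) = f x" if x: "x \<in> carrier L" for x
  proof (rule N.le_antisym)
    have s: "coproduct_inl L M x \<subseteq> carrier L \<times> carrier M" by (auto simp: coproduct_inl_def)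
    show "h (coproduct_inl L M x) \<in> carrier N" "f x \<in> carrier N" using s hc fc x by auto
    show "h (coproduct_inl L M x) \<sqsubseteq>\<^bsub>N\<^esub> f x"
    proof (rule hle[OF s fc[OF x]])
      fix a b assume "(a, b) \<in> coproduct_inl L M x"
      then consider "a \<in> carrier L" "b \<in> carrier M" "a \<sqsubseteq>\<^bsub>L\<^esub> x" | "a \<in> carrier L" "b = \<bottom>\<^bsub>M\<^esub>" by (auto simp: coproduct_inl_def)
      then show "f a \<sqinter>\<^bsub>N\<^esub> g b \<sqsubseteq>\<^bsub>N\<^esub> f x"
      proof cases
        case 1 then show ?thesis using fmono[of a x] x fc gc by (meson N.meet_left N.le_trans N.meet_closed)
      next
        case 2 then show ?thesis using x fc by (simp add: bots meet_bot N.bottom_lower)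
      qed
    qed
    show "f x \<sqsubseteq>\<^bsub>N\<^esub> h (coproduct_inl L M x)"
      using hge[OF s, of x "\<top>\<^bsub>M\<^esub>"] x fc by (simp add: tops meet_top coproduct_inl_def)
  qed
  show "h (coproduct_inr L M x) = g x" if x: "x \<in> carrier M" for x
  proof (rule N.le_antisym)
    have s: "coproduct_inr L M x \<subseteq> carrier L \<times> carrier M" by (auto simp: coproduct_inr_def)
    show "h (coproduct_inr L M x) \<in> carrier N" "g x \<in> carrier N" using s hc gc x by auto
    show "h (coproduct_inr L M x) \<sqsubseteq>\<^bsub>N\<^esub> g x"
    proof (rule hle[OF s gc[OF x]])
      fix a b assume "(a, b) \<in> coproduct_inr L M x"
      then consider "a \<in> carrier L" "b \<in> carrier M" "b \<sqsubseteq>\<^bsub>M\<^esub> x" | "b \<in> carrier M" "a = \<bottom>\<^bsub>L\<^esub>" by (auto simp: coproduct_inr_def)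
      then show "f a \<sqinter>\<^bsub>N\<^esub> g b \<sqsubseteq>\<^bsub>N\<^esub> g x"
      proof cases
        case 1 then show ?thesis using gmono[of b x] x fc gc by (meson N.meet_right N.le_trans N.meet_closed)
      next
        case 2 then show ?thesis using x gc by (simp add: bots meet_bot N.bottom_lower)
      qed
    qed
    show "g x \<sqsubseteq>\<^bsub>N\<^esub> h (coproduct_inr L M x)"
      using hge[OF s, of "\<top>\<^bsub>L\<^esub>" x] x gc by (simp add: tops meet_top coproduct_inr_def)
  qed
  show "frame_map C N h"
  proof (rule frame_mapI)
    show "frame C" unfolding C_def by (rule frame_C)
    show "frame N" by (rule F(2))
    show "h \<in> carrier C \<rightarrow> carrier N" using IC hc by auto
    show "h \<top>\<^bsub>C\<^esub> = \<top>\<^bsub>N\<^esub>"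
    proof (rule N.le_antisym)
      show "h \<top>\<^bsub>C\<^esub> \<in> carrier N" by (simp add: C_def top_C hc)
      then show "h \<top>\<^bsub>C\<^esub> \<sqsubseteq>\<^bsub>N\<^esub> \<top>\<^bsub>N\<^esub>" by (rule N.top_higher)
      show "\<top>\<^bsub>N\<^esub> \<sqsubseteq>\<^bsub>N\<^esub> h \<top>\<^bsub>C\<^esub>"
        using hge[of "carrier L \<times> carrier M" "\<top>\<^bsub>L\<^esub>" "\<top>\<^bsub>M\<^esub>"] by (simp add: tops meet_top C_def top_C)
    qed simp
  next
    fix Us assume Us: "Us \<subseteq> carrier C"
    have Us': "\<Union>Us \<subseteq> carrier L \<times> carrier M" using Us IC by auto
    have clc: "cl (\<Union>Us) \<subseteq> carrier L \<times> carrier M" using idlD(1)[OF cl_idl] .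
    have hUs: "h ` Us \<subseteq> carrier N" using Us IC hc by auto
    have "h (cl (\<Union>Us)) = \<Squnion>\<^bsub>N\<^esub>(h ` Us)"
    proof (rule N.le_antisym)
      let ?n = "\<Squnion>\<^bsub>N\<^esub>(h ` Us)"
      have n: "?n \<in> carrier N" using hUs by simp
      have "\<Union>Us \<subseteq> {(a, b) \<in> carrier L \<times> carrier M. f a \<sqinter>\<^bsub>N\<^esub> g b \<sqsubseteq>\<^bsub>N\<^esub> ?n}"
      proof
        fix p assume "p \<in> \<Union>Us"
        then obtain a b U where p: "p = (a, b)" "U \<in> Us" "(a, b) \<in> U" by (cases p) auto
        have U: "U \<subseteq> carrier L \<times> carrier M" using p Us IC by auto
        have "h U \<sqsubseteq>\<^bsub>N\<^esub> ?n" by (rule N.sup_upper[OF hUs]) (use p in auto)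
        then have "f a \<sqinter>\<^bsub>N\<^esub> g b \<sqsubseteq>\<^bsub>N\<^esub> ?n"
          using N.le_trans[OF hge[OF U p(3)]] U p fc gc hc[OF U] n by auto
        then show "p \<in> {(a, b) \<in> carrier L \<times> carrier M. f a \<sqinter>\<^bsub>N\<^esub> g b \<sqsubseteq>\<^bsub>N\<^esub> ?n}" using p U by auto
      qed
      then have "cl (\<Union>Us) \<subseteq> {(a, b) \<in> carrier L \<times> carrier M. f a \<sqinter>\<^bsub>N\<^esub> g b \<sqsubseteq>\<^bsub>N\<^esub> ?n}"
        by (rule cl_least[OF idn[OF n]])
      then show "h (cl (\<Union>Us)) \<sqsubseteq>\<^bsub>N\<^esub> ?n" by (intro hle[OF clc n]) auto
      show "?n \<sqsubseteq>\<^bsub>N\<^esub> h (cl (\<Union>Us))"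
        by (rule N.sup_least[OF hUs hc[OF clc]]) (use hmono[OF _ clc] cl_sub[OF Us'] in blast)
    qed (use hc[OF clc] hUs in auto)
    then show "h (\<Squnion>\<^bsub>C\<^esub>Us) = \<Squnion>\<^bsub>N\<^esub>(h ` Us)" using Us Sup_C by (simp add: C_def)
  next
    fix U V assume UV: "U \<in> carrier C" "V \<in> carrier C"
    then have i: "coproduct_ideal L M U" "coproduct_ideal L M V" by (auto simp: C_def C_simps)
    have c: "U \<subseteq> carrier L \<times> carrier M" "V \<subseteq> carrier L \<times> carrier M" using UV IC by auto
    have Ic: "U \<inter> V \<subseteq> carrier L \<times> carrier M" using c by auto
    have "h (U \<inter> V) = h U \<sqinter>\<^bsub>N\<^esub> h V"
    proof (rule N.le_antisym)
      show "h (U \<inter> V) \<sqsubseteq>\<^bsub>N\<^esub> h U \<sqinter>\<^bsub>N\<^esub> h V"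
        by (rule N.meet_le) (use hmono c hc Ic in auto)
      have rr: "?r p \<sqinter>\<^bsub>N\<^esub> ?r p' \<sqsubseteq>\<^bsub>N\<^esub> h (U \<inter> V)" if "p \<in> U" "p' \<in> V" for p p'
      proof -
        obtain a b c' d where p: "p = (a, b)" "p' = (c', d)" by (cases p, cases p')
        then have car: "a \<in> carrier L" "b \<in> carrier M" "c' \<in> carrier L" "d \<in> carrier M" using that c by auto
        have "f (a \<sqinter>\<^bsub>L\<^esub> c') \<sqinter>\<^bsub>N\<^esub> g (b \<sqinter>\<^bsub>M\<^esub> d) \<sqsubseteq>\<^bsub>N\<^esub> h (U \<inter> V)"
          by (rule hge[OF Ic]) (use Int_meets[OF i] that p in auto)
        moreover have "f (a \<sqinter>\<^bsub>L\<^esub> c') \<sqinter>\<^bsub>N\<^esub> g (b \<sqinter>\<^bsub>M\<^esub> d) = (f a \<sqinter>\<^bsub>N\<^esub> g b) \<sqinter>\<^bsub>N\<^esub> (f c' \<sqinter>\<^bsub>N\<^esub> g d)"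
          using car fc gc F(5) G(5) by (metis N.meet_assoc N.meet_closed meet_comm)
        ultimately show ?thesis using p by simp
      qed
      have hV: "n \<sqinter>\<^bsub>N\<^esub> h W = \<Squnion>\<^bsub>N\<^esub>((\<lambda>p. n \<sqinter>\<^bsub>N\<^esub> ?r p) ` W)"
        if "n \<in> carrier N" "W \<subseteq> carrier L \<times> carrier M" for n W
        unfolding h_def coproduct_copair_def using N.meet_Sup_distrib[OF that(1) rc[OF that(2)]] by (simp add: image_image)
      have r1: "?r p \<in> carrier N" if "p \<in> U" for p using rc[OF c(1)] that by blast
      have r2: "?r p \<in> carrier N" if "p \<in> V" for p using rc[OF c(2)] that by blast
      have "?r p \<sqinter>\<^bsub>N\<^esub> h V \<sqsubseteq>\<^bsub>N\<^esub> h (U \<inter> V)" if "p \<in> U" for p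
        unfolding hV[OF r1[OF that] c(2)]
        by (rule N.sup_least) (use rr[OF that] r1[OF that] r2 hc[OF Ic] N.meet_closed in \<open>auto simp del: split_paired_All\<close>)
      then have "\<Squnion>\<^bsub>N\<^esub>((\<lambda>p. h V \<sqinter>\<^bsub>N\<^esub> ?r p) ` U) \<sqsubseteq>\<^bsub>N\<^esub> h (U \<inter> V)"
        by (intro N.sup_least image_subsetI N.meet_closed hc c Ic r1) (auto simp: meet_comm[of N "h V"])
      then show "h U \<sqinter>\<^bsub>N\<^esub> h V \<sqsubseteq>\<^bsub>N\<^esub> h (U \<inter> V)" using hV[OF hc[OF c(2)] c(1)] by (simp add: meet_comm)
    qed (use c hc Ic in auto)
    then show "h (U \<sqinter>\<^bsub>C\<^esub> V) = h U \<sqinter>\<^bsub>N\<^esub> h V" using meet_C i by (simp add: C_def)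
  qed
  show "k U = h U" if k: "frame_map C N k" and kl: "\<And>x. x \<in> carrier L \<Longrightarrow> k (coproduct_inl L M x) = f x"
    and kr: "\<And>y. y \<in> carrier M \<Longrightarrow> k (coproduct_inr L M y) = g y" and U: "U \<in> carrier C" for k U
  proof -
    note K = frame_mapD[OF k]
    let ?F = "(\<lambda>(x, y). coproduct_inl L M x \<sqinter>\<^bsub>C\<^esub> coproduct_inr L M y) ` U"
    have i: "coproduct_ideal L M U" using U by (simp add: C_def C_simps)
    have c: "U \<subseteq> carrier L \<times> carrier M" using IC U by auto
    have lr: "coproduct_inl L M x \<in> carrier C" "coproduct_inr L M y \<in> carrier C" if "(x, y) \<in> U" for x y
      using that c idl_inl idl_inr by (auto simp: C_def C_simps)
    have Fc: "?F \<subseteq> carrier C" using lr by (auto simp: C_def)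
    have "k U = k (\<Squnion>\<^bsub>C\<^esub>?F)" using decompose[OF i] by (simp add: C_def)
    also have "\<dots> = \<Squnion>\<^bsub>N\<^esub>(k ` ?F)" by (rule K(4)[OF Fc])
    also have "k ` ?F = ?r ` U" unfolding image_image
      by (rule image_cong) (use lr c K(5) kl kr in auto)
    finally show ?thesis by (simp add: h_def coproduct_copair_def)
  qed
qed

end

theory Submission
  imports Defs
begin

text \<open>
  For a frame \<open>L\<close> and a set \<open>F\<close> of elements closed under finite joins, the subframe \<open>G\<close> of the
  congruence frame generated by all \<open>\<nabla> x\<close> and the \<open>\<Delta> s\<close> with \<open>s \<in> F\<close> consists of the joins of
  congruences \<open>\<nabla> x \<inter> \<Delta> s\<close>, and \<open>\<nabla> x \<inter> \<Delta> s \<subseteq> \<theta>\<close> means \<open>(x \<sqinter> s, x) \<in> \<theta>\<close>. Hence \<open>\<nabla> : L \<rightarrow> G\<close> is the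
  universal frame map that complements the elements of \<open>F\<close>: an \<open>f : L \<rightarrow> N\<close> with every \<open>f s\<close>
  complemented extends to \<open>G\<close> as the left adjoint of \<open>n \<mapsto> {(x, y). f x \<squnion> n = f y \<squnion> n}\<close>.

  Let \<open>Q\<close> be the quotient of the coproduct of the two parts of the assembly by all inequalities
  between finite elements that hold in the assembly. A finitary presentation of \<open>L\<close> consists of
  inequalities that hold in \<open>Q\<close> after applying \<open>\<nabla>\<close>, so there is a frame map \<open>L \<rightarrow> Q\<close>. It sends finite
  elements to complemented ones, because \<open>\<nabla> p \<sqinter> \<Delta> p = \<bottom>\<close> and \<open>\<nabla> p \<squnion> \<Delta> p = \<top>\<close> relate finite
  elements of the coproduct. So it extends to the main component of the assembly, and \<open>Q\<close> is
  that main component.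
\<close>

section \<open>Distributivity and complements in frames\<close>

text \<open>The kernel of the canonical map onto the main component always contains the congruence
  generated by the valid finite inequalities; the content is the reverse inclusion. A pair in the
  kernel may involve arbitrary joins, so it cannot be compared with finite inequalities directly.
  The universal property of the main component replaces this comparison: it yields a map back to
  \<open>Q\<close>, and a map out of the coproduct is determined by its values on the two parts. On
  their generators the values at closed congruences are prescribed, and those at open ones are
  forced because complements in a frame are unique.

  Finiteness enters twice. \<open>\<Delta>\<close> turns joins into meets, and a subframe is closed
  only under finite ones. Likewise, complements in \<open>Q\<close> are known for elements of the
  two parts of \<open>L\<close> and pass only to finite meets and joins of these. The presentation
  of \<open>L\<close> has to be finitary because \<open>Q\<close> imposes only inequalities between
  finite elements.\<close>

context complete_lattice begin

lemma join_le_iff: "\<lbrakk>x \<in> carrier L; y \<in> carrier L; z \<in> carrier L\<rbrakk> \<Longrightarrow> x \<squnion> y \<sqsubseteq> z \<longleftrightarrow> x \<sqsubseteq> z \<and> y \<sqsubseteq> z"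
  using le_trans[OF join_left, of x y z] le_trans[OF join_right, of x y z] join_le[of x z y] by auto

lemma le_meet_iff: "\<lbrakk>x \<in> carrier L; y \<in> carrier L; z \<in> carrier L\<rbrakk> \<Longrightarrow> z \<sqsubseteq> x \<sqinter> y \<longleftrightarrow> z \<sqsubseteq> x \<and> z \<sqsubseteq> y"
  using le_trans[OF _ meet_left, of z x y] le_trans[OF _ meet_right, of z x y] meet_le[of z x y] by auto

lemma meet_mono:
  assumes "x \<sqsubseteq> x'" "y \<sqsubseteq> y'" "x \<in> carrier L" "x' \<in> carrier L" "y \<in> carrier L" "y' \<in> carrier L"
  shows "x \<sqinter> y \<sqsubseteq> x' \<sqinter> y'"
  using assms le_trans[OF meet_left, of x y x'] le_trans[OF meet_right, of x y y'] by (simp add: le_meet_iff)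

lemma join_mono:
  assumes "x \<sqsubseteq> x'" "y \<sqsubseteq> y'" "x \<in> carrier L" "x' \<in> carrier L" "y \<in> carrier L" "y' \<in> carrier L"
  shows "x \<squnion> y \<sqsubseteq> x' \<squnion> y'"
  using assms le_trans[OF _ join_left, of x x' y'] le_trans[OF _ join_right, of y y' x'] by (simp add: join_le_iff)

lemma Sup_le_iff:
  assumes "A \<subseteq> carrier L" "z \<in> carrier L"
  shows "\<Squnion>A \<sqsubseteq> z \<longleftrightarrow> (\<forall>x \<in> A. x \<sqsubseteq> z)"
proof
  show "\<forall>x \<in> A. x \<sqsubseteq> z" if "\<Squnion>A \<sqsubseteq> z"
    using that assms le_trans[OF sup_upper[OF assms(1)], of _ z] by auto
qed (use assms in \<open>auto intro: sup_least\<close>)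

text \<open>The standard way below to prove equations between joins: a join is known through its
  upper bounds, and adjunctions are statements about upper bounds as well.\<close>

lemma eq_by_upper_bounds:
  "\<lbrakk>x \<in> carrier L; y \<in> carrier L; \<And>n. n \<in> carrier L \<Longrightarrow> x \<sqsubseteq> n \<longleftrightarrow> y \<sqsubseteq> n\<rbrakk> \<Longrightarrow> x = y"
  by (rule le_antisym) (use le_refl in blast)+

lemma Sup_empty_eq: "\<Squnion>{} = \<bottom>"
  using weak_sup_empty eq_is_equal by simp

lemma Sup_insert_eq: "\<lbrakk>a \<in> carrier L; A \<subseteq> carrier L\<rbrakk> \<Longrightarrow> \<Squnion>(insert a A) = a \<squnion> \<Squnion>A"
  using weak_sup_insert[of a A] eq_is_equal by simp

lemma meet_lattice_simps:
  assumes "x \<in> carrier L"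
  shows "x \<sqinter> x = x" "x \<sqinter> \<top> = x" "\<top> \<sqinter> x = x" "x \<sqinter> \<bottom> = \<bottom>" "\<bottom> \<sqinter> x = \<bottom>"
    "x \<squnion> x = x" "x \<squnion> \<top> = \<top>" "\<top> \<squnion> x = \<top>" "x \<squnion> \<bottom> = x" "\<bottom> \<squnion> x = x"
proof -
  show "x \<sqinter> x = x" using assms le_iff_meet_eq[of x x] by simp
  show "\<top> \<sqinter> x = x" "\<bottom> \<sqinter> x = \<bottom>" "\<top> \<squnion> x = \<top>" "\<bottom> \<squnion> x = x"
    using assms top_meet bottom_meet top_join bottom_join eq_is_equal by auto
  then show "x \<sqinter> \<top> = x" "x \<sqinter> \<bottom> = \<bottom>" "x \<squnion> \<top> = \<top>" "x \<squnion> \<bottom> = x"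
    by (simp_all add: meet_comm join_comm)
  show "x \<squnion> x = x" using assms join_le_iff[of x x x] join_left[of x x] by (intro le_antisym) auto
qed

lemma absorb_simps:
  assumes "x \<in> carrier L" "y \<in> carrier L"
  shows "x \<sqinter> (x \<squnion> y) = x" "x \<squnion> (x \<sqinter> y) = x" "y \<squnion> (x \<sqinter> y) = y" "y \<sqinter> (x \<squnion> y) = y"
proof -
  have *: "x \<sqinter> (x \<squnion> y) = x" "x \<squnion> (x \<sqinter> y) = x" if "x \<in> carrier L" "y \<in> carrier L" for x y
    using that by (auto intro!: le_antisym simp: le_meet_iff join_le_iff join_left meet_left)
  show "x \<sqinter> (x \<squnion> y) = x" "x \<squnion> (x \<sqinter> y) = x" using * assms by auto
  show "y \<squnion> (x \<sqinter> y) = y" "y \<sqinter> (x \<squnion> y) = y"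
    using *[of y x] assms by (auto simp: meet_comm join_comm)
qed

end

context frame begin

lemma meet_join_distrib:
  assumes "a \<in> carrier L" "b \<in> carrier L" "c \<in> carrier L"
  shows "a \<sqinter> (b \<squnion> c) = (a \<sqinter> b) \<squnion> (a \<sqinter> c)" "(b \<squnion> c) \<sqinter> a = (b \<sqinter> a) \<squnion> (c \<sqinter> a)"
proof -
  show "a \<sqinter> (b \<squnion> c) = (a \<sqinter> b) \<squnion> (a \<sqinter> c)"
    using meet_Sup_distrib[of a "{b, c}"] assms by (simp add: join_def)
  then show "(b \<squnion> c) \<sqinter> a = (b \<sqinter> a) \<squnion> (c \<sqinter> a)" by (simp add: meet_comm)
qed

lemma join_meet_distrib:
  assumes "a \<in> carrier L" "b \<in> carrier L" "c \<in> carrier L"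
  shows "a \<squnion> (b \<sqinter> c) = (a \<squnion> b) \<sqinter> (a \<squnion> c)" "(b \<sqinter> c) \<squnion> a = (b \<squnion> a) \<sqinter> (c \<squnion> a)"
proof -
  have "(a \<squnion> b) \<sqinter> (a \<squnion> c) = a \<squnion> (b \<sqinter> (a \<squnion> c))"
    using assms by (simp add: meet_join_distrib(2)[of "a \<squnion> c" a b] absorb_simps)
  also have "\<dots> = (a \<squnion> (b \<sqinter> a)) \<squnion> (b \<sqinter> c)"
    using assms by (simp add: meet_join_distrib(1)[of b a c] join_assoc)
  also have "\<dots> = a \<squnion> (b \<sqinter> c)" using assms by (simp add: absorb_simps)
  finally show "a \<squnion> (b \<sqinter> c) = (a \<squnion> b) \<sqinter> (a \<squnion> c)" by simp
  then show "(b \<sqinter> c) \<squnion> a = (b \<squnion> a) \<sqinter> (c \<squnion> a)" by (simp add: join_comm)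
qed

lemma meet_Sup_le_iff:
  assumes "a \<in> carrier L" "A \<subseteq> carrier L" "n \<in> carrier L"
  shows "a \<sqinter> \<Squnion>A \<sqsubseteq> n \<longleftrightarrow> (\<forall>x \<in> A. a \<sqinter> x \<sqsubseteq> n)" "\<Squnion>A \<sqinter> a \<sqsubseteq> n \<longleftrightarrow> (\<forall>x \<in> A. x \<sqinter> a \<sqsubseteq> n)"
proof -
  have "(\<lambda>x. a \<sqinter> x) ` A \<subseteq> carrier L" using assms by auto
  then show "a \<sqinter> \<Squnion>A \<sqsubseteq> n \<longleftrightarrow> (\<forall>x \<in> A. a \<sqinter> x \<sqsubseteq> n)"
    using assms by (simp add: meet_Sup_distrib Sup_le_iff)
  then show "\<Squnion>A \<sqinter> a \<sqsubseteq> n \<longleftrightarrow> (\<forall>x \<in> A. x \<sqinter> a \<sqsubseteq> n)" by (simp add: meet_comm)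
qed

lemma Sup_meet_Sup:
  assumes "A \<subseteq> carrier L" "A' \<subseteq> carrier L"
  shows "\<Squnion>A \<sqinter> \<Squnion>A' = \<Squnion>{x \<sqinter> y | x y. x \<in> A \<and> y \<in> A'}"
proof (rule eq_by_upper_bounds)
  have M: "{x \<sqinter> y | x y. x \<in> A \<and> y \<in> A'} \<subseteq> carrier L" using assms by (auto intro!: meet_closed)
  then show "\<Squnion>{x \<sqinter> y | x y. x \<in> A \<and> y \<in> A'} \<in> carrier L" by (rule sup_closed)
  fix n assume n: "n \<in> carrier L"
  have "\<Squnion>A \<sqinter> \<Squnion>A' \<sqsubseteq> n \<longleftrightarrow> (\<forall>x \<in> A. x \<sqinter> \<Squnion>A' \<sqsubseteq> n)"
    using n assms by (simp add: meet_Sup_le_iff(2))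
  also have "\<dots> \<longleftrightarrow> (\<forall>x \<in> A. \<forall>y \<in> A'. x \<sqinter> y \<sqsubseteq> n)"
    using n assms by (intro ball_cong meet_Sup_le_iff(1)) auto
  also have "\<dots> \<longleftrightarrow> \<Squnion>{x \<sqinter> y | x y. x \<in> A \<and> y \<in> A'} \<sqsubseteq> n"
    unfolding Sup_le_iff[OF M n] by blast
  finally show "\<Squnion>A \<sqinter> \<Squnion>A' \<sqsubseteq> n \<longleftrightarrow> \<Squnion>{x \<sqinter> y | x y. x \<in> A \<and> y \<in> A'} \<sqsubseteq> n" .
qed (use assms in auto)

section \<open>Complements in a frame\<close>

definition complements :: "'a \<Rightarrow> 'a \<Rightarrow> bool" where
  "complements a b \<longleftrightarrow> a \<in> carrier L \<and> b \<in> carrier L \<and> a \<sqinter> b = \<bottom> \<and> a \<squnion> b = \<top>"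

lemma complementsD:
  assumes "complements a b"
  shows "a \<in> carrier L" "b \<in> carrier L" "a \<sqinter> b = \<bottom>" "a \<squnion> b = \<top>"
  using assms by (auto simp: complements_def)

lemma complements_sym: "complements a b \<Longrightarrow> complements b a"
  by (auto simp: complements_def meet_comm join_comm)

text \<open>The element \<open>x\<close> splits as
  \<open>(x \<sqinter> a) \<squnion> (x \<sqinter> b)\<close>, and meeting with \<open>b\<close>
  removes the first summand. The right-hand side mentions only \<open>a\<close>, so it makes sense
  in frames where the complement \<open>b\<close> is absent; this is how a condition on a congruence
  becomes one on a complement.\<close>

lemma complement_le_iff:
  assumes "complements a b" "x \<in> carrier L" "n \<in> carrier L"
  shows "x \<sqinter> b \<sqsubseteq> n \<longleftrightarrow> x \<sqsubseteq> (x \<sqinter> a) \<squnion> n"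
proof
  note D = complementsD[OF assms(1)]
  assume *: "x \<sqinter> b \<sqsubseteq> n"
  have "x = (x \<sqinter> a) \<squnion> (x \<sqinter> b)"
    using D assms(2) meet_join_distrib(1)[of x a b] by (simp add: meet_lattice_simps)
  moreover have "(x \<sqinter> a) \<squnion> (x \<sqinter> b) \<sqsubseteq> (x \<sqinter> a) \<squnion> n"
    using D assms * by (intro join_mono) auto
  ultimately show "x \<sqsubseteq> (x \<sqinter> a) \<squnion> n" by simp
next
  note D = complementsD[OF assms(1)]
  assume *: "x \<sqsubseteq> (x \<sqinter> a) \<squnion> n"
  then have "x \<sqinter> b \<sqsubseteq> ((x \<sqinter> a) \<squnion> n) \<sqinter> b"
    using D assms by (intro meet_mono) auto
  also have "((x \<sqinter> a) \<squnion> n) \<sqinter> b = n \<sqinter> b"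
    using D assms by (simp add: meet_join_distrib meet_assoc meet_lattice_simps)
  finally show "x \<sqinter> b \<sqsubseteq> n" using D assms by (simp add: le_meet_iff)
qed

text \<open>By \<open>complement_le_iff\<close> at \<open>x = \<top>\<close>, the upper bounds of a
  complement are determined by \<open>a\<close> alone.\<close>

lemma complements_unique:
  assumes "complements a b" "complements a c"
  shows "b = c"
proof -
  note D = complementsD[OF assms(1)] complementsD[OF assms(2)]
  have "\<top> \<sqinter> b \<sqsubseteq> n \<longleftrightarrow> \<top> \<sqinter> c \<sqsubseteq> n" if "n \<in> carrier L" for n
    using complement_le_iff[OF assms(1), of \<top> n] complement_le_iff[OF assms(2), of \<top> n] that by simp
  then show ?thesis using D by (intro eq_by_upper_bounds) (auto simp: meet_lattice_simps)
qed

lemma complements_meet: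
  assumes "complements a b" "complements c d"
  shows "complements (a \<sqinter> c) (b \<squnion> d)"
proof -
  note D = complementsD[OF assms(1)] complementsD[OF assms(2)]
  have "(a \<sqinter> c) \<sqinter> (b \<squnion> d) = \<bottom>"
  proof -
    have "(a \<sqinter> c) \<sqinter> b = \<bottom>" "(a \<sqinter> c) \<sqinter> d = \<bottom>"
      using D by (metis meet_assoc meet_comm meet_lattice_simps(4), metis meet_assoc meet_lattice_simps(4))
    then show ?thesis using D by (simp add: meet_join_distrib meet_lattice_simps)
  qed
  moreover have "(a \<sqinter> c) \<squnion> (b \<squnion> d) = \<top>"
  proof -
    have "a \<squnion> (b \<squnion> d) = \<top>" "c \<squnion> (b \<squnion> d) = \<top>"
      using D by (metis join_assoc meet_lattice_simps(8), metis join_assoc join_comm meet_lattice_simps(8))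
    then show ?thesis using D by (simp add: join_meet_distrib meet_lattice_simps)
  qed
  ultimately show ?thesis using D by (simp add: complements_def)
qed

lemma complements_join: "complements a b \<Longrightarrow> complements c d \<Longrightarrow> complements (a \<squnion> c) (b \<sqinter> d)"
  by (rule complements_sym[OF complements_meet[OF complements_sym complements_sym]])

lemma complements_bottom: "complements \<bottom> \<top>"
  by (simp add: complements_def meet_lattice_simps)

text \<open>Each join of two complemented elements needs the meet of their complements, so the
  induction stops at finite joins. This is what makes the images of finite elements
  complemented.\<close>

lemma complemented_finite_Sup:
  assumes "finite S" "\<And>s. s \<in> S \<Longrightarrow> \<exists>c. complements s c"
  shows "\<exists>c. complements (\<Squnion>S) c"
  using assms
proof (induction rule: finite_induct)
  case empty
  then show ?case using complements_bottom by (auto simp: Sup_empty_eq)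
next
  case (insert x S)
  obtain d where "complements (\<Squnion>S) d" using insert.IH insert.prems by auto
  moreover obtain c where "complements x c" using insert.prems by auto
  moreover have "x \<in> carrier L" "S \<subseteq> carrier L" using insert.prems complementsD(1) by blast+
  ultimately show ?case using complements_join by (fastforce simp: Sup_insert_eq)
qed

end

lemma frame_map_complements:
  assumes "frame_map L M f" "frame.complements L a b"
  shows "frame.complements M (f a) (f b)"
proof -
  note F = frame_mapD[OF assms(1)]
  interpret L: frame L by (rule F)
  interpret M: frame M by (rule F)
  note D = L.complementsD[OF assms(2)]
  have "f (a \<squnion>\<^bsub>L\<^esub> b) = f a \<squnion>\<^bsub>M\<^esub> f b" using F(4)[of "{a, b}"] D by (simp add: join_def)
  moreover have "f \<bottom>\<^bsub>L\<^esub> = \<bottom>\<^bsub>M\<^esub>" using F(4)[of "{}"] by (simp add: L.Sup_empty_eq M.Sup_empty_eq)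
  moreover have "f a \<in> carrier M" "f b \<in> carrier M" using F(3) D by auto
  ultimately show ?thesis using D F(5)[of a b] F(6) by (simp add: M.complements_def)
qed

lemma frame_map_mono:
  assumes "frame_map L M f" "x \<sqsubseteq>\<^bsub>L\<^esub> y" "x \<in> carrier L" "y \<in> carrier L"
  shows "f x \<sqsubseteq>\<^bsub>M\<^esub> f y"
proof -
  note F = frame_mapD[OF assms(1)]
  interpret L: frame L by (rule F)
  interpret M: frame M by (rule F)
  have "f x \<in> carrier M" "f y \<in> carrier M" using F(3) assms by auto
  then show ?thesis using assms F(5)[of x y] by (metis L.le_iff_meet_eq M.le_iff_meet_eq)
qed

section \<open>The frame of congruences\<close>

lemma (in framecong) cjoin:
  assumes "(x, y) \<in> \<theta>" "(u, v) \<in> \<theta>"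
  shows "(x \<squnion> u, y \<squnion> v) \<in> \<theta>"
  using csup[of "{(x, y), (u, v)}"] assms by (simp add: join_def)

text \<open>Used at two levels: for a frame, and for its frame of congruences, whose subframes are
  the components of the assembly.\<close>

locale gorder_frame = frame L for L :: "'a gorder" (structure)
begin

abbreviation "A \<equiv> congruence_frame L"

lemma congruenceI:
  assumes "\<theta> \<subseteq> carrier L \<times> carrier L" "\<And>x. x \<in> carrier L \<Longrightarrow> (x, x) \<in> \<theta>"
    and "\<And>x y. (x, y) \<in> \<theta> \<Longrightarrow> (y, x) \<in> \<theta>" "\<And>x y z. \<lbrakk>(x, y) \<in> \<theta>; (y, z) \<in> \<theta>\<rbrakk> \<Longrightarrow> (x, z) \<in> \<theta>"
    and "\<And>x y u v. \<lbrakk>(x, y) \<in> \<theta>; (u, v) \<in> \<theta>\<rbrakk> \<Longrightarrow> (x \<sqinter> u, y \<sqinter> v) \<in> \<theta>"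
    and "\<And>S. S \<subseteq> \<theta> \<Longrightarrow> (\<Squnion>(fst ` S), \<Squnion>(snd ` S)) \<in> \<theta>"
  shows "frame_congruence L \<theta>"
proof -
  have "equiv (carrier L) \<theta>"
  proof (rule equivI)
    show "\<theta> \<subseteq> carrier L \<times> carrier L" by fact
    show "refl_on (carrier L) \<theta>" using assms(1,2) by (auto simp: refl_on_def)
    show "sym \<theta>" using assms(3) by (auto intro: symI)
    show "trans \<theta>" using assms(4) by (blast intro: transI)
  qed
  then show ?thesis using assms(5,6) by (auto simp: frame_congruence_def)
qed

lemma framecongI: "frame_congruence L \<theta> \<Longrightarrow> framecong L \<theta>"
  by unfold_locales

text \<open>Intersecting with the full relation gives the empty family the right value, the greatest
  congruence.\<close>

lemma congruence_Inter:
  assumes "\<And>\<theta>. \<theta> \<in> F \<Longrightarrow> frame_congruence L \<theta>"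
  shows "frame_congruence L (carrier L \<times> carrier L \<inter> \<Inter>F)"
proof (rule congruenceI)
  note c = framecongI[OF assms]
  show "(x, x) \<in> carrier L \<times> carrier L \<inter> \<Inter>F" if "x \<in> carrier L" for x
    using that framecong.crefl[OF c] by auto
  show "(y, x) \<in> carrier L \<times> carrier L \<inter> \<Inter>F" if "(x, y) \<in> carrier L \<times> carrier L \<inter> \<Inter>F" for x y
    using that framecong.csym[OF c] by auto
  show "(x, z) \<in> carrier L \<times> carrier L \<inter> \<Inter>F"
    if "(x, y) \<in> carrier L \<times> carrier L \<inter> \<Inter>F" "(y, z) \<in> carrier L \<times> carrier L \<inter> \<Inter>F" for x y z
    using that framecong.ctrans[OF c, of _ x y z] by auto
  show "(x \<sqinter> u, y \<sqinter> v) \<in> carrier L \<times> carrier L \<inter> \<Inter>F"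
    if "(x, y) \<in> carrier L \<times> carrier L \<inter> \<Inter>F" "(u, v) \<in> carrier L \<times> carrier L \<inter> \<Inter>F" for x y u v
    using that framecong.cmeet[OF c, of _ x y u v] by auto
  fix S assume S: "S \<subseteq> carrier L \<times> carrier L \<inter> \<Inter>F"
  have "(\<Squnion>(fst ` S), \<Squnion>(snd ` S)) \<in> \<theta>" if "\<theta> \<in> F" for \<theta>
    by (rule framecong.csup[OF c]) (use that S in auto)
  moreover have "fst ` S \<subseteq> carrier L" "snd ` S \<subseteq> carrier L" using S by auto
  ultimately show "(\<Squnion>(fst ` S), \<Squnion>(snd ` S)) \<in> carrier L \<times> carrier L \<inter> \<Inter>F" by simp
qed auto

lemma congruence_Int:
  assumes "frame_congruence L \<theta>" "frame_congruence L \<chi>"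
  shows "frame_congruence L (\<theta> \<inter> \<chi>)"
proof -
  interpret \<theta>: framecong L \<theta> using assms(1) by (rule framecongI)
  have "carrier L \<times> carrier L \<inter> \<Inter>{\<theta>, \<chi>} = \<theta> \<inter> \<chi>" using \<theta>.carr by auto
  then show ?thesis using congruence_Inter[of "{\<theta>, \<chi>}"] assms by auto
qed

lemma congruence_frame_simps:
  "carrier A = Collect (frame_congruence L)" "\<theta> \<sqsubseteq>\<^bsub>A\<^esub> \<chi> \<longleftrightarrow> \<theta> \<subseteq> \<chi>" "(.=\<^bsub>A\<^esub>) = (=)"
  by (auto simp: congruence_frame_def)

lemma congruence_complete_lattice: "complete_lattice A"
proof (rule complete_latticeI_sup)
  show "partial_order A" by (rule partial_orderI_eq) (auto simp: congruence_frame_simps)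
  fix F assume F: "F \<subseteq> carrier A"
  let ?s = "carrier L \<times> carrier L \<inter> \<Inter>{\<theta>. frame_congruence L \<theta> \<and> \<Union>F \<subseteq> \<theta>}"
  have "\<theta> \<subseteq> carrier L \<times> carrier L" if "\<theta> \<in> F" for \<theta>
    using that F framecong.carr[OF framecongI] by (auto simp: congruence_frame_simps)
  then have "least A ?s (Upper A F)"
  proof (intro least_UpperI)
    show "?s \<in> carrier A" unfolding congruence_frame_simps by (rule CollectI, rule congruence_Inter) blast
    show "?s \<sqsubseteq>\<^bsub>A\<^esub> \<chi>" if "\<chi> \<in> Upper A F" for \<chi>
    proof -
      have "frame_congruence L \<chi>" "\<Union>F \<subseteq> \<chi>"
        using that F by (auto simp: congruence_frame_simps Upper_def)
      then show ?thesis unfolding congruence_frame_simps by blast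
    qed
  qed (use F in \<open>auto simp: congruence_frame_simps\<close>)
  then show "\<exists>s. least A s (Upper A F)" by blast
qed

sublocale A: complete_lattice A by (rule congruence_complete_lattice)

lemma congruence_meet:
  "\<lbrakk>frame_congruence L \<theta>; frame_congruence L \<chi>\<rbrakk> \<Longrightarrow> \<theta> \<sqinter>\<^bsub>A\<^esub> \<chi> = \<theta> \<inter> \<chi>"
  by (rule A.meet_eqI[OF greatest_Lower_pairI]) (auto simp: congruence_frame_simps congruence_Int)

lemma congruence_top: "\<top>\<^bsub>A\<^esub> = carrier L \<times> carrier L"
proof (rule A.top_eqI)
  show "carrier L \<times> carrier L \<in> carrier A"
    using congruence_Inter[of "{}"] by (simp add: congruence_frame_simps)
  show "\<theta> \<sqsubseteq>\<^bsub>A\<^esub> carrier L \<times> carrier L" if "\<theta> \<in> carrier A" for \<theta>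
    using that framecong.carr[OF framecongI] by (auto simp: congruence_frame_simps)
qed

text \<open>
  The Heyting implication of \<open>A\<close>: a pair lies in \<open>\<theta> \<rightarrow> \<chi>\<close> iff its truncation to every
  interval \<open>[a, b]\<close> with \<open>(a, b) \<in> \<theta>\<close> lies in \<open>\<chi>\<close>.
\<close>

definition congruence_implication :: "('a \<times> 'a) set \<Rightarrow> ('a \<times> 'a) set \<Rightarrow> ('a \<times> 'a) set" where
  "congruence_implication \<theta> \<chi> = {(x, y) \<in> carrier L \<times> carrier L.
     \<forall>(a, b) \<in> \<theta>. a \<sqsubseteq> b \<longrightarrow> ((x \<sqinter> b) \<squnion> a, (y \<sqinter> b) \<squnion> a) \<in> \<chi>}"

lemma congruence_implication_iff:
  "(x, y) \<in> congruence_implication \<theta> \<chi> \<longleftrightarrow> x \<in> carrier L \<and> y \<in> carrier L \<and>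
     (\<forall>a b. (a, b) \<in> \<theta> \<longrightarrow> a \<sqsubseteq> b \<longrightarrow> ((x \<sqinter> b) \<squnion> a, (y \<sqinter> b) \<squnion> a) \<in> \<chi>)"
  by (auto simp: congruence_implication_def)

text \<open>Truncation \<open>(x \<sqinter> b) \<squnion> a\<close> preserves binary meets and
  nonempty joins by distributivity, so the pairs whose truncations lie in \<open>\<chi>\<close>
  inherit the closure properties of \<open>\<chi>\<close>.\<close>

lemma congruence_congruence_implication:
  assumes "frame_congruence L \<theta>" "frame_congruence L \<chi>"
  shows "frame_congruence L (congruence_implication \<theta> \<chi>)"
proof -
  interpret \<theta>: framecong L \<theta> using assms(1) by (rule framecongI)
  interpret \<chi>: framecong L \<chi> using assms(2) by (rule framecongI)
  show ?thesis
  proof (rule congruenceI)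
    show "congruence_implication \<theta> \<chi> \<subseteq> carrier L \<times> carrier L"
      by (auto simp: congruence_implication_def)
    show "(x, x) \<in> congruence_implication \<theta> \<chi>" if "x \<in> carrier L" for x
      using that \<theta>.carr by (auto simp: congruence_implication_iff intro!: \<chi>.crefl)
    show "(y, x) \<in> congruence_implication \<theta> \<chi>" if "(x, y) \<in> congruence_implication \<theta> \<chi>" for x y
      using that by (simp add: congruence_implication_iff \<chi>.csym)
    show "(x, z) \<in> congruence_implication \<theta> \<chi>"
      if "(x, y) \<in> congruence_implication \<theta> \<chi>" "(y, z) \<in> congruence_implication \<theta> \<chi>" for x y z
      using that unfolding congruence_implication_iff by (blast intro: \<chi>.ctrans)
  next
    fix x y u v
    assume *: "(x, y) \<in> congruence_implication \<theta> \<chi>" "(u, v) \<in> congruence_implication \<theta> \<chi>"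
    have "(((x \<sqinter> u) \<sqinter> b) \<squnion> a, ((y \<sqinter> v) \<sqinter> b) \<squnion> a) \<in> \<chi>" if ab: "(a, b) \<in> \<theta>" "a \<sqsubseteq> b" for a b
    proof -
      have split: "((s \<sqinter> t) \<sqinter> b) \<squnion> a = ((s \<sqinter> b) \<squnion> a) \<sqinter> ((t \<sqinter> b) \<squnion> a)"
        if "s \<in> carrier L" "t \<in> carrier L" for s t
      proof -
        have c: "a \<in> carrier L" "b \<in> carrier L" using \<theta>.carr ab by auto
        then have "(s \<sqinter> t) \<sqinter> b = (s \<sqinter> b) \<sqinter> (t \<sqinter> b)"
          using that by (metis meet_assoc meet_closed meet_comm meet_lattice_simps(1))
        then show ?thesis using that c by (simp add: join_meet_distrib(2)[of a "s \<sqinter> b" "t \<sqinter> b"])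
      qed
      have "(((x \<sqinter> b) \<squnion> a) \<sqinter> ((u \<sqinter> b) \<squnion> a), ((y \<sqinter> b) \<squnion> a) \<sqinter> ((v \<sqinter> b) \<squnion> a)) \<in> \<chi>"
        using * ab unfolding congruence_implication_iff by (blast intro: \<chi>.cmeet)
      then show ?thesis using * split unfolding congruence_implication_iff by simp
    qed
    then show "(x \<sqinter> u, y \<sqinter> v) \<in> congruence_implication \<theta> \<chi>"
      using * by (simp add: congruence_implication_iff)
  next
    fix S assume S: "S \<subseteq> congruence_implication \<theta> \<chi>"
    have Sc: "fst ` S \<subseteq> carrier L" "snd ` S \<subseteq> carrier L"
      using S by (auto simp: congruence_implication_def)
    have "((\<Squnion>(fst ` S) \<sqinter> b) \<squnion> a, (\<Squnion>(snd ` S) \<sqinter> b) \<squnion> a) \<in> \<chi>" if ab: "(a, b) \<in> \<theta>" "a \<sqsubseteq> b" for a b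
    proof -
      have c: "a \<in> carrier L" "b \<in> carrier L" using \<theta>.carr ab by auto
      let ?t = "\<lambda>x. (x \<sqinter> b) \<squnion> a"
      \<comment> \<open>The inserted \<open>a\<close> is for empty \<open>X\<close>: the truncation
        of \<open>\<bottom>\<close> is \<open>a\<close>, not \<open>\<bottom>\<close>. For nonempty
        \<open>X\<close> it changes nothing.\<close>
      have trunc: "?t (\<Squnion>X) = \<Squnion>(insert a (?t ` X))" if X: "X \<subseteq> carrier L" for X
      proof (rule eq_by_upper_bounds)
        have tX: "?t ` X \<subseteq> carrier L" using X c by auto
        show "?t (\<Squnion>X) \<in> carrier L" "\<Squnion>(insert a (?t ` X)) \<in> carrier L" using X c tX by auto
        fix n assume n: "n \<in> carrier L"
        have "?t x \<sqsubseteq> n \<longleftrightarrow> x \<sqinter> b \<sqsubseteq> n \<and> a \<sqsubseteq> n" if "x \<in> X" for x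
          using that X c n by (auto simp: join_le_iff)
        then have "(\<forall>x \<in> insert a (?t ` X). x \<sqsubseteq> n) \<longleftrightarrow> (\<forall>x \<in> X. x \<sqinter> b \<sqsubseteq> n) \<and> a \<sqsubseteq> n" by auto
        moreover have "?t (\<Squnion>X) \<sqsubseteq> n \<longleftrightarrow> (\<forall>x \<in> X. x \<sqinter> b \<sqsubseteq> n) \<and> a \<sqsubseteq> n"
          using X c n by (simp add: join_le_iff meet_Sup_le_iff)
        moreover have "\<Squnion>(insert a (?t ` X)) \<sqsubseteq> n \<longleftrightarrow> (\<forall>x \<in> insert a (?t ` X). x \<sqsubseteq> n)"
          by (rule Sup_le_iff) (use c tX n in auto)
        ultimately show "?t (\<Squnion>X) \<sqsubseteq> n \<longleftrightarrow> \<Squnion>(insert a (?t ` X)) \<sqsubseteq> n" by blast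
      qed
      let ?S = "insert (a, a) ((\<lambda>(x, y). (?t x, ?t y)) ` S)"
      have "?S \<subseteq> \<chi>"
        using S ab \<chi>.crefl[OF c(1)] by (auto simp: congruence_implication_def)
      then have "(\<Squnion>(fst ` ?S), \<Squnion>(snd ` ?S)) \<in> \<chi>" by (rule \<chi>.csup)
      moreover have "fst ` ?S = insert a (?t ` fst ` S)" "snd ` ?S = insert a (?t ` snd ` S)"
        by (auto simp: image_image case_prod_beta)
      ultimately show ?thesis by (simp only: trunc[OF Sc(1)] trunc[OF Sc(2)])
    qed
    then show "(\<Squnion>(fst ` S), \<Squnion>(snd ` S)) \<in> congruence_implication \<theta> \<chi>"
      using Sc by (simp add: congruence_implication_iff)
  qed
qed

text \<open>For \<open>(x, y)\<close> in \<open>\<theta>\<close> the interval from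
  \<open>x \<sqinter> y\<close> to \<open>x \<squnion> y\<close> is collapsed by
  \<open>\<theta>\<close>, and truncation to it fixes \<open>x\<close> and \<open>y\<close> by
  absorption. Conversely, truncation to an interval collapsed by \<open>\<theta>\<close> sends every
  element into the class of \<open>a\<close>, so truncated pairs of \<open>\<psi>\<close> lie in
  \<open>\<theta>\<close> as well.\<close>

lemma subset_congruence_implication:
  assumes \<theta>: "frame_congruence L \<theta>" and \<psi>: "frame_congruence L \<psi>" and \<chi>: "frame_congruence L \<chi>"
  shows "\<psi> \<subseteq> congruence_implication \<theta> \<chi> \<longleftrightarrow> \<theta> \<inter> \<psi> \<subseteq> \<chi>"
proof
  interpret \<theta>: framecong L \<theta> using \<theta> by (rule framecongI)
  interpret \<psi>: framecong L \<psi> using \<psi> by (rule framecongI)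
  {
    assume *: "\<psi> \<subseteq> congruence_implication \<theta> \<chi>"
    show "\<theta> \<inter> \<psi> \<subseteq> \<chi>"
    proof clarify
      fix x y assume xy: "(x, y) \<in> \<theta>" "(x, y) \<in> \<psi>"
      then have c: "x \<in> carrier L" "y \<in> carrier L" using \<theta>.carr by auto
      have "(x \<sqinter> y, y \<sqinter> y) \<in> \<theta>" "(x \<squnion> y, y \<squnion> y) \<in> \<theta>"
        using \<theta>.cmeet[OF xy(1)] \<theta>.cjoin[OF xy(1)] c \<theta>.crefl by auto
      then have "(x \<sqinter> y, x \<squnion> y) \<in> \<theta>"
        using c by (metis \<theta>.csym \<theta>.ctrans meet_lattice_simps(1,6))
      moreover have "x \<sqinter> y \<sqsubseteq> x \<squnion> y"
        using c le_trans[OF meet_left join_left] by auto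
      ultimately have "((x \<sqinter> (x \<squnion> y)) \<squnion> (x \<sqinter> y), (y \<sqinter> (x \<squnion> y)) \<squnion> (x \<sqinter> y)) \<in> \<chi>"
        using * xy(2) congruence_implication_iff by blast
      then show "(x, y) \<in> \<chi>" using c by (simp add: absorb_simps)
    qed
  next
    assume *: "\<theta> \<inter> \<psi> \<subseteq> \<chi>"
    show "\<psi> \<subseteq> congruence_implication \<theta> \<chi>"
    proof clarify
      fix x y assume xy: "(x, y) \<in> \<psi>"
      then have c: "x \<in> carrier L" "y \<in> carrier L" using \<psi>.carr by auto
      have "((x \<sqinter> b) \<squnion> a, (y \<sqinter> b) \<squnion> a) \<in> \<chi>" if ab: "(a, b) \<in> \<theta>" "a \<sqsubseteq> b" for a b
      proof -
        have c': "a \<in> carrier L" "b \<in> carrier L" using \<theta>.carr ab by auto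
        have "((z \<sqinter> b) \<squnion> a, a) \<in> \<theta>" if z: "z \<in> carrier L" for z
        proof -
          have "((z \<sqinter> b) \<squnion> a, (z \<sqinter> a) \<squnion> a) \<in> \<theta>"
            using z c' ab by (intro \<theta>.cjoin \<theta>.cmeet \<theta>.crefl \<theta>.csym[OF ab(1)])
          then show ?thesis using z c' by (simp add: absorb_simps join_comm[of L "z \<sqinter> a" a])
        qed
        then have "((x \<sqinter> b) \<squnion> a, (y \<sqinter> b) \<squnion> a) \<in> \<theta>" using c \<theta>.csym \<theta>.ctrans by blast
        moreover have "((x \<sqinter> b) \<squnion> a, (y \<sqinter> b) \<squnion> a) \<in> \<psi>"
          using xy c' by (intro \<psi>.cjoin \<psi>.cmeet \<psi>.crefl)
        ultimately show ?thesis using * by auto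
      qed
      then show "(x, y) \<in> congruence_implication \<theta> \<chi>"
        using c by (simp add: congruence_implication_iff)
    qed
  }
qed

text \<open>Meeting with \<open>\<theta>\<close> has the implication as a right adjoint, hence
  preserves joins. No explicit description of a join of congruences is required.\<close>

lemma frame_congruence_frame: "frame A"
proof (intro frame.intro A.complete_lattice_axioms frame_axioms.intro)
  fix \<theta> F assume \<theta>: "\<theta> \<in> carrier A" and F: "F \<subseteq> carrier A"
  have m: "\<theta> \<sqinter>\<^bsub>A\<^esub> \<chi> = \<theta> \<inter> \<chi>" if "\<chi> \<in> carrier A" for \<chi>
    using that \<theta> by (simp add: congruence_meet congruence_frame_simps)
  have FA: "(\<lambda>\<chi>. \<theta> \<sqinter>\<^bsub>A\<^esub> \<chi>) ` F \<subseteq> carrier A" using F \<theta> by auto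
  show "\<theta> \<sqinter>\<^bsub>A\<^esub> \<Squnion>\<^bsub>A\<^esub>F = \<Squnion>\<^bsub>A\<^esub>((\<lambda>\<chi>. \<theta> \<sqinter>\<^bsub>A\<^esub> \<chi>) ` F)"
  proof (rule A.eq_by_upper_bounds)
    fix \<chi> assume \<chi>: "\<chi> \<in> carrier A"
    let ?i = "congruence_implication \<theta> \<chi>"
    have i: "?i \<in> carrier A"
      using \<theta> \<chi> congruence_congruence_implication by (simp add: congruence_frame_simps)
    have adj: "\<theta> \<sqinter>\<^bsub>A\<^esub> \<psi> \<sqsubseteq>\<^bsub>A\<^esub> \<chi> \<longleftrightarrow> \<psi> \<sqsubseteq>\<^bsub>A\<^esub> ?i" if "\<psi> \<in> carrier A" for \<psi>
      using that \<theta> \<chi> m[OF that] subset_congruence_implication by (simp add: congruence_frame_simps)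
    have "\<theta> \<sqinter>\<^bsub>A\<^esub> \<Squnion>\<^bsub>A\<^esub>F \<sqsubseteq>\<^bsub>A\<^esub> \<chi> \<longleftrightarrow> (\<forall>\<psi> \<in> F. \<psi> \<sqsubseteq>\<^bsub>A\<^esub> ?i)"
      using adj[of "\<Squnion>\<^bsub>A\<^esub>F"] F i by (simp add: A.Sup_le_iff)
    also have "\<dots> \<longleftrightarrow> \<Squnion>\<^bsub>A\<^esub>((\<lambda>\<psi>. \<theta> \<sqinter>\<^bsub>A\<^esub> \<psi>) ` F) \<sqsubseteq>\<^bsub>A\<^esub> \<chi>"
      unfolding A.Sup_le_iff[OF FA \<chi>] ball_simps(9) by (rule ball_cong) (use adj F in auto)
    finally show "\<theta> \<sqinter>\<^bsub>A\<^esub> \<Squnion>\<^bsub>A\<^esub>F \<sqsubseteq>\<^bsub>A\<^esub> \<chi> \<longleftrightarrow> \<Squnion>\<^bsub>A\<^esub>((\<lambda>\<chi>. \<theta> \<sqinter>\<^bsub>A\<^esub> \<chi>) ` F) \<sqsubseteq>\<^bsub>A\<^esub> \<chi>" .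
  qed (use \<theta> F FA in auto)
qed

end

section \<open>Open and closed congruences\<close>

context gorder_frame begin

sublocale A: frame A by (rule frame_congruence_frame)

text \<open>Covers \<open>x \<squnion> a\<close> and \<open>x \<sqinter> a\<close>, which in general
  are not frame maps on \<open>L\<close>: the former moves \<open>\<bottom>\<close>, the latter
  \<open>\<top>\<close>. It is enough that the value of \<open>t\<close> at a meet or join depends
  only on the values of \<open>t\<close> at the arguments.\<close>

lemma congruence_kernelI:
  assumes "\<And>x x' y y'. \<lbrakk>x \<in> carrier L; x' \<in> carrier L; y \<in> carrier L; y' \<in> carrier L; t x = t x'; t y = t y'\<rbrakk>
      \<Longrightarrow> t (x \<sqinter> y) = t (x' \<sqinter> y')"
    and "\<And>X Y. \<lbrakk>X \<subseteq> carrier L; Y \<subseteq> carrier L; t ` X = t ` Y\<rbrakk> \<Longrightarrow> t (\<Squnion>X) = t (\<Squnion>Y)"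
  shows "frame_congruence L {(x, y) \<in> carrier L \<times> carrier L. t x = t y}"
proof (rule congruenceI)
  fix S assume S: "S \<subseteq> {(x, y) \<in> carrier L \<times> carrier L. t x = t y}"
  then have c: "fst ` S \<subseteq> carrier L" "snd ` S \<subseteq> carrier L" by auto
  have "t ` fst ` S = t ` snd ` S"
    unfolding image_image by (rule image_cong) (use S in auto)
  then show "(\<Squnion>(fst ` S), \<Squnion>(snd ` S)) \<in> {(x, y) \<in> carrier L \<times> carrier L. t x = t y}"
    using assms(2)[OF c] c by auto
next
  fix x y u v
  assume "(x, y) \<in> {(x, y) \<in> carrier L \<times> carrier L. t x = t y}" "(u, v) \<in> {(x, y) \<in> carrier L \<times> carrier L. t x = t y}"
  then show "(x \<sqinter> u, y \<sqinter> v) \<in> {(x, y) \<in> carrier L \<times> carrier L. t x = t y}"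
    using assms(1)[of x y u v] by simp
qed auto

lemma congruence_closed:
  assumes a: "a \<in> carrier L"
  shows "frame_congruence L (\<nabla> a)"
  unfolding closed_congruence_def
proof (rule congruence_kernelI)
  show "(x \<sqinter> y) \<squnion> a = (x' \<sqinter> y') \<squnion> a"
    if "x \<in> carrier L" "x' \<in> carrier L" "y \<in> carrier L" "y' \<in> carrier L"
      "x \<squnion> a = x' \<squnion> a" "y \<squnion> a = y' \<squnion> a" for x x' y y'
    using that a by (simp add: join_meet_distrib)
  \<comment> \<open>As for truncation, \<open>a\<close> is inserted to cover the empty join.\<close>
  have *: "\<Squnion>X \<squnion> a = \<Squnion>(insert a ((\<lambda>x. x \<squnion> a) ` X))" if X: "X \<subseteq> carrier L" for X
  proof (rule eq_by_upper_bounds)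
    have tX: "insert a ((\<lambda>x. x \<squnion> a) ` X) \<subseteq> carrier L" using X a by auto
    then show "\<Squnion>X \<squnion> a \<in> carrier L" "\<Squnion>(insert a ((\<lambda>x. x \<squnion> a) ` X)) \<in> carrier L" using a X by auto
    fix n assume n: "n \<in> carrier L"
    have "x \<squnion> a \<sqsubseteq> n \<longleftrightarrow> x \<sqsubseteq> n \<and> a \<sqsubseteq> n" if "x \<in> X" for x
      using that X a n by (auto simp: join_le_iff)
    then show "\<Squnion>X \<squnion> a \<sqsubseteq> n \<longleftrightarrow> \<Squnion>(insert a ((\<lambda>x. x \<squnion> a) ` X)) \<sqsubseteq> n"
      using Sup_le_iff[OF tX n] X a n by (auto simp: join_le_iff Sup_le_iff)
  qed
  show "\<Squnion>X \<squnion> a = \<Squnion>Y \<squnion> a"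
    if "X \<subseteq> carrier L" "Y \<subseteq> carrier L" "(\<lambda>x. x \<squnion> a) ` X = (\<lambda>x. x \<squnion> a) ` Y" for X Y
    using *[of X] *[of Y] that by simp
qed

lemma congruence_open:
  assumes a: "a \<in> carrier L"
  shows "frame_congruence L (\<Delta> a)"
  unfolding open_congruence_def
proof (rule congruence_kernelI)
  have *: "(x \<sqinter> y) \<sqinter> a = (x \<sqinter> a) \<sqinter> (y \<sqinter> a)" if "x \<in> carrier L" "y \<in> carrier L" for x y
    using that a by (metis meet_assoc meet_closed meet_comm meet_lattice_simps(1))
  show "(x \<sqinter> y) \<sqinter> a = (x' \<sqinter> y') \<sqinter> a"
    if "x \<in> carrier L" "x' \<in> carrier L" "y \<in> carrier L" "y' \<in> carrier L"
      "x \<sqinter> a = x' \<sqinter> a" "y \<sqinter> a = y' \<sqinter> a" for x x' y y'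
    using that by (simp add: *)
  have "\<Squnion>X \<sqinter> a = \<Squnion>((\<lambda>x. x \<sqinter> a) ` X)" if "X \<subseteq> carrier L" for X
    using meet_Sup_distrib[OF a that] by (simp add: meet_comm)
  then show "\<Squnion>X \<sqinter> a = \<Squnion>Y \<sqinter> a"
    if "X \<subseteq> carrier L" "Y \<subseteq> carrier L" "(\<lambda>x. x \<sqinter> a) ` X = (\<lambda>x. x \<sqinter> a) ` Y" for X Y
    using that by simp
qed

text \<open>The congruence \<open>\<nabla> a \<inter> \<Delta> b\<close> is generated by the single
  pair \<open>(a \<sqinter> b, a)\<close>. If it relates \<open>u\<close> and \<open>v\<close>, then
  \<open>u = (u \<sqinter> v) \<squnion> (u \<sqinter> a)\<close> because
  \<open>u \<sqsubseteq> v \<squnion> a\<close>. Modulo the pair, \<open>u \<sqinter> a\<close>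
  becomes \<open>u \<sqinter> (a \<sqinter> b)\<close>, which is below \<open>v\<close> because
  \<open>u \<sqinter> b = v \<sqinter> b\<close>. So \<open>u\<close> is congruent to
  \<open>u \<sqinter> v\<close>, and by symmetry so is \<open>v\<close>.\<close>

lemma closed_Int_open_subset_iff:
  assumes a: "a \<in> carrier L" and b: "b \<in> carrier L" and \<theta>: "frame_congruence L \<theta>"
  shows "\<nabla> a \<inter> \<Delta> b \<subseteq> \<theta> \<longleftrightarrow> (a \<sqinter> b, a) \<in> \<theta>"
proof
  assume "\<nabla> a \<inter> \<Delta> b \<subseteq> \<theta>"
  moreover have "(a \<sqinter> b) \<squnion> a = a \<squnion> a" "(a \<sqinter> b) \<sqinter> b = a \<sqinter> b"
    using a b by (simp_all add: absorb_simps join_comm[of L "a \<sqinter> b"] meet_assoc meet_lattice_simps)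
  then have "(a \<sqinter> b, a) \<in> \<nabla> a \<inter> \<Delta> b"
    using a b by (simp add: closed_congruence_def open_congruence_def)
  ultimately show "(a \<sqinter> b, a) \<in> \<theta>" by blast
next
  interpret \<theta>: framecong L \<theta> using \<theta> by (rule framecongI)
  assume *: "(a \<sqinter> b, a) \<in> \<theta>"
  have one: "(u, u \<sqinter> v) \<in> \<theta>"
    if uv: "u \<in> carrier L" "v \<in> carrier L" "u \<squnion> a = v \<squnion> a" "u \<sqinter> b = v \<sqinter> b" for u v
  proof -
    have "u = u \<sqinter> (v \<squnion> a)" using uv a absorb_simps(1)[of u a] by simp
    also have "\<dots> = (u \<sqinter> v) \<squnion> (u \<sqinter> a)" using uv a by (simp add: meet_join_distrib)
    finally have "u = (u \<sqinter> v) \<squnion> (u \<sqinter> a)" .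
    moreover have "((u \<sqinter> v) \<squnion> (u \<sqinter> a), (u \<sqinter> v) \<squnion> (u \<sqinter> (a \<sqinter> b))) \<in> \<theta>"
      using uv by (intro \<theta>.cjoin \<theta>.cmeet \<theta>.crefl \<theta>.csym[OF *]) auto
    moreover have "u \<sqinter> (a \<sqinter> b) \<sqsubseteq> u \<sqinter> v"
    proof -
      have "u \<sqinter> (a \<sqinter> b) = (v \<sqinter> b) \<sqinter> a"
        using uv a b by (metis meet_assoc meet_comm)
      moreover have "(v \<sqinter> b) \<sqinter> a \<sqsubseteq> v"
        using uv a b by (intro le_trans[OF meet_left meet_left]) auto
      ultimately have "u \<sqinter> (a \<sqinter> b) \<sqsubseteq> v" by simp
      then show ?thesis using uv a b by (intro meet_le meet_left) auto
    qed
    then have "(u \<sqinter> v) \<squnion> (u \<sqinter> (a \<sqinter> b)) = u \<sqinter> v"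
      using uv a b by (intro le_antisym) (auto simp: join_le_iff join_left)
    ultimately show ?thesis by simp
  qed
  show "\<nabla> a \<inter> \<Delta> b \<subseteq> \<theta>"
  proof clarify
    fix u v assume "(u, v) \<in> \<nabla> a" "(u, v) \<in> \<Delta> b"
    then have "(u, u \<sqinter> v) \<in> \<theta>" "(v, v \<sqinter> u) \<in> \<theta>"
      by (auto simp: closed_congruence_def open_congruence_def intro: one)
    then show "(u, v) \<in> \<theta>" by (metis \<theta>.csym \<theta>.ctrans meet_comm)
  qed
qed

lemma closed_top: "\<nabla> \<top> = carrier L \<times> carrier L"
  by (auto simp: closed_congruence_def meet_lattice_simps)

lemma open_bottom: "\<Delta> \<bottom> = carrier L \<times> carrier L"
  by (auto simp: open_congruence_def meet_lattice_simps)

lemma closed_carrier: "\<nabla> a \<subseteq> carrier L \<times> carrier L"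
  by (auto simp: closed_congruence_def)

lemma open_carrier: "\<Delta> a \<subseteq> carrier L \<times> carrier L"
  by (auto simp: open_congruence_def)

lemma closed_subset_iff:
  assumes "a \<in> carrier L" "frame_congruence L \<theta>"
  shows "\<nabla> a \<subseteq> \<theta> \<longleftrightarrow> (\<bottom>, a) \<in> \<theta>"
proof -
  have "\<nabla> a \<inter> \<Delta> \<bottom> = \<nabla> a" using closed_carrier by (auto simp: open_bottom)
  then show ?thesis
    using closed_Int_open_subset_iff[of a \<bottom> \<theta>] assms by (simp add: meet_lattice_simps)
qed

lemma open_subset_iff:
  assumes "a \<in> carrier L" "frame_congruence L \<theta>"
  shows "\<Delta> a \<subseteq> \<theta> \<longleftrightarrow> (a, \<top>) \<in> \<theta>"
proof -
  have "\<nabla> \<top> \<inter> \<Delta> a = \<Delta> a" using open_carrier by (auto simp: closed_top)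
  then show ?thesis
    using closed_Int_open_subset_iff[of \<top> a \<theta>] assms by (simp add: meet_lattice_simps)
qed

lemma closed_in_A: "a \<in> carrier L \<Longrightarrow> \<nabla> a \<in> carrier A"
  and open_in_A: "a \<in> carrier L \<Longrightarrow> \<Delta> a \<in> carrier A"
  by (simp_all add: congruence_frame_simps congruence_closed congruence_open)

lemma meet_A: "\<lbrakk>\<theta> \<in> carrier A; \<chi> \<in> carrier A\<rbrakk> \<Longrightarrow> \<theta> \<sqinter>\<^bsub>A\<^esub> \<chi> = \<theta> \<inter> \<chi>"
  by (simp add: congruence_frame_simps congruence_meet)

lemma closed_meet: "\<lbrakk>a \<in> carrier L; b \<in> carrier L\<rbrakk> \<Longrightarrow> \<nabla> (a \<sqinter> b) = \<nabla> a \<sqinter>\<^bsub>A\<^esub> \<nabla> b"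
proof -
  assume ab: "a \<in> carrier L" "b \<in> carrier L"
  have "x \<squnion> (a \<sqinter> b) = y \<squnion> (a \<sqinter> b) \<longleftrightarrow> x \<squnion> a = y \<squnion> a \<and> x \<squnion> b = y \<squnion> b"
    if "x \<in> carrier L" "y \<in> carrier L" for x y
  proof
    have *: "z \<squnion> a = (z \<squnion> (a \<sqinter> b)) \<squnion> a" "z \<squnion> b = (z \<squnion> (a \<sqinter> b)) \<squnion> b" if "z \<in> carrier L" for z
      using that ab by (simp_all add: join_assoc absorb_simps join_comm[of L "a \<sqinter> b"])
    show "x \<squnion> a = y \<squnion> a \<and> x \<squnion> b = y \<squnion> b" if "x \<squnion> (a \<sqinter> b) = y \<squnion> (a \<sqinter> b)"
      using *[of x] *[of y] that \<open>x \<in> carrier L\<close> \<open>y \<in> carrier L\<close> by simp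
  qed (use that ab in \<open>simp add: join_meet_distrib\<close>)
  then show ?thesis using ab unfolding meet_A[OF closed_in_A closed_in_A, OF ab]
    by (auto simp: closed_congruence_def)
qed

lemma open_join: "\<lbrakk>a \<in> carrier L; b \<in> carrier L\<rbrakk> \<Longrightarrow> \<Delta> (a \<squnion> b) = \<Delta> a \<sqinter>\<^bsub>A\<^esub> \<Delta> b"
proof -
  assume ab: "a \<in> carrier L" "b \<in> carrier L"
  have "x \<sqinter> (a \<squnion> b) = y \<sqinter> (a \<squnion> b) \<longleftrightarrow> x \<sqinter> a = y \<sqinter> a \<and> x \<sqinter> b = y \<sqinter> b"
    if "x \<in> carrier L" "y \<in> carrier L" for x y
  proof
    have *: "z \<sqinter> a = (z \<sqinter> (a \<squnion> b)) \<sqinter> a" "z \<sqinter> b = (z \<sqinter> (a \<squnion> b)) \<sqinter> b" if "z \<in> carrier L" for z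
      using that ab by (simp_all add: meet_assoc absorb_simps meet_comm[of L "a \<squnion> b"])
    show "x \<sqinter> a = y \<sqinter> a \<and> x \<sqinter> b = y \<sqinter> b" if "x \<sqinter> (a \<squnion> b) = y \<sqinter> (a \<squnion> b)"
      using *[of x] *[of y] that \<open>x \<in> carrier L\<close> \<open>y \<in> carrier L\<close> by simp
  qed (use that ab in \<open>simp add: meet_join_distrib\<close>)
  then show ?thesis using ab unfolding meet_A[OF open_in_A open_in_A, OF ab]
    by (auto simp: open_congruence_def)
qed

text \<open>A congruence contains \<open>\<nabla> x\<close> iff it relates \<open>x\<close> to
  \<open>\<bottom>\<close>, and the elements related to \<open>\<bottom>\<close> form a down-set
  closed under all joins.\<close>

lemma closed_Sup:
  assumes X: "X \<subseteq> carrier L"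
  shows "\<nabla> (\<Squnion>X) = \<Squnion>\<^bsub>A\<^esub>(\<nabla> ` X)"
proof (rule A.eq_by_upper_bounds)
  have c: "\<nabla> ` X \<subseteq> carrier A" using X closed_in_A by auto
  then show "\<nabla> (\<Squnion>X) \<in> carrier A" "\<Squnion>\<^bsub>A\<^esub>(\<nabla> ` X) \<in> carrier A"
    using X by (simp_all add: closed_in_A)
  fix \<theta> assume \<theta>: "\<theta> \<in> carrier A"
  then have cong: "frame_congruence L \<theta>" by (simp add: congruence_frame_simps)
  interpret \<theta>: framecong L \<theta> using cong by (rule framecongI)
  have "(\<bottom>, \<Squnion>X) \<in> \<theta> \<longleftrightarrow> (\<forall>x \<in> X. (\<bottom>, x) \<in> \<theta>)"
  proof
    assume *: "(\<bottom>, \<Squnion>X) \<in> \<theta>"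
    have "(\<bottom>, x) \<in> \<theta>" if "x \<in> X" for x
    proof -
      have x: "x \<in> carrier L" "x \<sqsubseteq> \<Squnion>X" using that X by (auto intro: sup_upper)
      then have "(x \<sqinter> \<bottom>, x \<sqinter> \<Squnion>X) \<in> \<theta>" using * by (intro \<theta>.cmeet \<theta>.crefl)
      then show ?thesis using x X le_iff_meet_eq[of x "\<Squnion>X"] by (simp add: meet_lattice_simps)
    qed
    then show "\<forall>x \<in> X. (\<bottom>, x) \<in> \<theta>" by blast
  next
    assume *: "\<forall>x \<in> X. (\<bottom>, x) \<in> \<theta>"
    \<comment> \<open>The extra pair makes the first projection \<open>{\<bottom>}\<close> for empty
      \<open>X\<close> too.\<close>
    let ?S = "insert (\<bottom>, \<bottom>) ((\<lambda>x. (\<bottom>, x)) ` X)"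
    have "(\<Squnion>(fst ` ?S), \<Squnion>(snd ` ?S)) \<in> \<theta>" by (rule \<theta>.csup) (use * \<theta>.crefl in auto)
    moreover have "fst ` ?S = {\<bottom>}" "snd ` ?S = insert \<bottom> X" by (auto simp: image_image)
    ultimately have "(\<Squnion>{\<bottom>}, \<Squnion>(insert \<bottom> X)) \<in> \<theta>" by (simp only:)
    then show "(\<bottom>, \<Squnion>X) \<in> \<theta>"
      using X by (simp add: Sup_insert_eq Sup_empty_eq meet_lattice_simps)
  qed
  moreover have "\<nabla> x \<subseteq> \<theta> \<longleftrightarrow> (\<bottom>, x) \<in> \<theta>" if "x \<in> X" for x
    using that X cong by (intro closed_subset_iff) auto
  ultimately show "\<nabla> (\<Squnion>X) \<sqsubseteq>\<^bsub>A\<^esub> \<theta> \<longleftrightarrow> \<Squnion>\<^bsub>A\<^esub>(\<nabla> ` X) \<sqsubseteq>\<^bsub>A\<^esub> \<theta>"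
    using X cong A.Sup_le_iff[OF c \<theta>] by (simp add: congruence_frame_simps closed_subset_iff)
qed

text \<open>Dual to \<open>closed_Sup\<close>, but only for two elements: those related to
  \<open>\<top>\<close> form a filter, closed under finite meets.\<close>

lemma open_meet:
  assumes ab: "a \<in> carrier L" "b \<in> carrier L"
  shows "\<Delta> (a \<sqinter> b) = \<Delta> a \<squnion>\<^bsub>A\<^esub> \<Delta> b"
proof (rule A.eq_by_upper_bounds)
  show "\<Delta> (a \<sqinter> b) \<in> carrier A" "\<Delta> a \<squnion>\<^bsub>A\<^esub> \<Delta> b \<in> carrier A" using ab by (simp_all add: open_in_A)
  fix \<theta> assume \<theta>: "\<theta> \<in> carrier A"
  then have cong: "frame_congruence L \<theta>" by (simp add: congruence_frame_simps)
  interpret \<theta>: framecong L \<theta> using cong by (rule framecongI)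
  have "(a \<sqinter> b, \<top>) \<in> \<theta> \<longleftrightarrow> (a, \<top>) \<in> \<theta> \<and> (b, \<top>) \<in> \<theta>"
  proof
    assume "(a, \<top>) \<in> \<theta> \<and> (b, \<top>) \<in> \<theta>"
    then show "(a \<sqinter> b, \<top>) \<in> \<theta>" using \<theta>.cmeet[of a \<top> b \<top>] by (simp add: meet_lattice_simps)
  next
    assume "(a \<sqinter> b, \<top>) \<in> \<theta>"
    then have "(x \<squnion> (a \<sqinter> b), x \<squnion> \<top>) \<in> \<theta>" if "x \<in> carrier L" for x
      using that by (intro \<theta>.cjoin \<theta>.crefl)
    from this[OF ab(1)] this[OF ab(2)] show "(a, \<top>) \<in> \<theta> \<and> (b, \<top>) \<in> \<theta>"
      using ab by (simp add: meet_lattice_simps absorb_simps)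
  qed
  then show "\<Delta> (a \<sqinter> b) \<sqsubseteq>\<^bsub>A\<^esub> \<theta> \<longleftrightarrow> \<Delta> a \<squnion>\<^bsub>A\<^esub> \<Delta> b \<sqsubseteq>\<^bsub>A\<^esub> \<theta>"
    using ab cong A.join_le_iff[OF open_in_A open_in_A \<theta>]
    by (simp add: congruence_frame_simps open_subset_iff)
qed

text \<open>The meet is generated by the trivial pair \<open>(a \<sqinter> a, a)\<close>, so it lies
  in every congruence. The join contains \<open>(\<bottom>, a)\<close> and
  \<open>(a, \<top>)\<close>, hence \<open>(\<bottom>, \<top>)\<close>, and so relates
  everything.\<close>

lemma closed_open_complements:
  assumes a: "a \<in> carrier L"
  shows "A.complements (\<nabla> a) (\<Delta> a)"
  unfolding A.complements_def
proof (intro conjI)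
  show "\<nabla> a \<in> carrier A" "\<Delta> a \<in> carrier A" using a by (simp_all add: closed_in_A open_in_A)
  then have m: "\<nabla> a \<sqinter>\<^bsub>A\<^esub> \<Delta> a = \<nabla> a \<inter> \<Delta> a" and j: "\<nabla> a \<squnion>\<^bsub>A\<^esub> \<Delta> a \<in> carrier A"
    and l: "\<nabla> a \<sqsubseteq>\<^bsub>A\<^esub> \<nabla> a \<squnion>\<^bsub>A\<^esub> \<Delta> a" "\<Delta> a \<sqsubseteq>\<^bsub>A\<^esub> \<nabla> a \<squnion>\<^bsub>A\<^esub> \<Delta> a"
    by (simp_all add: meet_A A.join_left A.join_right)
  have b: "frame_congruence L \<bottom>\<^bsub>A\<^esub>"
    using A.bottom_closed unfolding congruence_frame_simps by blast
  have "(a, a) \<in> \<bottom>\<^bsub>A\<^esub>" by (rule framecong.crefl[OF framecongI[OF b] a])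
  then have "\<nabla> a \<inter> \<Delta> a \<subseteq> \<bottom>\<^bsub>A\<^esub>"
    using closed_Int_open_subset_iff[OF a a b] a by (simp add: meet_lattice_simps)
  then show "\<nabla> a \<sqinter>\<^bsub>A\<^esub> \<Delta> a = \<bottom>\<^bsub>A\<^esub>"
    using \<open>\<nabla> a \<in> carrier A\<close> \<open>\<Delta> a \<in> carrier A\<close> A.bottom_lower[OF A.meet_closed, of "\<nabla> a" "\<Delta> a"]
    by (simp add: m congruence_frame_simps(2) subset_antisym)
  have cong: "frame_congruence L (\<nabla> a \<squnion>\<^bsub>A\<^esub> \<Delta> a)" using j by (simp add: congruence_frame_simps)
  interpret \<theta>: framecong L "\<nabla> a \<squnion>\<^bsub>A\<^esub> \<Delta> a" using cong by (rule framecongI)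
  have "(\<bottom>, \<top>) \<in> \<nabla> a \<squnion>\<^bsub>A\<^esub> \<Delta> a"
    using l a cong closed_subset_iff open_subset_iff \<theta>.ctrans by (simp add: congruence_frame_simps)
  then have "\<Delta> \<bottom> \<subseteq> \<nabla> a \<squnion>\<^bsub>A\<^esub> \<Delta> a" using open_subset_iff[OF _ cong] by simp
  then show "\<nabla> a \<squnion>\<^bsub>A\<^esub> \<Delta> a = \<top>\<^bsub>A\<^esub>"
    using \<theta>.carr unfolding congruence_top open_bottom by auto
qed

end

section \<open>Subframes\<close>

context gorder_frame begin

lemma subframeD:
  assumes "subframe L T"
  shows "T \<subseteq> carrier L" "\<top> \<in> T" "\<And>x y. \<lbrakk>x \<in> T; y \<in> T\<rbrakk> \<Longrightarrow> x \<sqinter> y \<in> T" "\<And>S. S \<subseteq> T \<Longrightarrow> \<Squnion>S \<in> T"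
  using assms by (auto simp: subframe_def)

lemma subframe_complete_lattice:
  assumes T: "subframe L T"
  shows "complete_lattice (L\<lparr>carrier := T\<rparr>)"
    and "\<And>S. S \<subseteq> T \<Longrightarrow> \<Squnion>\<^bsub>L\<lparr>carrier := T\<rparr>\<^esub>S = \<Squnion>S"
proof -
  note D = subframeD[OF T]
  have l: "least (L\<lparr>carrier := T\<rparr>) (\<Squnion>S) (Upper (L\<lparr>carrier := T\<rparr>) S)" if S: "S \<subseteq> T" for S
  proof (rule least_UpperI)
    have Sc: "S \<subseteq> carrier L" using S D(1) by blast
    show "x \<sqsubseteq>\<^bsub>L\<lparr>carrier := T\<rparr>\<^esub> \<Squnion>S" if "x \<in> S" for x using sup_upper[OF Sc that] by simp
    show "\<Squnion>S \<sqsubseteq>\<^bsub>L\<lparr>carrier := T\<rparr>\<^esub> y" if "y \<in> Upper (L\<lparr>carrier := T\<rparr>) S" for y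
    proof -
      have "y \<in> carrier L" "\<forall>x \<in> S. x \<sqsubseteq> y" using that S D(1) by (auto simp: Upper_def)
      then show ?thesis using Sup_le_iff[OF Sc] by simp
    qed
  qed (use S D(4) in auto)
  have po: "partial_order (L\<lparr>carrier := T\<rparr>)"
  proof (rule partial_orderI_eq)
    show "x \<sqsubseteq>\<^bsub>L\<lparr>carrier := T\<rparr>\<^esub> z"
      if "x \<sqsubseteq>\<^bsub>L\<lparr>carrier := T\<rparr>\<^esub> y" "y \<sqsubseteq>\<^bsub>L\<lparr>carrier := T\<rparr>\<^esub> z" "x \<in> carrier (L\<lparr>carrier := T\<rparr>)"
        "y \<in> carrier (L\<lparr>carrier := T\<rparr>)" "z \<in> carrier (L\<lparr>carrier := T\<rparr>)" for x y z
      using that D(1) le_trans[of x y z] by auto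
    show "x = y"
      if "x \<sqsubseteq>\<^bsub>L\<lparr>carrier := T\<rparr>\<^esub> y" "y \<sqsubseteq>\<^bsub>L\<lparr>carrier := T\<rparr>\<^esub> x" "x \<in> carrier (L\<lparr>carrier := T\<rparr>)"
        "y \<in> carrier (L\<lparr>carrier := T\<rparr>)" for x y
      using that D(1) le_antisym[of x y] by auto
  qed (use D(1) eq_is_equal in auto)
  show cl: "complete_lattice (L\<lparr>carrier := T\<rparr>)"
    by (rule complete_latticeI_sup[OF po]) (use l in auto)
  show "\<Squnion>\<^bsub>L\<lparr>carrier := T\<rparr>\<^esub>S = \<Squnion>S" if "S \<subseteq> T" for S
    using complete_lattice.Sup_eqI[OF cl l[OF that]] that by simp
qed

lemma subframe_meet:
  assumes T: "subframe L T" and xy: "x \<in> T" "y \<in> T"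
  shows "x \<sqinter>\<^bsub>L\<lparr>carrier := T\<rparr>\<^esub> y = x \<sqinter> y"
proof (rule complete_lattice.meet_eqI[OF subframe_complete_lattice(1)[OF T] greatest_Lower_pairI])
  note D = subframeD[OF T]
  have c: "x \<in> carrier L" "y \<in> carrier L" using xy D(1) by auto
  show "x \<sqinter> y \<sqsubseteq>\<^bsub>L\<lparr>carrier := T\<rparr>\<^esub> x" "x \<sqinter> y \<sqsubseteq>\<^bsub>L\<lparr>carrier := T\<rparr>\<^esub> y"
    using c by (simp_all add: meet_left meet_right)
  show "z \<sqsubseteq>\<^bsub>L\<lparr>carrier := T\<rparr>\<^esub> x \<sqinter> y"
    if "z \<in> carrier (L\<lparr>carrier := T\<rparr>)" "z \<sqsubseteq>\<^bsub>L\<lparr>carrier := T\<rparr>\<^esub> x" "z \<sqsubseteq>\<^bsub>L\<lparr>carrier := T\<rparr>\<^esub> y" for z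
    using that D(1) c by (auto simp: le_meet_iff subset_iff)
qed (use subframeD[OF T] xy in auto)

lemma subframe_top:
  assumes T: "subframe L T"
  shows "\<top>\<^bsub>L\<lparr>carrier := T\<rparr>\<^esub> = \<top>"
  by (rule complete_lattice.top_eqI[OF subframe_complete_lattice(1)[OF T]])
    (use subframeD[OF T] in \<open>auto simp: subset_iff intro: top_higher\<close>)

lemma subframe_frame:
  assumes T: "subframe L T"
  shows "frame (L\<lparr>carrier := T\<rparr>)"
proof (intro frame.intro subframe_complete_lattice(1)[OF T] frame_axioms.intro)
  note D = subframeD[OF T]
  fix a S assume aS: "a \<in> carrier (L\<lparr>carrier := T\<rparr>)" "S \<subseteq> carrier (L\<lparr>carrier := T\<rparr>)"
  then have *: "a \<in> T" "S \<subseteq> T" by auto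
  have "(\<lambda>x. a \<sqinter>\<^bsub>L\<lparr>carrier := T\<rparr>\<^esub> x) ` S = (\<lambda>x. a \<sqinter> x) ` S"
    by (rule image_cong) (use * subframe_meet[OF T] in auto)
  moreover have "(\<lambda>x. a \<sqinter> x) ` S \<subseteq> T" using * D(3) by auto
  moreover have "a \<sqinter> \<Squnion>S = \<Squnion>((\<lambda>x. a \<sqinter> x) ` S)" by (rule meet_Sup_distrib) (use * D(1) in auto)
  ultimately show "a \<sqinter>\<^bsub>L\<lparr>carrier := T\<rparr>\<^esub> \<Squnion>\<^bsub>L\<lparr>carrier := T\<rparr>\<^esub>S
      = \<Squnion>\<^bsub>L\<lparr>carrier := T\<rparr>\<^esub>((\<lambda>x. a \<sqinter>\<^bsub>L\<lparr>carrier := T\<rparr>\<^esub> x) ` S)"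
    using * D(4)[OF *(2)] by (simp add: subframe_complete_lattice(2)[OF T] subframe_meet[OF T])
qed

lemma subframe_inclusion:
  assumes T: "subframe L T" "subframe L T'" "T \<subseteq> T'"
  shows "frame_map (L\<lparr>carrier := T\<rparr>) (L\<lparr>carrier := T'\<rparr>) (\<lambda>x. x)"
proof (rule frame_mapI[OF subframe_frame[OF T(1)] subframe_frame[OF T(2)]])
  show "\<Squnion>\<^bsub>L\<lparr>carrier := T\<rparr>\<^esub>S = \<Squnion>\<^bsub>L\<lparr>carrier := T'\<rparr>\<^esub>((\<lambda>x. x) ` S)"
    if "S \<subseteq> carrier (L\<lparr>carrier := T\<rparr>)" for S
    using that T(3) by (simp add: subframe_complete_lattice(2) T(1,2) subset_trans)
  show "x \<sqinter>\<^bsub>L\<lparr>carrier := T\<rparr>\<^esub> y = x \<sqinter>\<^bsub>L\<lparr>carrier := T'\<rparr>\<^esub> y"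
    if "x \<in> carrier (L\<lparr>carrier := T\<rparr>)" "y \<in> carrier (L\<lparr>carrier := T\<rparr>)" for x y
    using that T(3) by (simp add: subframe_meet T(1,2) subset_iff)
qed (use T in \<open>auto simp: subframe_top\<close>)

lemma subframe_complements:
  assumes T: "subframe L T" and ab: "complements a b" "a \<in> T" "b \<in> T"
  shows "frame.complements (L\<lparr>carrier := T\<rparr>) a b"
proof -
  interpret T: frame "L\<lparr>carrier := T\<rparr>" using T by (rule subframe_frame)
  have "\<bottom>\<^bsub>L\<lparr>carrier := T\<rparr>\<^esub> = \<bottom>"
    using subframe_complete_lattice(2)[OF T, of "{}"] by (simp add: T.Sup_empty_eq Sup_empty_eq)
  moreover have "a \<squnion>\<^bsub>L\<lparr>carrier := T\<rparr>\<^esub> b = a \<squnion> b"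
    using subframe_complete_lattice(2)[OF T, of "{a, b}"] ab by (simp add: join_def)
  ultimately show ?thesis
    using complementsD[OF ab(1)] ab by (simp add: T.complements_def subframe_meet[OF T] subframe_top[OF T])
qed

lemma generated_subframe_least:
  assumes "subframe L T" "G \<subseteq> T"
  shows "carrier (generated_subframe L G) \<subseteq> T"
  using assms by (auto simp: generated_subframe_def)

lemma generators_subset: "G \<subseteq> carrier (generated_subframe L G)"
  by (auto simp: generated_subframe_def)

lemma generated_subframe_eq: "generated_subframe L G = L\<lparr>carrier := carrier (generated_subframe L G)\<rparr>"
  by (simp add: generated_subframe_def)

lemma subframe_generated:
  assumes "G \<subseteq> carrier L"
  shows "subframe L (carrier (generated_subframe L G))"
proof -
  have "subframe L (carrier L)" by (auto simp: subframe_def)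
  then have "carrier (generated_subframe L G) \<subseteq> carrier L" using assms by (rule generated_subframe_least)
  moreover have "\<Squnion>S \<in> T" if "subframe L T" "S \<subseteq> T" for S T using subframeD(4) that by blast
  ultimately show ?thesis unfolding subframe_def
    by (auto simp: generated_subframe_def subframeD(2,3)) (blast intro: subframeD(4))
qed

text \<open>The equaliser of two frame maps is a subframe; once it contains \<open>G\<close>, it
  contains all that \<open>G\<close> generates.\<close>

lemma frame_maps_agree_on_generated:
  assumes G: "G \<subseteq> carrier L"
    and f: "frame_map (generated_subframe L G) N f" and g: "frame_map (generated_subframe L G) N g"
    and eq: "\<And>x. x \<in> G \<Longrightarrow> f x = g x" and x: "x \<in> carrier (generated_subframe L G)"
  shows "f x = g x"
proof -
  define T where "T = carrier (generated_subframe L G)"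
  have T: "subframe L T" unfolding T_def using G by (rule subframe_generated)
  have gen: "generated_subframe L G = L\<lparr>carrier := T\<rparr>" unfolding T_def by (rule generated_subframe_eq)
  note D = subframeD[OF T]
  note F = frame_mapD[OF f[unfolded gen]] and F' = frame_mapD[OF g[unfolded gen]]
  have "subframe L {x \<in> T. f x = g x}"
    unfolding subframe_def
  proof (intro conjI ballI allI impI)
    show "\<top> \<in> {x \<in> T. f x = g x}" using D(2) F(6) F'(6) by (simp add: subframe_top[OF T])
    show "x \<sqinter> y \<in> {x \<in> T. f x = g x}" if "x \<in> {x \<in> T. f x = g x}" "y \<in> {x \<in> T. f x = g x}" for x y
      using that F(5)[of x y] F'(5)[of x y] D(3) by (simp add: subframe_meet[OF T])
    fix S assume S: "S \<subseteq> {x \<in> T. f x = g x}"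
    then have "S \<subseteq> T" "f ` S = g ` S" by (auto intro!: image_cong)
    then show "\<Squnion>S \<in> {x \<in> T. f x = g x}"
      using F(4)[of S] F'(4)[of S] D(4) by (simp add: subframe_complete_lattice(2)[OF T])
  qed (use D in auto)
  moreover have "G \<subseteq> {x \<in> T. f x = g x}" using eq generators_subset unfolding T_def by blast
  ultimately show ?thesis using generated_subframe_least x by blast
qed

lemma subframe_joins:
  assumes D: "D \<subseteq> carrier L" "\<top> \<in> D" "\<And>x y. \<lbrakk>x \<in> D; y \<in> D\<rbrakk> \<Longrightarrow> x \<sqinter> y \<in> D"
  shows "subframe L {\<Squnion>S | S. S \<subseteq> D}"
  unfolding subframe_def
proof (intro conjI ballI allI impI)
  show "{\<Squnion>S | S. S \<subseteq> D} \<subseteq> carrier L" using D(1) by auto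
  have "\<top> = \<Squnion>{\<top>}" by simp
  then show "\<top> \<in> {\<Squnion>S | S. S \<subseteq> D}" using D(2) by blast
next
  fix x y assume "x \<in> {\<Squnion>S | S. S \<subseteq> D}" "y \<in> {\<Squnion>S | S. S \<subseteq> D}"
  then obtain S S' where S: "S \<subseteq> D" "S' \<subseteq> D" "x = \<Squnion>S" "y = \<Squnion>S'" by auto
  then have "x \<sqinter> y = \<Squnion>{x \<sqinter> y | x y. x \<in> S \<and> y \<in> S'}" using D(1) by (simp add: Sup_meet_Sup)
  moreover have "{x \<sqinter> y | x y. x \<in> S \<and> y \<in> S'} \<subseteq> D" using S D(3) by blast
  ultimately show "x \<sqinter> y \<in> {\<Squnion>S | S. S \<subseteq> D}" by blast
next
  fix F assume F: "F \<subseteq> {\<Squnion>S | S. S \<subseteq> D}"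
  then have Fc: "F \<subseteq> carrier L" using D(1) by auto
  \<comment> \<open>All basic elements below some member of \<open>F\<close>, which avoids choosing
    a decomposition for each member.\<close>
  let ?S = "{d \<in> D. \<exists>x \<in> F. d \<sqsubseteq> x}"
  have Sc: "?S \<subseteq> carrier L" using D(1) by auto
  have "\<Squnion>F = \<Squnion>?S"
  proof (rule le_antisym)
    have "x \<sqsubseteq> \<Squnion>?S" if x: "x \<in> F" for x
    proof -
      obtain S where S: "S \<subseteq> D" "x = \<Squnion>S" using x F by auto
      have Sc': "S \<subseteq> carrier L" using S D(1) by auto
      have "S \<subseteq> ?S" using S x sup_upper[OF Sc'] by blast
      then have "\<forall>d \<in> S. d \<sqsubseteq> \<Squnion>?S" using sup_upper[OF Sc] by blast
      then show ?thesis unfolding S(2) using Sup_le_iff[OF Sc'] Sc by simp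
    qed
    then show "\<Squnion>F \<sqsubseteq> \<Squnion>?S" using Sup_le_iff[OF Fc] Sc by simp
    have "d \<sqsubseteq> \<Squnion>F" if "d \<in> D" "x \<in> F" "d \<sqsubseteq> x" for d x
      using that le_trans[OF that(3) sup_upper[OF Fc that(2)]] subsetD[OF D(1) that(1)] subsetD[OF Fc that(2)] Fc by simp
    then show "\<Squnion>?S \<sqsubseteq> \<Squnion>F" using Sup_le_iff[OF Sc] Fc by auto
  qed (use Fc Sc in auto)
  then show "\<Squnion>F \<in> {\<Squnion>S | S. S \<subseteq> D}" by blast
qed

end

section \<open>Extending a frame map to closed and open congruences\<close>

text \<open>Applied below to \<open>\<nabla> n\<close>, it provides the right adjoint from which the
  extension is built.\<close>

lemma (in gorder_frame) congruence_preimage: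
  assumes f: "frame_map L N f" and \<theta>: "frame_congruence N \<theta>"
  shows "frame_congruence L {(x, y) \<in> carrier L \<times> carrier L. (f x, f y) \<in> \<theta>}"
proof (rule congruenceI)
  note D = frame_mapD[OF f]
  interpret N: frame N by (rule D(2))
  interpret \<theta>: framecong N \<theta> by unfold_locales (rule \<theta>)
  show "(x, x) \<in> {(x, y) \<in> carrier L \<times> carrier L. (f x, f y) \<in> \<theta>}" if "x \<in> carrier L" for x
    using that D(3) \<theta>.crefl by auto
  fix x y assume xy: "(x, y) \<in> {(x, y) \<in> carrier L \<times> carrier L. (f x, f y) \<in> \<theta>}"
  then show "(y, x) \<in> {(x, y) \<in> carrier L \<times> carrier L. (f x, f y) \<in> \<theta>}" using \<theta>.csym by auto
  show "(x, z) \<in> {(x, y) \<in> carrier L \<times> carrier L. (f x, f y) \<in> \<theta>}"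
    if "(y, z) \<in> {(x, y) \<in> carrier L \<times> carrier L. (f x, f y) \<in> \<theta>}" for z
    using xy that \<theta>.ctrans[of "f x" "f y" "f z"] by auto
  show "(x \<sqinter> u, y \<sqinter> v) \<in> {(x, y) \<in> carrier L \<times> carrier L. (f x, f y) \<in> \<theta>}"
    if "(u, v) \<in> {(x, y) \<in> carrier L \<times> carrier L. (f x, f y) \<in> \<theta>}" for u v
    using xy that \<theta>.cmeet[of "f x" "f y" "f u" "f v"] D(5) by auto
next
  note D = frame_mapD[OF f]
  interpret N: frame N by (rule D(2))
  interpret \<theta>: framecong N \<theta> by unfold_locales (rule \<theta>)
  fix S assume S: "S \<subseteq> {(x, y) \<in> carrier L \<times> carrier L. (f x, f y) \<in> \<theta>}"
  then have c: "fst ` S \<subseteq> carrier L" "snd ` S \<subseteq> carrier L" by auto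
  let ?S = "(\<lambda>(x, y). (f x, f y)) ` S"
  have "(\<Squnion>\<^bsub>N\<^esub>(fst ` ?S), \<Squnion>\<^bsub>N\<^esub>(snd ` ?S)) \<in> \<theta>" by (rule \<theta>.csup) (use S in auto)
  moreover have "fst ` ?S = f ` fst ` S" "snd ` ?S = f ` snd ` S"
    by (auto simp: image_image case_prod_beta)
  ultimately show "(\<Squnion>(fst ` S), \<Squnion>(snd ` S)) \<in> {(x, y) \<in> carrier L \<times> carrier L. (f x, f y) \<in> \<theta>}"
    using c D(4) by simp
qed auto

text \<open>The conditions on \<open>F\<close> are those that make the congruences
  \<open>\<nabla> x \<sqinter> \<Delta> s\<close> closed under finite meets, since
  \<open>\<Delta> \<bottom>\<close> is the top congruence and
  \<open>\<Delta> (s \<squnion> t)\<close> is the meet of \<open>\<Delta> s\<close> and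
  \<open>\<Delta> t\<close>.\<close>

locale closed_open_frame = gorder_frame L for L :: "'a gorder" (structure) +
  fixes F :: "'a set"
  assumes F_carrier: "F \<subseteq> carrier L"
    and F_bottom: "\<bottom> \<in> F"
    and F_join: "\<lbrakk>s \<in> F; t \<in> F\<rbrakk> \<Longrightarrow> s \<squnion> t \<in> F"
begin

definition base :: "('a \<times> 'a) set set" where
  "base = {\<nabla> x \<sqinter>\<^bsub>A\<^esub> \<Delta> s | x s. x \<in> carrier L \<and> s \<in> F}"

abbreviation "generators \<equiv> \<nabla> ` carrier L \<union> \<Delta> ` F"

abbreviation "G \<equiv> generated_subframe A generators"

lemma generators_carrier: "generators \<subseteq> carrier A"
  using F_carrier closed_in_A open_in_A by auto

lemma base_carrier: "base \<subseteq> carrier A"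
  using F_carrier by (auto simp: base_def intro!: A.meet_closed closed_in_A open_in_A)

lemma base_meet:
  assumes "x \<in> carrier L" "y \<in> carrier L" "s \<in> F" "t \<in> F"
  shows "(\<nabla> x \<sqinter>\<^bsub>A\<^esub> \<Delta> s) \<sqinter>\<^bsub>A\<^esub> (\<nabla> y \<sqinter>\<^bsub>A\<^esub> \<Delta> t) = \<nabla> (x \<sqinter> y) \<sqinter>\<^bsub>A\<^esub> \<Delta> (s \<squnion> t)"
proof -
  have "s \<in> carrier L" "t \<in> carrier L" using assms F_carrier by auto
  then show ?thesis using assms
    by (simp add: closed_meet open_join closed_in_A open_in_A A.meet_assoc meet_comm[of A "\<Delta> s" "\<nabla> y \<sqinter>\<^bsub>A\<^esub> \<Delta> t"]
        meet_comm[of A "\<Delta> t" "\<Delta> s"])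
qed

text \<open>The joins of a base closed under finite meets form a subframe. The base contains the
  generators, through \<open>s = \<bottom>\<close> or \<open>x = \<top>\<close>.\<close>

lemma carrier_G: "carrier G = {\<Squnion>\<^bsub>A\<^esub>S | S. S \<subseteq> base}"
proof
  interpret AF: gorder_frame A ..
  have sub: "subframe A {\<Squnion>\<^bsub>A\<^esub>S | S. S \<subseteq> base}"
  proof (rule AF.subframe_joins[OF base_carrier])
    have "\<top>\<^bsub>A\<^esub> = \<nabla> \<top> \<sqinter>\<^bsub>A\<^esub> \<Delta> \<bottom>"
      by (simp add: closed_top open_bottom A.meet_lattice_simps flip: congruence_top)
    then show "\<top>\<^bsub>A\<^esub> \<in> base" unfolding base_def using F_bottom top_closed by blast
    show "\<theta> \<sqinter>\<^bsub>A\<^esub> \<chi> \<in> base" if "\<theta> \<in> base" "\<chi> \<in> base" for \<theta> \<chi>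
    proof -
      from that obtain x s y t where "x \<in> carrier L" "s \<in> F" "\<theta> = \<nabla> x \<sqinter>\<^bsub>A\<^esub> \<Delta> s"
        and "y \<in> carrier L" "t \<in> F" "\<chi> = \<nabla> y \<sqinter>\<^bsub>A\<^esub> \<Delta> t" unfolding base_def by blast
      then show ?thesis
        unfolding base_def using base_meet[of x y s t] F_join[of s t] meet_closed[of x y] by blast
    qed
  qed
  have "\<theta> = \<Squnion>\<^bsub>A\<^esub>{\<theta>}" if "\<theta> \<in> carrier A" for \<theta> using that by simp
  then have one: "\<theta> \<in> {\<Squnion>\<^bsub>A\<^esub>S | S. S \<subseteq> base}" if "\<theta> \<in> base" for \<theta>
    using that base_carrier by blast
  have top: "\<theta> \<sqinter>\<^bsub>A\<^esub> \<top>\<^bsub>A\<^esub> = \<theta>" "\<top>\<^bsub>A\<^esub> \<sqinter>\<^bsub>A\<^esub> \<theta> = \<theta>" if "\<theta> \<in> carrier A" for \<theta>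
    using that by (simp_all add: A.meet_lattice_simps)
  have "\<nabla> x \<in> base" if "x \<in> carrier L" for x
  proof -
    have "\<nabla> x = \<nabla> x \<sqinter>\<^bsub>A\<^esub> \<Delta> \<bottom>"
      using top(1)[OF closed_in_A[OF that]] by (simp add: open_bottom congruence_top)
    then show ?thesis unfolding base_def using that F_bottom by blast
  qed
  moreover have "\<Delta> s \<in> base" if "s \<in> F" for s
  proof -
    have "\<Delta> s = \<nabla> \<top> \<sqinter>\<^bsub>A\<^esub> \<Delta> s"
      using top(2)[OF open_in_A, of s] that F_carrier by (auto simp: closed_top congruence_top)
    then show ?thesis unfolding base_def using that top_closed by blast
  qed
  ultimately show "carrier G \<subseteq> {\<Squnion>\<^bsub>A\<^esub>S | S. S \<subseteq> base}"
    using one by (intro AF.generated_subframe_least[OF sub]) blast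
  have subG: "subframe A (carrier G)" by (rule AF.subframe_generated[OF generators_carrier])
  have "generators \<subseteq> carrier G" by (rule AF.generators_subset)
  then have "base \<subseteq> carrier G"
    by (auto simp: base_def intro!: AF.subframeD(3)[OF subG])
  then show "{\<Squnion>\<^bsub>A\<^esub>S | S. S \<subseteq> base} \<subseteq> carrier G"
    by (auto intro!: AF.subframeD(4)[OF subG])
qed

text \<open>Being a left adjoint gives preservation of joins only. Finite meets call for the
  explicit formula: \<open>g \<theta>\<close> is the join of all \<open>f x \<sqinter> c s\<close>
  over the basic congruences below \<open>\<theta>\<close>, where \<open>c s\<close> is the
  complement of \<open>f s\<close>.\<close>

theorem closed_open_extension:
  fixes N :: "'b gorder"
  assumes f: "frame_map L N f" and compl: "\<And>s. s \<in> F \<Longrightarrow> \<exists>b. frame.complements N (f s) b"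
  shows "\<exists>g. frame_map G N g \<and> (\<forall>x \<in> carrier L. g (\<nabla> x) = f x)"
proof -
  note D = frame_mapD[OF f]
  interpret N: gorder_frame N by (intro gorder_frame.intro D(2))
  interpret AF: gorder_frame A ..
  have subG: "subframe A (carrier G)" by (rule AF.subframe_generated[OF generators_carrier])
  note GD = AF.subframeD[OF subG]
  have fc: "f x \<in> carrier N" if "x \<in> carrier L" for x using that D(3) by auto
  define c where "c s = (SOME b. N.complements (f s) b)" for s
  have c: "N.complements (f s) (c s)" if "s \<in> F" for s
    unfolding c_def by (rule someI_ex[OF compl[OF that]])
  note cc = N.complementsD(2)[OF c]
  \<comment> \<open>The complements are picked by choice, and their uniqueness makes the choice
    compatible with joins. This makes the values at basic congruences multiply correctly under
    meets.\<close>
  have c_join: "c (s \<squnion> t) = c s \<sqinter>\<^bsub>N\<^esub> c t" if "s \<in> F" "t \<in> F" for s t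
  proof -
    have "f (s \<squnion> t) = f s \<squnion>\<^bsub>N\<^esub> f t"
      using D(4)[of "{s, t}"] that F_carrier by (auto simp: join_def)
    then show ?thesis
      using N.complements_unique[OF c[OF F_join[OF that]]] N.complements_join[OF c c, OF that] by simp
  qed
  define K where "K n = {(x, y) \<in> carrier L \<times> carrier L. (f x, f y) \<in> \<nabla>\<^bsub>N\<^esub> n}" for n
  have K: "frame_congruence L (K n)" if "n \<in> carrier N" for n
    unfolding K_def by (rule congruence_preimage[OF f N.congruence_closed[OF that]])
  \<comment> \<open>The adjunction on basic congruences. The inclusion amounts to the pair
    \<open>(x \<sqinter> s, x)\<close> being in \<open>K n\<close>, an equation in \<open>N\<close>
    of which only one inequality is substantial; \<open>complement_le_iff\<close> restates it with
    \<open>c s\<close>.\<close>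
  have base_le: "\<nabla> x \<sqinter>\<^bsub>A\<^esub> \<Delta> s \<subseteq> K n \<longleftrightarrow> f x \<sqinter>\<^bsub>N\<^esub> c s \<sqsubseteq>\<^bsub>N\<^esub> n"
    if xs: "x \<in> carrier L" "s \<in> F" and n: "n \<in> carrier N" for x s n
  proof -
    have s: "s \<in> carrier L" using xs F_carrier by auto
    have m: "f x \<sqinter>\<^bsub>N\<^esub> f s \<in> carrier N" "f x \<in> carrier N" using xs s fc by auto
    have "\<nabla> x \<sqinter>\<^bsub>A\<^esub> \<Delta> s \<subseteq> K n \<longleftrightarrow> (x \<sqinter> s, x) \<in> K n"
      using closed_Int_open_subset_iff[OF xs(1) s K[OF n]] xs s by (simp add: meet_A closed_in_A open_in_A)
    also have "\<dots> \<longleftrightarrow> (f x \<sqinter>\<^bsub>N\<^esub> f s) \<squnion>\<^bsub>N\<^esub> n = f x \<squnion>\<^bsub>N\<^esub> n"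
      using xs s m D(5)[of x s] by (simp add: K_def closed_congruence_def)
    also have "\<dots> \<longleftrightarrow> f x \<sqsubseteq>\<^bsub>N\<^esub> (f x \<sqinter>\<^bsub>N\<^esub> f s) \<squnion>\<^bsub>N\<^esub> n"
    proof
      show "f x \<sqsubseteq>\<^bsub>N\<^esub> (f x \<sqinter>\<^bsub>N\<^esub> f s) \<squnion>\<^bsub>N\<^esub> n" if "(f x \<sqinter>\<^bsub>N\<^esub> f s) \<squnion>\<^bsub>N\<^esub> n = f x \<squnion>\<^bsub>N\<^esub> n"
        unfolding that using m n by (simp add: N.join_left)
      assume *: "f x \<sqsubseteq>\<^bsub>N\<^esub> (f x \<sqinter>\<^bsub>N\<^esub> f s) \<squnion>\<^bsub>N\<^esub> n"
      show "(f x \<sqinter>\<^bsub>N\<^esub> f s) \<squnion>\<^bsub>N\<^esub> n = f x \<squnion>\<^bsub>N\<^esub> n"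
      proof (rule N.le_antisym)
        show "(f x \<sqinter>\<^bsub>N\<^esub> f s) \<squnion>\<^bsub>N\<^esub> n \<sqsubseteq>\<^bsub>N\<^esub> f x \<squnion>\<^bsub>N\<^esub> n"
          using m n s fc by (intro N.join_mono N.meet_left N.le_refl) auto
        show "f x \<squnion>\<^bsub>N\<^esub> n \<sqsubseteq>\<^bsub>N\<^esub> (f x \<sqinter>\<^bsub>N\<^esub> f s) \<squnion>\<^bsub>N\<^esub> n"
          using * m n by (simp add: N.join_le_iff N.join_right)
      qed (use m n in auto)
    qed
    also have "\<dots> \<longleftrightarrow> f x \<sqinter>\<^bsub>N\<^esub> c s \<sqsubseteq>\<^bsub>N\<^esub> n"
      by (rule N.complement_le_iff[OF c[OF xs(2)] m(2) n, symmetric])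
    finally show ?thesis .
  qed
  define H where "H \<theta> = {f x \<sqinter>\<^bsub>N\<^esub> c s | x s. x \<in> carrier L \<and> s \<in> F \<and> \<nabla> x \<sqinter>\<^bsub>A\<^esub> \<Delta> s \<subseteq> \<theta>}" for \<theta>
  have H: "H \<theta> \<subseteq> carrier N" for \<theta> using fc cc by (auto simp: H_def)
  define g where "g \<theta> = \<Squnion>\<^bsub>N\<^esub>(H \<theta>)" for \<theta>
  have gc: "g \<theta> \<in> carrier N" for \<theta> using H by (simp add: g_def)
  have adj: "g \<theta> \<sqsubseteq>\<^bsub>N\<^esub> n \<longleftrightarrow> \<theta> \<subseteq> K n" if \<theta>: "\<theta> \<in> carrier G" and n: "n \<in> carrier N" for \<theta> n
  proof -
    obtain S where S: "S \<subseteq> base" "\<theta> = \<Squnion>\<^bsub>A\<^esub>S" using \<theta> carrier_G by auto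
    have KA: "K n \<in> carrier A" using K[OF n] by (simp add: congruence_frame_simps)
    have Sc: "S \<subseteq> carrier A" using S base_carrier by auto
    have S_iff: "\<theta> \<subseteq> \<chi> \<longleftrightarrow> (\<forall>\<psi> \<in> S. \<psi> \<subseteq> \<chi>)" if "\<chi> \<in> carrier A" for \<chi>
      using A.Sup_le_iff[OF Sc that] S(2) by (simp add: congruence_frame_simps)
    have \<theta>A: "\<theta> \<in> carrier A" using \<theta> GD(1) by auto
    have "g \<theta> \<sqsubseteq>\<^bsub>N\<^esub> n \<longleftrightarrow> (\<forall>x \<in> carrier L. \<forall>s \<in> F. \<nabla> x \<sqinter>\<^bsub>A\<^esub> \<Delta> s \<subseteq> \<theta> \<longrightarrow> f x \<sqinter>\<^bsub>N\<^esub> c s \<sqsubseteq>\<^bsub>N\<^esub> n)"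
      unfolding g_def N.Sup_le_iff[OF H n] unfolding H_def by blast
    also have "\<dots> \<longleftrightarrow> (\<forall>x \<in> carrier L. \<forall>s \<in> F. \<nabla> x \<sqinter>\<^bsub>A\<^esub> \<Delta> s \<subseteq> \<theta> \<longrightarrow> \<nabla> x \<sqinter>\<^bsub>A\<^esub> \<Delta> s \<subseteq> K n)"
      using base_le[OF _ _ n] by (simp cong: ball_cong)
    also have "\<dots> \<longleftrightarrow> (\<forall>\<psi> \<in> base. \<psi> \<subseteq> \<theta> \<longrightarrow> \<psi> \<subseteq> K n)" unfolding base_def by blast
    \<comment> \<open>As \<open>\<theta>\<close> is a join of basic congruences, the basic
      congruences below it suffice as tests.\<close>
    also have "\<dots> \<longleftrightarrow> \<theta> \<subseteq> K n"
    proof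
      show "\<theta> \<subseteq> K n" if "\<forall>\<psi> \<in> base. \<psi> \<subseteq> \<theta> \<longrightarrow> \<psi> \<subseteq> K n"
        unfolding S_iff[OF KA] using that S(1) S_iff[OF \<theta>A] by auto
    qed (use subset_trans in blast)
    finally show ?thesis .
  qed
  have gen: "G = A\<lparr>carrier := carrier G\<rparr>" by (rule AF.generated_subframe_eq)
  have "frame_map (A\<lparr>carrier := carrier G\<rparr>) N g"
  proof (rule frame_mapI[OF AF.subframe_frame[OF subG] D(2)])
    fix S assume "S \<subseteq> carrier (A\<lparr>carrier := carrier G\<rparr>)"
    then have S: "S \<subseteq> carrier G" by simp
    have "g (\<Squnion>\<^bsub>A\<^esub>S) = \<Squnion>\<^bsub>N\<^esub>(g ` S)"
    proof (rule N.eq_by_upper_bounds)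
      have gS: "g ` S \<subseteq> carrier N" using gc by auto
      then show "g (\<Squnion>\<^bsub>A\<^esub>S) \<in> carrier N" "\<Squnion>\<^bsub>N\<^esub>(g ` S) \<in> carrier N" using gc by auto
      fix n assume n: "n \<in> carrier N"
      have "g (\<Squnion>\<^bsub>A\<^esub>S) \<sqsubseteq>\<^bsub>N\<^esub> n \<longleftrightarrow> \<Squnion>\<^bsub>A\<^esub>S \<subseteq> K n" by (rule adj[OF GD(4)[OF S] n])
      also have "\<dots> \<longleftrightarrow> (\<forall>\<theta> \<in> S. \<theta> \<subseteq> K n)"
        using A.Sup_le_iff[of S "K n"] S GD(1) K[OF n] by (auto simp: congruence_frame_simps)
      also have "\<dots> \<longleftrightarrow> (\<forall>\<theta> \<in> S. g \<theta> \<sqsubseteq>\<^bsub>N\<^esub> n)" using adj[OF subsetD[OF S] n] by (simp cong: ball_cong)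
      also have "\<dots> \<longleftrightarrow> \<Squnion>\<^bsub>N\<^esub>(g ` S) \<sqsubseteq>\<^bsub>N\<^esub> n" using N.Sup_le_iff[OF gS n] by simp
      finally show "g (\<Squnion>\<^bsub>A\<^esub>S) \<sqsubseteq>\<^bsub>N\<^esub> n \<longleftrightarrow> \<Squnion>\<^bsub>N\<^esub>(g ` S) \<sqsubseteq>\<^bsub>N\<^esub> n" .
    qed
    then show "g (\<Squnion>\<^bsub>A\<lparr>carrier := carrier G\<rparr>\<^esub>S) = \<Squnion>\<^bsub>N\<^esub>(g ` S)"
      by (simp only: AF.subframe_complete_lattice(2)[OF subG S])
  next
    fix \<theta> \<chi> assume "\<theta> \<in> carrier (A\<lparr>carrier := carrier G\<rparr>)" "\<chi> \<in> carrier (A\<lparr>carrier := carrier G\<rparr>)"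
    then have *: "\<theta> \<in> carrier G" "\<chi> \<in> carrier G" by auto
    then have **: "\<theta> \<in> carrier A" "\<chi> \<in> carrier A" using GD(1) by auto
    have Sup_le_g: "\<Squnion>\<^bsub>N\<^esub>U \<sqsubseteq>\<^bsub>N\<^esub> g \<psi>" if "U \<subseteq> H \<psi>" for U \<psi>
      unfolding N.Sup_le_iff[OF subset_trans[OF that H] gc] unfolding g_def using N.sup_upper[OF H] that by auto
    have mono: "g \<theta>' \<sqsubseteq>\<^bsub>N\<^esub> g \<chi>'" if "\<theta>' \<subseteq> \<chi>'" for \<theta>' \<chi>'
    proof -
      have "H \<theta>' \<subseteq> H \<chi>'" using that by (auto simp: H_def)
      then show ?thesis
        using Sup_le_g by (simp add: g_def[of \<theta>'])
    qed
    have "g (\<theta> \<sqinter>\<^bsub>A\<^esub> \<chi>) = g \<theta> \<sqinter>\<^bsub>N\<^esub> g \<chi>"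
    proof (rule N.le_antisym)
      show "g (\<theta> \<sqinter>\<^bsub>A\<^esub> \<chi>) \<sqsubseteq>\<^bsub>N\<^esub> g \<theta> \<sqinter>\<^bsub>N\<^esub> g \<chi>"
        using ** by (intro N.meet_le mono gc) (auto simp: meet_A)
      \<comment> \<open>The product of a summand of \<open>g \<theta>\<close> and one of
        \<open>g \<chi>\<close> is a summand of \<open>g\<close> at the meet, with indices
        \<open>x \<sqinter> y\<close> and \<open>s \<squnion> t\<close>. Distributivity then gives
        the nontrivial half of meet preservation.\<close>
      have "{u \<sqinter>\<^bsub>N\<^esub> v | u v. u \<in> H \<theta> \<and> v \<in> H \<chi>} \<subseteq> H (\<theta> \<sqinter>\<^bsub>A\<^esub> \<chi>)"
      proof clarify
        fix u v assume "u \<in> H \<theta>" "v \<in> H \<chi>"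
        then obtain x s y t where xs: "x \<in> carrier L" "s \<in> F" "\<nabla> x \<sqinter>\<^bsub>A\<^esub> \<Delta> s \<subseteq> \<theta>" "u = f x \<sqinter>\<^bsub>N\<^esub> c s"
          and yt: "y \<in> carrier L" "t \<in> F" "\<nabla> y \<sqinter>\<^bsub>A\<^esub> \<Delta> t \<subseteq> \<chi>" "v = f y \<sqinter>\<^bsub>N\<^esub> c t"
          unfolding H_def by blast
        have bA: "\<nabla> x \<sqinter>\<^bsub>A\<^esub> \<Delta> s \<in> carrier A" "\<nabla> y \<sqinter>\<^bsub>A\<^esub> \<Delta> t \<in> carrier A"
          using xs yt F_carrier by (auto intro!: A.meet_closed closed_in_A open_in_A)
        have "\<nabla> (x \<sqinter> y) \<sqinter>\<^bsub>A\<^esub> \<Delta> (s \<squnion> t) \<subseteq> \<theta> \<sqinter>\<^bsub>A\<^esub> \<chi>"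
          using xs(3) yt(3) unfolding base_meet[OF xs(1) yt(1) xs(2) yt(2), symmetric] meet_A[OF bA] meet_A[OF **]
          by (rule Int_mono)
        moreover have "u \<sqinter>\<^bsub>N\<^esub> v = f (x \<sqinter> y) \<sqinter>\<^bsub>N\<^esub> c (s \<squnion> t)"
          using xs yt fc[OF xs(1)] fc[OF yt(1)] cc[OF xs(2)] cc[OF yt(2)] D(5)[OF xs(1) yt(1)] c_join[OF xs(2) yt(2)]
          by (simp add: N.meet_assoc meet_comm[of N "c s" "f y \<sqinter>\<^bsub>N\<^esub> c t"] meet_comm[of N "c t" "c s"])
        ultimately show "u \<sqinter>\<^bsub>N\<^esub> v \<in> H (\<theta> \<sqinter>\<^bsub>A\<^esub> \<chi>)"
          unfolding H_def using meet_closed[OF xs(1) yt(1)] F_join[OF xs(2) yt(2)] by blast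
      qed
      moreover have "g \<theta> \<sqinter>\<^bsub>N\<^esub> g \<chi> = \<Squnion>\<^bsub>N\<^esub>{u \<sqinter>\<^bsub>N\<^esub> v | u v. u \<in> H \<theta> \<and> v \<in> H \<chi>}"
        unfolding g_def by (rule N.Sup_meet_Sup[OF H H])
      ultimately show "g \<theta> \<sqinter>\<^bsub>N\<^esub> g \<chi> \<sqsubseteq>\<^bsub>N\<^esub> g (\<theta> \<sqinter>\<^bsub>A\<^esub> \<chi>)"
        using Sup_le_g by simp
    qed (use gc in auto)
    then show "g (\<theta> \<sqinter>\<^bsub>A\<lparr>carrier := carrier G\<rparr>\<^esub> \<chi>) = g \<theta> \<sqinter>\<^bsub>N\<^esub> g \<chi>"
      by (simp only: AF.subframe_meet[OF subG *])
  next
    \<comment> \<open>Since \<open>f \<bottom>\<close> is the bottom of \<open>N\<close>, its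
      complement \<open>c \<bottom>\<close> is the top. So the summand for \<open>x = \<top>\<close>
      and \<open>s = \<bottom>\<close> is already the top of \<open>N\<close>.\<close>
    have b: "N.complements \<bottom>\<^bsub>N\<^esub> (c \<bottom>)"
      using c[OF F_bottom] D(4)[of "{}"] by (simp add: Sup_empty_eq N.Sup_empty_eq)
    have "f \<top> \<sqinter>\<^bsub>N\<^esub> c \<bottom> = \<top>\<^bsub>N\<^esub>"
      using N.complements_unique[OF b N.complements_bottom] D(6) by (simp add: N.meet_lattice_simps)
    moreover have "\<nabla> \<top> \<sqinter>\<^bsub>A\<^esub> \<Delta> \<bottom> \<subseteq> \<top>\<^bsub>A\<^esub>"
      using congruence_top closed_carrier by (simp add: meet_A closed_in_A open_in_A) blast
    ultimately have "\<top>\<^bsub>N\<^esub> \<in> H \<top>\<^bsub>A\<^esub>"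
      unfolding H_def using F_bottom top_closed by (intro CollectI exI[of _ \<top>] exI[of _ \<bottom>]) simp
    then have "g \<top>\<^bsub>A\<^esub> = \<top>\<^bsub>N\<^esub>"
      unfolding g_def using N.sup_upper[OF H] H by (intro N.le_antisym) (auto intro: N.top_higher)
    then show "g \<top>\<^bsub>A\<lparr>carrier := carrier G\<rparr>\<^esub> = \<top>\<^bsub>N\<^esub>" by (simp only: AF.subframe_top[OF subG])
  qed (use gc in auto)
  moreover have "g (\<nabla> x) = f x" if x: "x \<in> carrier L" for x
  proof (rule N.eq_by_upper_bounds[OF gc fc[OF x]])
    fix n assume n: "n \<in> carrier N"
    have "\<nabla> x \<in> carrier G" by (rule subsetD[OF AF.generators_subset]) (use x in simp)
    then have "g (\<nabla> x) \<sqsubseteq>\<^bsub>N\<^esub> n \<longleftrightarrow> (\<bottom>, x) \<in> K n" using adj n closed_subset_iff[OF x K[OF n]] by simp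
    also have "\<dots> \<longleftrightarrow> n = f x \<squnion>\<^bsub>N\<^esub> n"
      using x n fc[OF x] D(4)[of "{}"]
      by (simp add: K_def closed_congruence_def Sup_empty_eq N.Sup_empty_eq N.meet_lattice_simps)
    also have "\<dots> \<longleftrightarrow> f x \<sqsubseteq>\<^bsub>N\<^esub> n"
      using N.le_iff_meet[OF fc[OF x] n] by (simp add: eq_commute[of n])
    finally show "g (\<nabla> x) \<sqsubseteq>\<^bsub>N\<^esub> n \<longleftrightarrow> f x \<sqsubseteq>\<^bsub>N\<^esub> n" .
  qed
  ultimately show ?thesis using gen by metis
qed

end

section \<open>The assembly is a biframe\<close>

text \<open>A biframe seen from inside its main component: the two parts are replaced by their
  images, so that the embeddings disappear from the computations.\<close>

locale bigenerated_frame = gorder_frame L for L :: "'a gorder" (structure) +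
  fixes P N :: "'a set"
  assumes P: "subframe L P" and N: "subframe L N"
    and decompose: "x \<in> carrier L \<Longrightarrow> \<exists>S \<subseteq> {p \<sqinter> n | p n. p \<in> P \<and> n \<in> N}. x = \<Squnion>S"
begin

definition "rects = {p \<sqinter> n | p n. p \<in> P \<and> n \<in> N}"

definition "fin = {\<Squnion>S | S. finite S \<and> S \<subseteq> rects}"

lemmas PD = subframeD[OF P] and ND = subframeD[OF N]

lemma rects_carrier: "rects \<subseteq> carrier L"
  using PD(1) ND(1) by (auto simp: rects_def intro!: meet_closed)

lemma rects_fin: "rects \<subseteq> fin"
proof
  fix r assume r: "r \<in> rects"
  then have "r = \<Squnion>{r}" using rects_carrier by auto
  then show "r \<in> fin" unfolding fin_def using r by blast
qed

lemma parts_rects: "P \<subseteq> rects" "N \<subseteq> rects"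
proof -
  have "p = p \<sqinter> \<top>" if "p \<in> P" for p using that PD(1) by (auto simp: meet_lattice_simps)
  then show "P \<subseteq> rects" unfolding rects_def using ND(2) by blast
  have "n = \<top> \<sqinter> n" if "n \<in> N" for n using that ND(1) by (auto simp: meet_lattice_simps)
  then show "N \<subseteq> rects" unfolding rects_def using PD(2) by blast
qed

sublocale closed_open_frame L fin
proof
  show "fin \<subseteq> carrier L" using rects_carrier by (auto simp: fin_def)
  have "\<bottom> = \<Squnion>{}" by (simp add: Sup_empty_eq)
  then show "\<bottom> \<in> fin" unfolding fin_def by blast
  fix s t assume "s \<in> fin" "t \<in> fin"
  then obtain S T where ST: "finite S" "S \<subseteq> rects" "s = \<Squnion>S" "finite T" "T \<subseteq> rects" "t = \<Squnion>T"
    unfolding fin_def by blast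
  then have c: "S \<subseteq> carrier L" "T \<subseteq> carrier L" "S \<union> T \<subseteq> carrier L" using rects_carrier by auto
  have "\<Squnion>S \<squnion> \<Squnion>T = \<Squnion>(S \<union> T)"
    by (rule eq_by_upper_bounds) (use c in \<open>auto simp: join_le_iff Sup_le_iff[OF c(1)] Sup_le_iff[OF c(2)] Sup_le_iff[OF c(3)]\<close>)
  moreover have "finite (S \<union> T)" "S \<union> T \<subseteq> rects" using ST by auto
  ultimately show "s \<squnion> t \<in> fin" unfolding fin_def ST(3,6) by blast
qed

abbreviation "pos_generators \<equiv> \<nabla> ` P \<union> \<Delta> ` N"
abbreviation "neg_generators \<equiv> \<nabla> ` N \<union> \<Delta> ` P"
abbreviation "pos_assembly \<equiv> generated_subframe A pos_generators"
abbreviation "neg_assembly \<equiv> generated_subframe A neg_generators"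

sublocale AF: gorder_frame A ..

lemma part_generators_carrier: "pos_generators \<subseteq> carrier A" "neg_generators \<subseteq> carrier A"
  using PD(1) ND(1) closed_in_A open_in_A by auto

lemmas subframe_main = AF.subframe_generated[OF generators_carrier]
  and subframe_pos = AF.subframe_generated[OF part_generators_carrier(1)]
  and subframe_neg = AF.subframe_generated[OF part_generators_carrier(2)]

lemma part_subset_main: "carrier pos_assembly \<subseteq> carrier G" "carrier neg_assembly \<subseteq> carrier G"
proof -
  have "P \<subseteq> fin" "N \<subseteq> fin" using parts_rects rects_fin by auto
  then have "pos_generators \<subseteq> generators" "neg_generators \<subseteq> generators" using F_carrier by auto
  then have "pos_generators \<subseteq> carrier G" "neg_generators \<subseteq> carrier G"
    by - (erule subset_trans[OF _ AF.generators_subset[of generators]])+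
  then show "carrier pos_assembly \<subseteq> carrier G" "carrier neg_assembly \<subseteq> carrier G"
    using AF.generated_subframe_least[OF subframe_main] by auto
qed

lemma frame_map_pos: "frame_map pos_assembly G (\<lambda>\<theta>. \<theta>)"
  using AF.subframe_inclusion[OF subframe_pos subframe_main part_subset_main(1)]
  by (simp flip: AF.generated_subframe_eq)

lemma frame_map_neg: "frame_map neg_assembly G (\<lambda>\<theta>. \<theta>)"
  using AF.subframe_inclusion[OF subframe_neg subframe_main part_subset_main(2)]
  by (simp flip: AF.generated_subframe_eq)

lemma Sup_G: "S \<subseteq> carrier G \<Longrightarrow> \<Squnion>\<^bsub>G\<^esub>S = \<Squnion>\<^bsub>A\<^esub>S"
  using AF.subframe_complete_lattice(2)[OF subframe_main, of S] by (simp flip: AF.generated_subframe_eq)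

lemma meet_G: "\<lbrakk>\<theta> \<in> carrier G; \<chi> \<in> carrier G\<rbrakk> \<Longrightarrow> \<theta> \<sqinter>\<^bsub>G\<^esub> \<chi> = \<theta> \<sqinter>\<^bsub>A\<^esub> \<chi>"
  using AF.subframe_meet[OF subframe_main, of \<theta> \<chi>] by (simp flip: AF.generated_subframe_eq)

text \<open>The joins of rectangles form a subframe, so only generators have to be checked. For
  \<open>\<nabla> x\<close>, all joins and binary meets pass through \<open>\<nabla>\<close>. For
  \<open>\<Delta> s\<close>, the finite join \<open>s\<close> of rectangles becomes a finite meet of
  congruences \<open>\<Delta> (p \<sqinter> n)\<close>, each the join of \<open>\<Delta> p\<close>
  and \<open>\<Delta> n\<close>. An infinite join would give an infinite meet, which a subframe need
  not contain.\<close>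

lemma assembly_decompose:
  assumes "\<theta> \<in> carrier G"
  shows "\<exists>S \<subseteq> {\<alpha> \<sqinter>\<^bsub>A\<^esub> \<beta> | \<alpha> \<beta>. \<alpha> \<in> carrier pos_assembly \<and> \<beta> \<in> carrier neg_assembly}. \<theta> = \<Squnion>\<^bsub>A\<^esub>S"
proof -
  let ?E = "{\<alpha> \<sqinter>\<^bsub>A\<^esub> \<beta> | \<alpha> \<beta>. \<alpha> \<in> carrier pos_assembly \<and> \<beta> \<in> carrier neg_assembly}"
  note pD = AF.subframeD[OF subframe_pos] and nD = AF.subframeD[OF subframe_neg]
  have Ec: "?E \<subseteq> carrier A" using pD(1) nD(1) by (auto intro!: A.meet_closed)
  have E: "\<alpha> \<sqinter>\<^bsub>A\<^esub> \<beta> \<in> ?E" if "\<alpha> \<in> carrier pos_assembly" "\<beta> \<in> carrier neg_assembly" for \<alpha> \<beta>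
    using that by blast
  have sub: "subframe A {\<Squnion>\<^bsub>A\<^esub>S | S. S \<subseteq> ?E}"
  proof (rule AF.subframe_joins[OF Ec])
    show "\<top>\<^bsub>A\<^esub> \<in> ?E" using E[OF pD(2) nD(2)] by (simp add: A.meet_lattice_simps)
    fix \<theta> \<chi> assume "\<theta> \<in> ?E" "\<chi> \<in> ?E"
    then obtain \<alpha> \<beta> \<gamma> \<delta> where *: "\<alpha> \<in> carrier pos_assembly" "\<beta> \<in> carrier neg_assembly" "\<theta> = \<alpha> \<sqinter>\<^bsub>A\<^esub> \<beta>"
      "\<gamma> \<in> carrier pos_assembly" "\<delta> \<in> carrier neg_assembly" "\<chi> = \<gamma> \<sqinter>\<^bsub>A\<^esub> \<delta>" by blast
    then have c: "\<alpha> \<in> carrier A" "\<beta> \<in> carrier A" "\<gamma> \<in> carrier A" "\<delta> \<in> carrier A"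
      using pD(1) nD(1) by auto
    then have "\<beta> \<sqinter>\<^bsub>A\<^esub> (\<gamma> \<sqinter>\<^bsub>A\<^esub> \<delta>) = \<gamma> \<sqinter>\<^bsub>A\<^esub> (\<beta> \<sqinter>\<^bsub>A\<^esub> \<delta>)"
      using A.meet_assoc[of \<beta> \<gamma> \<delta>] A.meet_assoc[of \<gamma> \<beta> \<delta>] by (simp add: meet_comm[of A \<beta> \<gamma>])
    then have "\<theta> \<sqinter>\<^bsub>A\<^esub> \<chi> = (\<alpha> \<sqinter>\<^bsub>A\<^esub> \<gamma>) \<sqinter>\<^bsub>A\<^esub> (\<beta> \<sqinter>\<^bsub>A\<^esub> \<delta>)"
      unfolding * using c by (simp add: A.meet_assoc)
    then show "\<theta> \<sqinter>\<^bsub>A\<^esub> \<chi> \<in> ?E" using E[OF pD(3) nD(3)] * by simp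
  qed
  let ?J = "{\<Squnion>\<^bsub>A\<^esub>S | S. S \<subseteq> ?E}"
  note JD = AF.subframeD[OF sub]
  have EJ: "\<theta> \<in> ?J" if "\<theta> \<in> ?E" for \<theta>
  proof -
    have "\<theta> = \<Squnion>\<^bsub>A\<^esub>{\<theta>}" using subsetD[OF Ec that] by simp
    then show ?thesis using that by blast
  qed
  have posJ: "\<alpha> \<in> ?J" if "\<alpha> \<in> carrier pos_assembly" for \<alpha>
    using EJ[OF E[OF that nD(2)]] subsetD[OF pD(1) that] by (simp add: A.meet_lattice_simps)
  have negJ: "\<beta> \<in> ?J" if "\<beta> \<in> carrier neg_assembly" for \<beta>
    using EJ[OF E[OF pD(2) that]] subsetD[OF nD(1) that] by (simp add: A.meet_lattice_simps)
  have gen: "\<nabla> p \<in> carrier pos_assembly" "\<Delta> p \<in> carrier neg_assembly" if "p \<in> P" for p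
    by (rule subsetD[OF AF.generators_subset], use that in blast)+
  have gen': "\<nabla> n \<in> carrier neg_assembly" "\<Delta> n \<in> carrier pos_assembly" if "n \<in> N" for n
    by (rule subsetD[OF AF.generators_subset], use that in blast)+
  have closedJ: "\<nabla> x \<in> ?J" if x: "x \<in> carrier L" for x
  proof -
    obtain S where S: "S \<subseteq> rects" "x = \<Squnion>S" using decompose[OF x] unfolding rects_def by blast
    have "\<nabla> r \<in> ?E" if "r \<in> rects" for r
    proof -
      obtain p n where "p \<in> P" "n \<in> N" "r = p \<sqinter> n" using \<open>r \<in> rects\<close> unfolding rects_def by blast
      then show ?thesis
        using subsetD[OF PD(1), of p] subsetD[OF ND(1), of n] E[OF gen(1) gen'(1), of p n] by (simp add: closed_meet)
    qed
    then have "\<nabla> ` S \<subseteq> ?E" using S(1) by blast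
    moreover have "\<nabla> x = \<Squnion>\<^bsub>A\<^esub>(\<nabla> ` S)" using S rects_carrier by (simp add: closed_Sup)
    ultimately show ?thesis by blast
  qed
  have openJ: "\<Delta> (\<Squnion>S) \<in> ?J" if "finite S" "S \<subseteq> rects" for S
    using that
  proof (induction rule: finite_induct)
    case empty
    have "\<Delta> \<bottom> = \<top>\<^bsub>A\<^esub>" by (simp add: open_bottom congruence_top)
    then show ?case using JD(2) by (simp add: Sup_empty_eq)
  next
    case (insert r S)
    obtain p n where pn: "p \<in> P" "n \<in> N" "r = p \<sqinter> n" using insert.prems unfolding rects_def by blast
    then have c: "p \<in> carrier L" "n \<in> carrier L" using PD(1) ND(1) by auto
    have "\<Delta> r = \<Squnion>\<^bsub>A\<^esub>{\<Delta> p, \<Delta> n}" using open_meet[OF c] pn(3) by (simp add: join_def)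
    also have "\<dots> \<in> ?J" by (rule JD(4)) (use negJ[OF gen(2)] posJ[OF gen'(2)] pn in auto)
    finally have "\<Delta> r \<in> ?J" .
    moreover have "\<Delta> (\<Squnion>S) \<in> ?J" using insert by auto
    moreover have "\<Delta> (\<Squnion>(insert r S)) = \<Delta> r \<sqinter>\<^bsub>A\<^esub> \<Delta> (\<Squnion>S)"
    proof -
      have "r \<in> carrier L" "S \<subseteq> carrier L" using insert.prems rects_carrier by auto
      then show ?thesis by (simp add: Sup_insert_eq open_join)
    qed
    ultimately show ?case using JD(3) by simp
  qed
  have "generators \<subseteq> ?J"
    using closedJ openJ unfolding fin_def by blast
  then have "carrier G \<subseteq> ?J" by (rule AF.generated_subframe_least[OF sub])
  then show ?thesis using assms by blast
qed

end

section \<open>Passage from biframes to frames generated by two subframes\<close>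

lemma frame_map_image_subframe:
  assumes f: "frame_map K L f"
  shows "subframe L (f ` carrier K)"
proof -
  note D = frame_mapD[OF f]
  interpret K: frame K by (rule D(1))
  show ?thesis
    unfolding subframe_def
  proof (intro conjI ballI allI impI)
    show "f ` carrier K \<subseteq> carrier L" using D(3) by auto
    show "\<top>\<^bsub>L\<^esub> \<in> f ` carrier K" using D(6)[symmetric] by simp
    show "x \<sqinter>\<^bsub>L\<^esub> y \<in> f ` carrier K" if "x \<in> f ` carrier K" "y \<in> f ` carrier K" for x y
      using that by (auto simp: D(5)[symmetric])
    fix S assume "S \<subseteq> f ` carrier K"
    then obtain T where "T \<subseteq> carrier K" "S = f ` T" by (auto simp: subset_image_iff)
    then show "\<Squnion>\<^bsub>L\<^esub>S \<in> f ` carrier K" by (simp flip: D(4))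
  qed
qed

abbreviation pos_part :: "('p, 'n, 'm) biframe_data \<Rightarrow> 'm set" where
  "pos_part B \<equiv> pos_map B ` carrier (pos B)"

abbreviation neg_part :: "('p, 'n, 'm) biframe_data \<Rightarrow> 'm set" where
  "neg_part B \<equiv> neg_map B ` carrier (neg B)"

lemma rectangles_eq:
  "rectangles B = {p \<sqinter>\<^bsub>main B\<^esub> n | p n. p \<in> pos_part B \<and> n \<in> neg_part B}"
  unfolding rectangles_def by blast

lemma biframe_bigenerated:
  assumes "biframe B"
  shows "bigenerated_frame (main B) (pos_part B) (neg_part B)"
proof -
  have m: "frame_map (pos B) (main B) (pos_map B)" "frame_map (neg B) (main B) (neg_map B)"
    and d: "\<forall>x \<in> carrier (main B). \<exists>S \<subseteq> rectangles B. x = \<Squnion>\<^bsub>main B\<^esub>S"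
    using assms by (auto simp: biframe_def)
  show ?thesis
    by (intro bigenerated_frame.intro gorder_frame.intro bigenerated_frame_axioms.intro
        frame_map_image_subframe m frame_mapD(2)[OF m(1)])
      (use d in \<open>auto simp: rectangles_eq\<close>)
qed

lemma fin_elements_eq:
  assumes "biframe B"
  shows "fin_elements B = bigenerated_frame.fin (main B) (pos_part B) (neg_part B)"
proof -
  interpret bigenerated_frame "main B" "pos_part B" "neg_part B" by (rule biframe_bigenerated[OF assms])
  show ?thesis unfolding fin_elements_def fin_def rects_def rectangles_eq ..
qed

lemma biframe_assembly:
  assumes B: "biframe B"
  shows "biframe (assembly B)"
proof -
  interpret bigenerated_frame "main B" "pos_part B" "neg_part B" by (rule biframe_bigenerated[OF B])
  have sel: "pos (assembly B) = pos_assembly" "neg (assembly B) = neg_assembly" "main (assembly B) = G"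
    "pos_map (assembly B) = (\<lambda>\<theta>. \<theta>)" "neg_map (assembly B) = (\<lambda>\<theta>. \<theta>)"
    by (simp_all add: assembly_def Let_def fin_elements_eq[OF B])
  have r: "rectangles (assembly B)
      = {\<alpha> \<sqinter>\<^bsub>A\<^esub> \<beta> | \<alpha> \<beta>. \<alpha> \<in> carrier pos_assembly \<and> \<beta> \<in> carrier neg_assembly}"
    unfolding rectangles_def sel using part_subset_main meet_G by blast
  have "\<exists>S \<subseteq> rectangles (assembly B). \<theta> = \<Squnion>\<^bsub>G\<^esub>S" if \<theta>: "\<theta> \<in> carrier G" for \<theta>
  proof -
    obtain S where S: "S \<subseteq> rectangles (assembly B)" "\<theta> = \<Squnion>\<^bsub>A\<^esub>S" using assembly_decompose[OF \<theta>] r by auto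
    have "rectangles (assembly B) \<subseteq> carrier G"
      unfolding r using part_subset_main by (auto intro!: AF.subframeD(3)[OF subframe_main] dest: subsetD)
    then have "S \<subseteq> carrier G" using S(1) by (rule subset_trans[rotated])
    then have "\<theta> = \<Squnion>\<^bsub>G\<^esub>S" using S(2) Sup_G by simp
    then show ?thesis using S(1) by blast
  qed
  then show ?thesis
    unfolding biframe_def sel using frame_map_pos frame_map_neg by (simp add: inj_on_def)
qed

section \<open>The assembly of a finitary biframe is finitary\<close>

lemma frame_map_compose:
  assumes f: "frame_map K L f" and g: "frame_map L M g"
  shows "frame_map K M (\<lambda>x. g (f x))"
proof -
  note F = frame_mapD[OF f] and G = frame_mapD[OF g]
  show ?thesis
  proof (rule frame_mapI[OF F(1) G(2)])
    show "g (f (\<Squnion>\<^bsub>K\<^esub>S)) = \<Squnion>\<^bsub>M\<^esub>((\<lambda>x. g (f x)) ` S)" if S: "S \<subseteq> carrier K" for S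
    proof -
      have "f ` S \<subseteq> carrier L" using S F(3) by auto
      then show ?thesis using G(4)[of "f ` S"] F(4)[OF S] by (simp add: image_image)
    qed
    show "g (f (x \<sqinter>\<^bsub>K\<^esub> y)) = g (f x) \<sqinter>\<^bsub>M\<^esub> g (f y)" if "x \<in> carrier K" "y \<in> carrier K" for x y
      using that F(3) F(5)[OF that] G(5)[of "f x" "f y"] by auto
  qed (use F(3,6) G(3,6) in auto)
qed

lemma frame_map_bottom:
  assumes f: "frame_map L M f"
  shows "f \<bottom>\<^bsub>L\<^esub> = \<bottom>\<^bsub>M\<^esub>"
proof -
  note F = frame_mapD[OF f]
  interpret L: frame L by (rule F)
  interpret M: frame M by (rule F)
  show ?thesis using F(4)[of "{}"] by (simp add: L.Sup_empty_eq M.Sup_empty_eq)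
qed

lemma frame_map_join:
  assumes "frame_map L M f" "x \<in> carrier L" "y \<in> carrier L"
  shows "f (x \<squnion>\<^bsub>L\<^esub> y) = f x \<squnion>\<^bsub>M\<^esub> f y"
  using frame_mapD(4)[OF assms(1), of "{x, y}"] assms(2,3) by (simp add: join_def)

text \<open>Serves to descend a map defined on the coproduct of the parts of a biframe to its main
  component. Preimages under \<open>r\<close> are chosen; the condition on kernels makes the choice
  immaterial.\<close>

lemma frame_map_factor:
  assumes r: "frame_map C L r" and surj: "carrier L \<subseteq> r ` carrier C" and f: "frame_map C M f"
    and ker: "\<And>U V. \<lbrakk>U \<in> carrier C; V \<in> carrier C; r U = r V\<rbrakk> \<Longrightarrow> f U = f V"
  shows "\<exists>g. frame_map L M g \<and> (\<forall>U \<in> carrier C. g (r U) = f U)"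
proof -
  note R = frame_mapD[OF r] and F = frame_mapD[OF f]
  interpret C: frame C by (rule R)
  define g where "g x = f (SOME U. U \<in> carrier C \<and> r U = x)" for x
  have g: "g (r U) = f U" if U: "U \<in> carrier C" for U
  proof -
    have "\<exists>V. V \<in> carrier C \<and> r V = r U" using U by blast
    from someI_ex[OF this] show ?thesis unfolding g_def using ker U by blast
  qed
  have "frame_map L M g"
  proof (rule frame_mapI[OF R(2) F(2)])
    show "g \<in> carrier L \<rightarrow> carrier M"
    proof
      fix x assume "x \<in> carrier L"
      then obtain U where "U \<in> carrier C" "x = r U" using surj by blast
      then show "g x \<in> carrier M" using g F(3) by auto
    qed
    show "g \<top>\<^bsub>L\<^esub> = \<top>\<^bsub>M\<^esub>" using g[OF C.top_closed] R(6) F(6) by simp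
    show "g (x \<sqinter>\<^bsub>L\<^esub> y) = g x \<sqinter>\<^bsub>M\<^esub> g y" if xy: "x \<in> carrier L" "y \<in> carrier L" for x y
    proof -
      obtain U V where "U \<in> carrier C" "V \<in> carrier C" "x = r U" "y = r V" using surj xy by blast
      then show ?thesis using g[OF C.meet_closed, of U V] by (simp add: R(5) F(5) g)
    qed
    fix S assume "S \<subseteq> carrier L"
    then have "S \<subseteq> r ` carrier C" using surj by (rule subset_trans)
    then obtain T where T: "T \<subseteq> carrier C" "S = r ` T" by (auto simp: subset_image_iff)
    have "g ` r ` T = f ` T" unfolding image_image by (rule image_cong) (use T g in auto)
    then show "g (\<Squnion>\<^bsub>L\<^esub>S) = \<Squnion>\<^bsub>M\<^esub>(g ` S)" using T g[OF C.sup_closed[OF T(1)]] R(4) F(4) by simp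
  qed
  then show ?thesis using g by blast
qed

lemma congruence_generated_subset_kernel:
  assumes R: "R \<subseteq> carrier L \<times> carrier L" and f: "frame_map L M f"
    and le: "\<And>a b. (a, b) \<in> R \<Longrightarrow> f a \<sqsubseteq>\<^bsub>M\<^esub> f b"
  shows "congruence_generated L R \<subseteq> frame_kernel L f"
proof -
  note L = frame_mapD(1)[OF f]
  interpret framecong L "congruence_generated L R"
    using L frame_congruence_generated(1)[OF L R] by (simp add: framecong_def framecong_axioms_def)
  obtain k where k: "\<forall>x \<in> carrier L. k (q x) = f x"
    using quotient_universal(5)[OF L R f le] by blast
  show ?thesis
  proof clarify
    fix x y assume xy: "(x, y) \<in> congruence_generated L R"
    then have c: "x \<in> carrier L" "y \<in> carrier L" using carr by auto
    then have "q x = q y" using q_eq xy by blast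
    then have "f x = f y" using k c by metis
    then show "(x, y) \<in> frame_kernel L f" using c by (simp add: frame_kernel_def)
  qed
qed

lemma (in gorder_frame) frame_map_closed:
  assumes e: "frame_map K L e" and T: "subframe A T" and eT: "\<And>x. x \<in> carrier K \<Longrightarrow> \<nabla> (e x) \<in> T"
  shows "frame_map K (A\<lparr>carrier := T\<rparr>) (\<lambda>x. \<nabla> (e x))"
proof -
  note E = frame_mapD[OF e]
  interpret AF: gorder_frame A ..
  show ?thesis
  proof (rule frame_mapI[OF E(1) AF.subframe_frame[OF T]])
    fix S assume S: "S \<subseteq> carrier K"
    then have "e ` S \<subseteq> carrier L" "(\<lambda>x. \<nabla> (e x)) ` S \<subseteq> T" using E(3) eT by auto
    then show "\<nabla> (e (\<Squnion>\<^bsub>K\<^esub>S)) = \<Squnion>\<^bsub>A\<lparr>carrier := T\<rparr>\<^esub>((\<lambda>x. \<nabla> (e x)) ` S)"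
      using E(4)[OF S] by (simp add: closed_Sup AF.subframe_complete_lattice(2)[OF T] image_image)
  next
    show "\<nabla> (e (x \<sqinter>\<^bsub>K\<^esub> y)) = \<nabla> (e x) \<sqinter>\<^bsub>A\<lparr>carrier := T\<rparr>\<^esub> \<nabla> (e y)"
      if xy: "x \<in> carrier K" "y \<in> carrier K" for x y
    proof -
      have "e x \<in> carrier L" "e y \<in> carrier L" using xy E(3) by auto
      then show ?thesis by (simp add: E(5)[OF xy] closed_meet AF.subframe_meet[OF T eT eT, OF xy])
    qed
    show "\<nabla> (e \<top>\<^bsub>K\<^esub>) = \<top>\<^bsub>A\<lparr>carrier := T\<rparr>\<^esub>"
      by (simp only: E(6) AF.subframe_top[OF T] closed_top congruence_top)
  qed (use eT in auto)
qed

section \<open>Finite elements of a frame coproduct\<close>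

abbreviation coproduct_rectangle :: "'a gorder \<Rightarrow> 'b gorder \<Rightarrow> 'a \<times> 'b \<Rightarrow> ('a \<times> 'b) set" where
  "coproduct_rectangle K M \<equiv> \<lambda>(x, y). coproduct_inl K M x \<sqinter>\<^bsub>frame_coproduct K M\<^esub> coproduct_inr K M y"

context framepair begin

lemma inl_carrier: "x \<in> carrier L \<Longrightarrow> coproduct_inl L M x \<in> carrier C"
  and inr_carrier: "y \<in> carrier M \<Longrightarrow> coproduct_inr L M y \<in> carrier C"
  by (simp_all add: C_simps idl_inl idl_inr)

lemma coproduct_rectangle_carrier:
  "Z \<subseteq> carrier L \<times> carrier M \<Longrightarrow> coproduct_rectangle L M ` Z \<subseteq> carrier C"
proof -
  interpret C: frame C by (rule frame_C)
  show "Z \<subseteq> carrier L \<times> carrier M \<Longrightarrow> coproduct_rectangle L M ` Z \<subseteq> carrier C"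
    using inl_carrier inr_carrier by auto
qed

text \<open>Indexing by finite sets of pairs of coordinates, instead of sets of rectangles, allows
  maps to be applied coordinatewise and keeps the result finite.\<close>

lemma coproduct_fin_elements:
  "fin_elements (coproduct_biframe L M)
     = {\<Squnion>\<^bsub>C\<^esub>(coproduct_rectangle L M ` Z) | Z. finite Z \<and> Z \<subseteq> carrier L \<times> carrier M}"
proof -
  have r: "rectangles (coproduct_biframe L M) = coproduct_rectangle L M ` (carrier L \<times> carrier M)"
    unfolding rectangles_def coproduct_biframe_def by auto
  have m: "main (coproduct_biframe L M) = C" by (simp add: coproduct_biframe_def)
  show ?thesis
  proof (intro equalityI subsetI)
    fix X assume "X \<in> fin_elements (coproduct_biframe L M)"
    then obtain S where S: "finite S" "S \<subseteq> coproduct_rectangle L M ` (carrier L \<times> carrier M)" "X = \<Squnion>\<^bsub>C\<^esub>S"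
      unfolding fin_elements_def r m by blast
    obtain Z where "Z \<subseteq> carrier L \<times> carrier M" "finite Z" "S = coproduct_rectangle L M ` Z"
      using finite_subset_image[OF S(1,2)] by blast
    then show "X \<in> {\<Squnion>\<^bsub>C\<^esub>(coproduct_rectangle L M ` Z) | Z. finite Z \<and> Z \<subseteq> carrier L \<times> carrier M}"
      using S(3) by blast
  next
    fix X assume "X \<in> {\<Squnion>\<^bsub>C\<^esub>(coproduct_rectangle L M ` Z) | Z. finite Z \<and> Z \<subseteq> carrier L \<times> carrier M}"
    then obtain Z where Z: "finite Z" "Z \<subseteq> carrier L \<times> carrier M" "X = \<Squnion>\<^bsub>C\<^esub>(coproduct_rectangle L M ` Z)"
      by blast
    have "finite (coproduct_rectangle L M ` Z)"
      "coproduct_rectangle L M ` Z \<subseteq> coproduct_rectangle L M ` (carrier L \<times> carrier M)"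
      using Z(1,2) by (auto intro: image_mono)
    then show "X \<in> fin_elements (coproduct_biframe L M)"
      unfolding fin_elements_def r m Z(3) by blast
  qed
qed

lemma frame_map_coproduct_rectangles:
  assumes k: "frame_map C N k" and Z: "Z \<subseteq> carrier L \<times> carrier M"
  shows "k (\<Squnion>\<^bsub>C\<^esub>(coproduct_rectangle L M ` Z))
    = \<Squnion>\<^bsub>N\<^esub>((\<lambda>(x, y). k (coproduct_inl L M x) \<sqinter>\<^bsub>N\<^esub> k (coproduct_inr L M y)) ` Z)"
proof -
  note K = frame_mapD[OF k]
  have "k ` coproduct_rectangle L M ` Z = (\<lambda>(x, y). k (coproduct_inl L M x) \<sqinter>\<^bsub>N\<^esub> k (coproduct_inr L M y)) ` Z"
    unfolding image_image by (rule image_cong) (use Z inl_carrier inr_carrier K(5) in auto)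
  then show ?thesis using K(4)[OF coproduct_rectangle_carrier[OF Z]] by simp
qed

end

section \<open>The coproduct of the assembly parts modulo finite inequalities\<close>

context bigenerated_frame begin

abbreviation "coprod \<equiv> frame_coproduct pos_assembly neg_assembly"
abbreviation "inl \<equiv> coproduct_inl pos_assembly neg_assembly"
abbreviation "inr \<equiv> coproduct_inr pos_assembly neg_assembly"
abbreviation "rectangle \<equiv> coproduct_rectangle pos_assembly neg_assembly"
abbreviation "coprod_fin \<equiv> fin_elements (coproduct_biframe pos_assembly neg_assembly)"

definition "to_main = coproduct_copair G (\<lambda>\<theta>. \<theta>) (\<lambda>\<theta>. \<theta>)"

text \<open>Taking every valid inequality between finite elements makes one inclusion of congruences
  immediate and lets any finite fact about the assembly be transferred to the quotient.\<close>

definition "fin_inequalities = {(X, Y) \<in> coprod_fin \<times> coprod_fin. to_main X \<sqsubseteq>\<^bsub>G\<^esub> to_main Y}"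

definition "fin_congruence = congruence_generated coprod fin_inequalities"

abbreviation "quot \<equiv> quotient_frame coprod fin_congruence"
abbreviation "q X \<equiv> fin_congruence `` {X}"

lemmas coprod_maps = coproduct_universal[OF frame_map_pos frame_map_neg, folded to_main_def]

lemmas frame_coprod = frame_mapD(1)[OF coprod_maps(3)]
  and frame_G = frame_mapD(2)[OF coprod_maps(3)]

sublocale pair: framepair pos_assembly neg_assembly
  by (intro framepair.intro frame_mapD(1)[OF frame_map_pos] frame_mapD(1)[OF frame_map_neg])

lemma coprod_finI:
  "finite Z \<Longrightarrow> Z \<subseteq> carrier pos_assembly \<times> carrier neg_assembly
    \<Longrightarrow> \<Squnion>\<^bsub>coprod\<^esub>(rectangle ` Z) \<in> coprod_fin"
  unfolding pair.coproduct_fin_elements by blast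

lemma coprod_fin_carrier: "coprod_fin \<subseteq> carrier coprod"
proof -
  interpret C: frame coprod by (rule frame_coprod)
  show ?thesis
    unfolding pair.coproduct_fin_elements using pair.coproduct_rectangle_carrier by auto
qed

lemma fin_inequalities_carrier: "fin_inequalities \<subseteq> carrier coprod \<times> carrier coprod"
  using coprod_fin_carrier by (auto simp: fin_inequalities_def)

lemmas quot_universal = quotient_universal[OF frame_coprod fin_inequalities_carrier, folded fin_congruence_def]

lemmas frame_map_q = quot_universal(1)

lemmas frame_quot = frame_mapD(2)[OF frame_map_q]

lemma q_le:
  assumes "X \<in> coprod_fin" "Y \<in> coprod_fin" "to_main X \<sqsubseteq>\<^bsub>G\<^esub> to_main Y"
  shows "q X \<sqsubseteq>\<^bsub>quot\<^esub> q Y"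
  by (rule quot_universal(4)) (use assms in \<open>auto simp: fin_inequalities_def\<close>)

lemma q_eq:
  assumes "X \<in> coprod_fin" "Y \<in> coprod_fin" "to_main X = to_main Y"
  shows "q X = q Y"
proof -
  interpret Q: frame quot by (rule frame_quot)
  interpret G: frame G by (rule frame_G)
  have c: "X \<in> carrier coprod" "Y \<in> carrier coprod" using assms coprod_fin_carrier by auto
  then have "to_main X \<in> carrier G" using frame_mapD(3)[OF coprod_maps(3)] by auto
  then have "q X \<sqsubseteq>\<^bsub>quot\<^esub> q Y" "q Y \<sqsubseteq>\<^bsub>quot\<^esub> q X"
    using assms q_le by simp_all
  moreover have "q X \<in> carrier quot" "q Y \<in> carrier quot"
    using frame_mapD(3)[OF frame_map_q] c by auto
  ultimately show ?thesis by (rule Q.le_antisym)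
qed

text \<open>Being complementary is a pair of equations between finite elements of the coproduct;
  they hold after \<open>to_main\<close>, so the quotient satisfies them.\<close>

lemma q_complements:
  assumes \<alpha>: "\<alpha> \<in> carrier pos_assembly" and \<beta>: "\<beta> \<in> carrier neg_assembly" and compl: "A.complements \<alpha> \<beta>"
  shows "frame.complements quot (q (inl \<alpha>)) (q (inr \<beta>))"
proof -
  interpret Q: frame quot by (rule frame_quot)
  interpret C: frame coprod by (rule frame_coprod)
  interpret G: frame G by (rule frame_G)
  have "frame.complements (A\<lparr>carrier := carrier G\<rparr>) \<alpha> \<beta>"
    by (rule AF.subframe_complements[OF subframe_main compl]) (use \<alpha> \<beta> part_subset_main in auto)
  then have "G.complements \<alpha> \<beta>" by (simp flip: AF.generated_subframe_eq)
  note D = G.complementsD[OF this]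
  have tops: "inl \<top>\<^bsub>pos_assembly\<^esub> = \<top>\<^bsub>coprod\<^esub>" "inr \<top>\<^bsub>neg_assembly\<^esub> = \<top>\<^bsub>coprod\<^esub>"
    using frame_mapD(6)[OF coprod_maps(1)] frame_mapD(6)[OF coprod_maps(2)] .
  have c: "inl \<alpha> \<in> carrier coprod" "inr \<beta> \<in> carrier coprod"
    using \<alpha> \<beta> by (simp_all add: pair.inl_carrier pair.inr_carrier)
  \<comment> \<open>The sides of the two equations are finite: \<open>\<bottom>\<close> is the empty
    join, \<open>\<top>\<close> is one rectangle, and in the join \<open>\<alpha>\<close> and
    \<open>\<beta>\<close> are rectangles whose other side is \<open>\<top>\<close>.\<close>
  have f1: "\<bottom>\<^bsub>coprod\<^esub> \<in> coprod_fin" using coprod_finI[of "{}"] by (simp add: C.Sup_empty_eq)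
  have f2: "inl \<alpha> \<sqinter>\<^bsub>coprod\<^esub> inr \<beta> \<in> coprod_fin"
    using coprod_finI[of "{(\<alpha>, \<beta>)}"] \<alpha> \<beta> c by simp
  have f3: "\<top>\<^bsub>coprod\<^esub> \<in> coprod_fin"
    using coprod_finI[of "{(\<top>\<^bsub>pos_assembly\<^esub>, \<top>\<^bsub>neg_assembly\<^esub>)}"] by (simp add: tops C.meet_lattice_simps)
  have f4: "inl \<alpha> \<squnion>\<^bsub>coprod\<^esub> inr \<beta> \<in> coprod_fin"
    using coprod_finI[of "{(\<alpha>, \<top>\<^bsub>neg_assembly\<^esub>), (\<top>\<^bsub>pos_assembly\<^esub>, \<beta>)}"] \<alpha> \<beta> c
    by (simp add: tops C.meet_lattice_simps join_def)
  have "to_main (inl \<alpha> \<sqinter>\<^bsub>coprod\<^esub> inr \<beta>) = to_main \<bottom>\<^bsub>coprod\<^esub>"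
    using frame_mapD(5)[OF coprod_maps(3) c] D(3) coprod_maps(4)[OF \<alpha>] coprod_maps(5)[OF \<beta>]
    by (simp add: frame_map_bottom[OF coprod_maps(3)])
  then have "q (inl \<alpha> \<sqinter>\<^bsub>coprod\<^esub> inr \<beta>) = q \<bottom>\<^bsub>coprod\<^esub>" by (rule q_eq[OF f2 f1])
  then have "q (inl \<alpha>) \<sqinter>\<^bsub>quot\<^esub> q (inr \<beta>) = \<bottom>\<^bsub>quot\<^esub>"
    using frame_mapD(5)[OF frame_map_q c] frame_map_bottom[OF frame_map_q] by simp
  moreover have "to_main (inl \<alpha> \<squnion>\<^bsub>coprod\<^esub> inr \<beta>) = to_main \<top>\<^bsub>coprod\<^esub>"
    using frame_map_join[OF coprod_maps(3) c] D(4) coprod_maps(4)[OF \<alpha>] coprod_maps(5)[OF \<beta>]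
    by (simp add: frame_mapD(6)[OF coprod_maps(3)])
  then have "q (inl \<alpha> \<squnion>\<^bsub>coprod\<^esub> inr \<beta>) = q \<top>\<^bsub>coprod\<^esub>" by (rule q_eq[OF f4 f3])
  then have "q (inl \<alpha>) \<squnion>\<^bsub>quot\<^esub> q (inr \<beta>) = \<top>\<^bsub>quot\<^esub>"
    using frame_map_join[OF frame_map_q c] frame_mapD(6)[OF frame_map_q] by simp
  ultimately show ?thesis
    using frame_mapD(3)[OF frame_map_q] c by (auto simp: Q.complements_def)
qed

lemma closed_part:
  "p \<in> P \<Longrightarrow> \<nabla> p \<in> carrier pos_assembly" "p \<in> P \<Longrightarrow> \<Delta> p \<in> carrier neg_assembly"
  "n \<in> N \<Longrightarrow> \<nabla> n \<in> carrier neg_assembly" "n \<in> N \<Longrightarrow> \<Delta> n \<in> carrier pos_assembly"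
  by (rule subsetD[OF AF.generators_subset], blast)+

text \<open>
  Any frame map \<open>f : L \<rightarrow> quot\<close> compatible with \<open>q\<close> on closed congruences extends to the main
  component of the assembly; the extension \<open>g\<close> satisfies \<open>q = g \<circ> to_main\<close>, whence the kernel
  of \<open>to_main\<close> is no larger than that of \<open>q\<close>.
\<close>

lemma kernel_to_main:
  assumes f: "frame_map L quot f"
    and fP: "\<And>p. p \<in> P \<Longrightarrow> f p = q (inl (\<nabla> p))" and fN: "\<And>n. n \<in> N \<Longrightarrow> f n = q (inr (\<nabla> n))"
  shows "frame_kernel coprod to_main = fin_congruence"
proof
  interpret Q: frame quot by (rule frame_quot)
  interpret C: frame coprod by (rule frame_coprod)
  have compl_P: "Q.complements (f p) (q (inr (\<Delta> p)))" if "p \<in> P" for p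
    using q_complements[OF closed_part(1,2)[OF that] closed_open_complements] that PD(1) fP by auto
  have compl_N: "Q.complements (f n) (q (inl (\<Delta> n)))" if "n \<in> N" for n
    using Q.complements_sym[OF q_complements[OF closed_part(4,3)[OF that]
          A.complements_sym[OF closed_open_complements]]] that ND(1) fN by auto
  \<comment> \<open>Both parts of \<open>L\<close> go to complemented elements, rectangles are meets
    of two such elements, and finite elements are finite joins of rectangles.\<close>
  have compl: "\<exists>b. Q.complements (f s) b" if s: "s \<in> fin" for s
  proof -
    obtain S where S: "finite S" "S \<subseteq> rects" "s = \<Squnion>S" using s unfolding fin_def by blast
    have "\<exists>b. Q.complements (f r) b" if r: "r \<in> S" for r
    proof -
      obtain p n where pn: "p \<in> P" "n \<in> N" "r = p \<sqinter> n" using r S(2) unfolding rects_def by blast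
      then have "f r = f p \<sqinter>\<^bsub>quot\<^esub> f n" using subsetD[OF PD(1)] subsetD[OF ND(1)] frame_mapD(5)[OF f] by simp
      then show ?thesis using Q.complements_meet[OF compl_P compl_N, OF pn(1,2)] by metis
    qed
    then have "\<exists>b. Q.complements (\<Squnion>\<^bsub>quot\<^esub>(f ` S)) b"
      by (intro Q.complemented_finite_Sup) (use S(1) in auto)
    then show ?thesis using frame_mapD(4)[OF f, of S] S(3) subset_trans[OF S(2) rects_carrier] by simp
  qed
  obtain g where g: "frame_map G quot g" and g_closed: "\<forall>x \<in> carrier L. g (\<nabla> x) = f x"
    using closed_open_extension[OF f compl] by blast
  \<comment> \<open>The extension was specified only on closed congruences. Its values on open ones
    are determined because frame maps preserve complements.\<close>
  have g_open: "Q.complements (f s) (g (\<Delta> s))" if s: "s \<in> fin" for s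
  proof -
    have "frame.complements (A\<lparr>carrier := carrier G\<rparr>) (\<nabla> s) (\<Delta> s)"
    proof (rule AF.subframe_complements[OF subframe_main closed_open_complements])
      show "\<nabla> s \<in> carrier G" "\<Delta> s \<in> carrier G"
        by (rule subsetD[OF AF.generators_subset], use s F_carrier in blast)+
    qed (use s F_carrier in auto)
    then have "frame.complements G (\<nabla> s) (\<Delta> s)" by (simp flip: AF.generated_subframe_eq)
    from frame_map_complements[OF g this] show ?thesis using g_closed subsetD[OF F_carrier s] by simp
  qed
  have fin_parts: "P \<subseteq> fin" "N \<subseteq> fin" using parts_rects rects_fin by auto
  \<comment> \<open>Agreement need only be checked on generators. At \<open>\<Delta> n\<close> both
    sides are complements of \<open>f n\<close>, hence equal.\<close>
  have g_pos: "g \<alpha> = q (inl \<alpha>)" if "\<alpha> \<in> carrier pos_assembly" for \<alpha>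
  proof (rule AF.frame_maps_agree_on_generated[OF part_generators_carrier(1)
        frame_map_compose[OF frame_map_pos g] frame_map_compose[OF coprod_maps(1) frame_map_q] _ that])
    fix \<gamma> assume "\<gamma> \<in> pos_generators"
    then consider p where "p \<in> P" "\<gamma> = \<nabla> p" | n where "n \<in> N" "\<gamma> = \<Delta> n" by blast
    then show "g \<gamma> = q (inl \<gamma>)"
    proof cases
      case 1 then show ?thesis using g_closed fP subsetD[OF PD(1)] by simp
    next
      case 2 then show ?thesis using Q.complements_unique[OF g_open compl_N] subsetD[OF fin_parts(2)] by simp
    qed
  qed
  have g_neg: "g \<beta> = q (inr \<beta>)" if "\<beta> \<in> carrier neg_assembly" for \<beta>
  proof (rule AF.frame_maps_agree_on_generated[OF part_generators_carrier(2)
        frame_map_compose[OF frame_map_neg g] frame_map_compose[OF coprod_maps(2) frame_map_q] _ that])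
    fix \<gamma> assume "\<gamma> \<in> neg_generators"
    then consider n where "n \<in> N" "\<gamma> = \<nabla> n" | p where "p \<in> P" "\<gamma> = \<Delta> p" by blast
    then show "g \<gamma> = q (inr \<gamma>)"
    proof cases
      case 1 then show ?thesis using g_closed fN subsetD[OF ND(1)] by simp
    next
      case 2 then show ?thesis using Q.complements_unique[OF g_open compl_P] subsetD[OF fin_parts(1)] by simp
    qed
  qed
  \<comment> \<open>Both sides are frame maps on the coproduct with the same restrictions to the two
    parts, so uniqueness in the universal property applies.\<close>
  have q_factor: "q U = g (to_main U)" if U: "U \<in> carrier coprod" for U
  proof -
    note uniq = coproduct_universal(6)[OF frame_map_compose[OF coprod_maps(1) frame_map_q]
        frame_map_compose[OF coprod_maps(2) frame_map_q] _ _ _ U]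
    have "q U = coproduct_copair quot (\<lambda>\<alpha>. q (inl \<alpha>)) (\<lambda>\<beta>. q (inr \<beta>)) U"
      by (rule uniq[OF frame_map_q]) simp_all
    moreover have "g (to_main U) = coproduct_copair quot (\<lambda>\<alpha>. q (inl \<alpha>)) (\<lambda>\<beta>. q (inr \<beta>)) U"
      by (rule uniq[OF frame_map_compose[OF coprod_maps(3) g]]) (simp_all add: coprod_maps(4,5) g_pos g_neg)
    ultimately show ?thesis by simp
  qed
  have "frame_kernel coprod to_main \<subseteq> frame_kernel coprod (\<lambda>X. q X)"
    unfolding frame_kernel_def by clarify (simp add: q_factor)
  then show "frame_kernel coprod to_main \<subseteq> fin_congruence"
    using quot_universal(3) by simp
  show "fin_congruence \<subseteq> frame_kernel coprod to_main"
    unfolding fin_congruence_def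
    by (rule congruence_generated_subset_kernel[OF fin_inequalities_carrier coprod_maps(3)])
      (simp add: fin_inequalities_def)
qed

end

section \<open>Transport of the presentation of the biframe to its assembly\<close>

theorem proposition4p17:
  fixes B :: "('p, 'n, 'm) biframe_data"
  assumes "finitary_biframe B"
  shows "finitary_biframe (assembly B)"
proof -
  have B: "biframe B" using assms by (simp add: finitary_biframe_def)
  interpret bigenerated_frame "main B" "pos_part B" "neg_part B" by (rule biframe_bigenerated[OF B])
  have maps: "frame_map (pos B) (main B) (pos_map B)" "frame_map (neg B) (main B) (neg_map B)"
    using B by (auto simp: biframe_def)
  define C where "C = frame_coproduct (pos B) (neg B)"
  define r where "r = coproduct_copair (main B) (pos_map B) (neg_map B)"
  note r_maps = coproduct_universal[OF maps, folded C_def r_def]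
  interpret B: framepair "pos B" "neg B"
    by (intro framepair.intro frame_mapD(1)[OF maps(1)] frame_mapD(1)[OF maps(2)])
  obtain R where R: "R \<subseteq> fin_elements (coproduct_biframe (pos B) (neg B)) \<times> fin_elements (coproduct_biframe (pos B) (neg B))"
    and kernel_r: "frame_kernel C r = congruence_generated C R"
    using assms unfolding finitary_biframe_def finitary_congruence_def coproduct_congruence_def C_def r_def
    by (auto simp: coproduct_biframe_def)

  have closed_pos: "frame_map (pos B) pos_assembly (\<lambda>x. \<nabla>\<^bsub>main B\<^esub> (pos_map B x))"
    using frame_map_closed[OF maps(1) subframe_pos closed_part(1)] by (simp flip: AF.generated_subframe_eq)
  have closed_neg: "frame_map (neg B) neg_assembly (\<lambda>x. \<nabla>\<^bsub>main B\<^esub> (neg_map B x))"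
    using frame_map_closed[OF maps(2) subframe_neg closed_part(3)] by (simp flip: AF.generated_subframe_eq)
  have closed_main: "frame_map (main B) G (\<lambda>x. \<nabla>\<^bsub>main B\<^esub> x)"
  proof -
    have "frame_map (main B) (main B) (\<lambda>x. x)"
      by (rule frame_mapI) (use frame_axioms in auto)
    moreover have "\<nabla>\<^bsub>main B\<^esub> x \<in> carrier G" if "x \<in> carrier (main B)" for x
      by (rule subsetD[OF AF.generators_subset]) (use that in blast)
    ultimately show ?thesis
      using frame_map_closed[where K = "main B" and e = "\<lambda>x. x", OF _ subframe_main]
      by (simp flip: AF.generated_subframe_eq)
  qed

  \<comment> \<open>The map that becomes \<open>f : L \<rightarrow> quot\<close> once it is shown to
    identify everything that \<open>r\<close> identifies.\<close>
  define f0 where "f0 = coproduct_copair quot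
    (\<lambda>x. q (inl (\<nabla>\<^bsub>main B\<^esub> (pos_map B x)))) (\<lambda>y. q (inr (\<nabla>\<^bsub>main B\<^esub> (neg_map B y))))"
  note f0_maps = coproduct_universal[OF
      frame_map_compose[OF closed_pos frame_map_compose[OF coprod_maps(1) frame_map_q]]
      frame_map_compose[OF closed_neg frame_map_compose[OF coprod_maps(2) frame_map_q]],
      folded C_def f0_def]

  \<comment> \<open>Applying \<open>\<nabla>\<close> to both coordinates of each rectangle of
    \<open>U\<close> gives a finite element \<open>X\<close> of the other coproduct. It links the
    value of \<open>f0\<close> in the quotient to the image of \<open>U\<close> in the
    assembly.\<close>
  have lift: "\<exists>X \<in> coprod_fin. f0 U = q X \<and> to_main X = \<nabla>\<^bsub>main B\<^esub> (r U)"
    if U: "U \<in> fin_elements (coproduct_biframe (pos B) (neg B))" for U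
  proof -
    obtain Z where Z: "finite Z" "Z \<subseteq> carrier (pos B) \<times> carrier (neg B)"
      "U = \<Squnion>\<^bsub>C\<^esub>(coproduct_rectangle (pos B) (neg B) ` Z)"
      using U unfolding B.coproduct_fin_elements C_def by blast
    let ?Z = "(\<lambda>(x, y). (\<nabla>\<^bsub>main B\<^esub> (pos_map B x), \<nabla>\<^bsub>main B\<^esub> (neg_map B y))) ` Z"
    have Z': "finite ?Z" "?Z \<subseteq> carrier pos_assembly \<times> carrier neg_assembly"
      using Z(1,2) closed_part(1,3) by auto
    let ?X = "\<Squnion>\<^bsub>coprod\<^esub>(rectangle ` ?Z)"
    have "f0 U = \<Squnion>\<^bsub>quot\<^esub>((\<lambda>(x, y). f0 (coproduct_inl (pos B) (neg B) x) \<sqinter>\<^bsub>quot\<^esub> f0 (coproduct_inr (pos B) (neg B) y)) ` Z)"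
      unfolding Z(3) C_def by (rule B.frame_map_coproduct_rectangles[OF f0_maps(3)[unfolded C_def] Z(2)])
    also have "(\<lambda>(x, y). f0 (coproduct_inl (pos B) (neg B) x) \<sqinter>\<^bsub>quot\<^esub> f0 (coproduct_inr (pos B) (neg B) y)) ` Z
        = (\<lambda>(\<alpha>, \<beta>). q (inl \<alpha>) \<sqinter>\<^bsub>quot\<^esub> q (inr \<beta>)) ` ?Z"
      unfolding image_image[of _ _ Z]
    proof (rule image_cong[OF HOL.refl], goal_cases)
      case (1 z)
      then obtain x y where z: "z = (x, y)" "x \<in> carrier (pos B)" "y \<in> carrier (neg B)" using Z(2) by blast
      then show ?case by (simp only: prod.case f0_maps(4,5))
    qed
    also have "\<Squnion>\<^bsub>quot\<^esub>\<dots> = q ?X"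
      by (rule pair.frame_map_coproduct_rectangles[OF frame_map_q Z'(2), symmetric])
    finally have "f0 U = q ?X" .
    have "to_main ?X = \<Squnion>\<^bsub>G\<^esub>((\<lambda>(\<alpha>, \<beta>). to_main (inl \<alpha>) \<sqinter>\<^bsub>G\<^esub> to_main (inr \<beta>)) ` ?Z)"
      by (rule pair.frame_map_coproduct_rectangles[OF coprod_maps(3) Z'(2)])
    also have "(\<lambda>(\<alpha>, \<beta>). to_main (inl \<alpha>) \<sqinter>\<^bsub>G\<^esub> to_main (inr \<beta>)) ` ?Z
        = (\<lambda>(x, y). \<nabla>\<^bsub>main B\<^esub> (r (coproduct_inl (pos B) (neg B) x)) \<sqinter>\<^bsub>G\<^esub> \<nabla>\<^bsub>main B\<^esub> (r (coproduct_inr (pos B) (neg B) y))) ` Z"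
      unfolding image_image[of _ _ Z]
    proof (rule image_cong[OF HOL.refl], goal_cases)
      case (1 z)
      then obtain x y where z: "z = (x, y)" "x \<in> carrier (pos B)" "y \<in> carrier (neg B)" using Z(2) by blast
      then show ?case by (simp only: prod.case r_maps(4,5) coprod_maps(4,5) closed_part(1,3) imageI)
    qed
    also have "\<Squnion>\<^bsub>G\<^esub>\<dots> = \<nabla>\<^bsub>main B\<^esub> (r U)"
      unfolding Z(3) C_def
      by (rule B.frame_map_coproduct_rectangles[OF frame_map_compose[OF r_maps(3)[unfolded C_def] closed_main] Z(2), symmetric])
    finally have "to_main ?X = \<nabla>\<^bsub>main B\<^esub> (r U)" .
    with \<open>f0 U = q ?X\<close> show ?thesis using coprod_finI[OF Z'] by blast
  qed

  have fin_C: "fin_elements (coproduct_biframe (pos B) (neg B)) \<subseteq> carrier C"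
  proof -
    interpret C: frame C by (rule frame_mapD(1)[OF r_maps(3)])
    show ?thesis
      using B.coproduct_rectangle_carrier unfolding B.coproduct_fin_elements C_def[symmetric] by auto
  qed
  have R_C: "R \<subseteq> carrier C \<times> carrier C" using R fin_C by auto
  \<comment> \<open>A relation of the presentation is an inequality true in \<open>L\<close>, hence
    true in the assembly after \<open>\<nabla>\<close>. Its two sides lift to finite elements, so it
    is among the inequalities imposed on the quotient.\<close>
  have f0_R: "f0 U \<sqsubseteq>\<^bsub>quot\<^esub> f0 V" if UV: "(U, V) \<in> R" for U V
  proof -
    interpret C: frame C by (rule frame_mapD(1)[OF r_maps(3)])
    have c: "U \<in> carrier C" "V \<in> carrier C" using UV R_C by auto
    have "(U \<sqinter>\<^bsub>C\<^esub> V, U) \<in> frame_kernel C r"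
      unfolding kernel_r by (rule frame_congruence_generated(2)[OF C.frame_axioms R_C UV])
    then have "r U \<sqinter>\<^bsub>main B\<^esub> r V = r U"
      using frame_mapD(5)[OF r_maps(3) c] by (simp add: frame_kernel_def)
    moreover have "r U \<in> carrier (main B)" "r V \<in> carrier (main B)"
      using frame_mapD(3)[OF r_maps(3)] c by auto
    ultimately have "\<nabla>\<^bsub>main B\<^esub> (r U) \<sqsubseteq>\<^bsub>G\<^esub> \<nabla>\<^bsub>main B\<^esub> (r V)"
      by (intro frame_map_mono[OF closed_main]) (simp_all add: le_iff_meet_eq)
    moreover have "U \<in> fin_elements (coproduct_biframe (pos B) (neg B))"
      "V \<in> fin_elements (coproduct_biframe (pos B) (neg B))" using UV R by auto
    from lift[OF this(1)] lift[OF this(2)]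
    obtain X Y where "X \<in> coprod_fin" "f0 U = q X" "to_main X = \<nabla>\<^bsub>main B\<^esub> (r U)"
      and "Y \<in> coprod_fin" "f0 V = q Y" "to_main Y = \<nabla>\<^bsub>main B\<^esub> (r V)"
      by (elim bexE conjE)
    ultimately show ?thesis using q_le by simp
  qed
  have f0_ker: "f0 U = f0 V" if "U \<in> carrier C" "V \<in> carrier C" "r U = r V" for U V
  proof -
    have "(U, V) \<in> congruence_generated C R"
      unfolding kernel_r[symmetric] using that by (simp add: frame_kernel_def)
    then have "(U, V) \<in> frame_kernel C f0"
      using congruence_generated_subset_kernel[OF R_C f0_maps(3) f0_R] by blast
    then show ?thesis by (simp add: frame_kernel_def)
  qed
  \<comment> \<open>The image of \<open>r\<close> is a subframe containing both parts, and every
    element of the main component is a join of rectangles.\<close>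
  have surj: "carrier (main B) \<subseteq> r ` carrier C"
  proof
    fix x assume x: "x \<in> carrier (main B)"
    note im = subframeD[OF frame_map_image_subframe[OF r_maps(3)]]
    have "p \<in> r ` carrier C" if "p \<in> pos_part B" for p
    proof -
      obtain u where u: "u \<in> carrier (pos B)" "p = pos_map B u" using \<open>p \<in> pos_part B\<close> by blast
      then have "coproduct_inl (pos B) (neg B) u \<in> carrier C" using B.inl_carrier by (simp add: C_def)
      moreover have "p = r (coproduct_inl (pos B) (neg B) u)" using u r_maps(4) by simp
      ultimately show ?thesis by blast
    qed
    moreover have "n \<in> r ` carrier C" if "n \<in> neg_part B" for n
    proof -
      obtain u where u: "u \<in> carrier (neg B)" "n = neg_map B u" using \<open>n \<in> neg_part B\<close> by blast
      then have "coproduct_inr (pos B) (neg B) u \<in> carrier C" using B.inr_carrier by (simp add: C_def)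
      moreover have "n = r (coproduct_inr (pos B) (neg B) u)" using u r_maps(5) by simp
      ultimately show ?thesis by blast
    qed
    ultimately have "rects \<subseteq> r ` carrier C" unfolding rects_def using im(3) by blast
    moreover obtain S where "S \<subseteq> rects" "x = \<Squnion>\<^bsub>main B\<^esub>S" using decompose[OF x] unfolding rects_def by blast
    ultimately show "x \<in> r ` carrier C" using im(4)[of S] by simp
  qed
  obtain f where f: "frame_map (main B) quot f" and f_r: "\<forall>U \<in> carrier C. f (r U) = f0 U"
    using frame_map_factor[OF r_maps(3) surj f0_maps(3) f0_ker] by blast
  have "f p = q (inl (\<nabla>\<^bsub>main B\<^esub> p))" if p: "p \<in> pos_part B" for p
  proof -
    obtain u where u: "u \<in> carrier (pos B)" "p = pos_map B u" using p by blast
    then have "coproduct_inl (pos B) (neg B) u \<in> carrier C" using B.inl_carrier by (simp add: C_def)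
    then have "f (r (coproduct_inl (pos B) (neg B) u)) = f0 (coproduct_inl (pos B) (neg B) u)" using f_r by blast
    then show ?thesis using r_maps(4)[OF u(1)] f0_maps(4)[OF u(1)] u(2) by simp
  qed
  moreover have "f n = q (inr (\<nabla>\<^bsub>main B\<^esub> n))" if n: "n \<in> neg_part B" for n
  proof -
    obtain u where u: "u \<in> carrier (neg B)" "n = neg_map B u" using n by blast
    then have "coproduct_inr (pos B) (neg B) u \<in> carrier C" using B.inr_carrier by (simp add: C_def)
    then have "f (r (coproduct_inr (pos B) (neg B) u)) = f0 (coproduct_inr (pos B) (neg B) u)" using f_r by blast
    then show ?thesis using r_maps(5)[OF u(1)] f0_maps(5)[OF u(1)] u(2) by simp
  qed
  ultimately have kernel: "frame_kernel coprod to_main = fin_congruence"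
    by (rule kernel_to_main[OF f])
  have sel: "pos (assembly B) = pos_assembly" "neg (assembly B) = neg_assembly" "main (assembly B) = G"
    "pos_map (assembly B) = (\<lambda>\<theta>. \<theta>)" "neg_map (assembly B) = (\<lambda>\<theta>. \<theta>)"
    by (simp_all add: assembly_def Let_def fin_elements_eq[OF B])
  have "coproduct_congruence (assembly B) = congruence_generated coprod fin_inequalities"
    unfolding coproduct_congruence_def sel kernel[unfolded to_main_def] fin_congruence_def ..
  moreover have "main (coproduct_biframe pos_assembly neg_assembly) = coprod"
    by (simp add: coproduct_biframe_def)
  moreover have "fin_inequalities \<subseteq> coprod_fin \<times> coprod_fin" by (auto simp: fin_inequalities_def)
  ultimately show ?thesis
    unfolding finitary_biframe_def finitary_congruence_def sel using biframe_assembly[OF B] by auto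
qed

end
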